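(* Let $(R,\mathfrak{m},k)$ be a local ring of prime characteristic $p>0$ and let $x\in\mathfrak{m}$ be a regular element. Suppose that $R/xR$ is $F$-injective and that for each $\ell>0$ and each $i\ge 0$ the homomorphism $H^i_{\mathfrak{m}}(R/x^\ell R)\to H^i_{\mathfrak{m}}(R/xR)$ induced by the natural surjection $R/x^\ell R\to R/xR$ is surjective. Then $R$ is $F$-injective.
   Context: All rings are commutative and noetherian. $H^i_{\mathfrak{m}}(-)$ denotes the $i$-th local cohomology module with support in $\mathfrak{m}$. A regular element is a nonzerodivisor. A local ring $(A,\mathfrak{n})$ of prime characteristic $p>0$ is called $F$-injective if for every $i\ge 0$ the Frobenius action on $H^i_{\mathfrak{n}}(A)$ (the additive, $p$-linear map induced by the Frobenius map $a\mapsto a^p$ of $A$, e.g. by applying Frobenius termwise to the Čech complex) is injective. *)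

theory Defs
  imports "HOL-Algebra.Module" "HOL-Algebra.QuotRing" "HOL-Algebra.Ring_Divisibility" "HOL-Computational_Algebra.Primes"
begin

section \<open>Local rings, characteristic, regular elements\<close>

locale local_ring = cring R + noetherian_ring R + maximalideal \<mm> R
  for R (structure) and \<mm> +
  assumes unique_maximal: "maximalideal J R \<Longrightarrow> J = \<mm>"

definition has_char :: "('a, 'b) ring_scheme \<Rightarrow> nat \<Rightarrow> bool" where
  "has_char R p \<longleftrightarrow> (\<forall>n::nat. add_pow R n \<one>\<^bsub>R\<^esub> = \<zero>\<^bsub>R\<^esub> \<longleftrightarrow> p dvd n)"

definition regular_elem :: "('a, 'b) ring_scheme \<Rightarrow> 'a \<Rightarrow> bool" where
  "regular_elem R x \<longleftrightarrow>
     x \<in> carrier R \<and> (\<forall>a\<in>carrier R. x \<otimes>\<^bsub>R\<^esub> a = \<zero>\<^bsub>R\<^esub> \<longrightarrow> a = \<zero>\<^bsub>R\<^esub>)"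

definition generates :: "('a, 'b) ring_scheme \<Rightarrow> 'a list \<Rightarrow> 'a set \<Rightarrow> bool" where
  "generates R fs I \<longleftrightarrow> set fs \<subseteq> carrier R \<and> Idl\<^bsub>R\<^esub> (set fs) = I"

lemma (in noetherian_ring) generates_exists:
  assumes "ideal I R"
  shows "\<exists>fs. generates R fs I"
proof -
  obtain A where "A \<subseteq> carrier R" "finite A" "I = Idl A"
    using finetely_gen[OF assms] by blast
  moreover obtain fs where "set fs = A"
    using finite_list[OF \<open>finite A\<close>] by blast
  ultimately show ?thesis
    unfolding generates_def by blast
qed


section \<open>Modules\<close>

text \<open>The ring \<open>A\<close> as a module over \<open>R\<close> along a homomorphism \<open>\<phi>\<close> from \<open>R\<close> to \<open>A\<close>.\<close>

definition ring_module :: "('c, 'd) ring_scheme \<Rightarrow> ('a \<Rightarrow> 'c) \<Rightarrow> ('a, 'c) module" where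
  "ring_module A \<phi> = \<lparr>carrier = carrier A, mult = mult A, one = one A, zero = zero A,
     add = add A, smult = (\<lambda>r a. \<phi> r \<otimes>\<^bsub>A\<^esub> a)\<rparr>"

definition quotient_ring_module :: "('a, 'b) ring_scheme \<Rightarrow> 'a set \<Rightarrow> ('a, 'a set) module" where
  "quotient_ring_module R I = ring_module (R Quot I) (\<lambda>r. I +>\<^bsub>R\<^esub> r)"

text \<open>The record type of modules extends that of rings; the fields \<open>mult\<close> and \<open>one\<close> of a module
  carry no information and are left undefined below.\<close>

definition quotient_module :: "('a, 'm) module \<Rightarrow> 'm set \<Rightarrow> ('a, 'm set) module" where
  "quotient_module M N = \<lparr>carrier = a_rcosets\<^bsub>M\<^esub> N, mult = undefined, one = undefined, zero = N,
     add = set_add M, smult = (\<lambda>r X. \<Union>m\<in>X. N +>\<^bsub>M\<^esub> (r \<odot>\<^bsub>M\<^esub> m))\<rparr>"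


section \<open>Localization of a module at the powers of one element\<close>

text \<open>The fraction \<open>m / f\<^sup>a\<close> is represented by the pair \<open>(m, a)\<close>.\<close>

definition frac_rel ::
  "('a, 'b) ring_scheme \<Rightarrow> ('a, 'm) module \<Rightarrow> 'a \<Rightarrow> (('m \<times> nat) \<times> ('m \<times> nat)) set" where
  "frac_rel R M f = {((m, a), (m', b)). m \<in> carrier M \<and> m' \<in> carrier M \<and>
     (\<exists>c. (f [^]\<^bsub>R\<^esub> (c + b)) \<odot>\<^bsub>M\<^esub> m = (f [^]\<^bsub>R\<^esub> (c + a)) \<odot>\<^bsub>M\<^esub> m')}"

definition frac ::
  "('a, 'b) ring_scheme \<Rightarrow> ('a, 'm) module \<Rightarrow> 'a \<Rightarrow> 'm \<times> nat \<Rightarrow> ('m \<times> nat) set" where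
  "frac R M f q = frac_rel R M f `` {q}"

definition localization ::
  "('a, 'b) ring_scheme \<Rightarrow> ('a, 'm) module \<Rightarrow> 'a \<Rightarrow> ('a, ('m \<times> nat) set) module" where
  "localization R M f = \<lparr>carrier = (carrier M \<times> UNIV) // frac_rel R M f,
     mult = undefined, one = undefined, zero = frac R M f (\<zero>\<^bsub>M\<^esub>, 0),
     add = (\<lambda>X Y. \<Union>(m, a)\<in>X. \<Union>(m', b)\<in>Y. frac R M f
              ((f [^]\<^bsub>R\<^esub> b) \<odot>\<^bsub>M\<^esub> m \<oplus>\<^bsub>M\<^esub> (f [^]\<^bsub>R\<^esub> a) \<odot>\<^bsub>M\<^esub> m', a + b)),
     smult = (\<lambda>r X. \<Union>(m, a)\<in>X. frac R M f (r \<odot>\<^bsub>M\<^esub> m, a))\<rparr>"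

text \<open>The map into the localization \<open>N\<^sub>f\<close> that a map \<open>g\<close> between representatives induces
  on fractions; a union over representatives that all give the same class.\<close>

definition frac_map ::
  "('a, 'b) ring_scheme \<Rightarrow> ('a, 'n) module \<Rightarrow> 'a \<Rightarrow> ('m \<times> nat \<Rightarrow> 'n \<times> nat)
    \<Rightarrow> ('m \<times> nat) set \<Rightarrow> ('n \<times> nat) set" where
  "frac_map R N f g X = (\<Union>q\<in>X. frac R N f (g q))"

text \<open>The canonical map from \<open>M\<^sub>f\<close> to \<open>M\<^sub>f\<^sub>h\<close>, sending \<open>m / f\<^sup>a\<close> to \<open>h\<^sup>a m / (f h)\<^sup>a\<close>.\<close>

definition loc_map ::
  "('a, 'b) ring_scheme \<Rightarrow> ('a, 'm) module \<Rightarrow> 'a \<Rightarrow> 'a \<Rightarrow> ('m \<times> nat) set \<Rightarrow> ('m \<times> nat) set" where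
  "loc_map R M f h = frac_map R M (f \<otimes>\<^bsub>R\<^esub> h) (\<lambda>(m, a). ((h [^]\<^bsub>R\<^esub> a) \<odot>\<^bsub>M\<^esub> m, a))"


section \<open>The Cech complex and local cohomology\<close>

definition cech_index :: "'a list \<Rightarrow> nat \<Rightarrow> nat set set" where
  "cech_index fs i = {T. T \<subseteq> {..<length fs} \<and> card T = i}"

definition cech_elem :: "('a, 'b) ring_scheme \<Rightarrow> 'a list \<Rightarrow> nat set \<Rightarrow> 'a" where
  "cech_elem R fs T = finprod R (\<lambda>j. fs ! j) T"

abbreviation cech_loc ::
  "('a, 'b) ring_scheme \<Rightarrow> 'a list \<Rightarrow> ('a, 'm) module \<Rightarrow> nat set \<Rightarrow> ('a, ('m \<times> nat) set) module" where
  "cech_loc R fs M T \<equiv> localization R M (cech_elem R fs T)"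

definition cech_module ::
  "('a, 'b) ring_scheme \<Rightarrow> 'a list \<Rightarrow> ('a, 'm) module \<Rightarrow> nat
    \<Rightarrow> ('a, nat set \<Rightarrow> ('m \<times> nat) set) module" where
  "cech_module R fs M i = \<lparr>carrier = (\<Pi>\<^sub>E T\<in>cech_index fs i. carrier (cech_loc R fs M T)),
     mult = undefined, one = undefined,
     zero = (\<lambda>T\<in>cech_index fs i. \<zero>\<^bsub>cech_loc R fs M T\<^esub>),
     add = (\<lambda>c d. \<lambda>T\<in>cech_index fs i. c T \<oplus>\<^bsub>cech_loc R fs M T\<^esub> d T),
     smult = (\<lambda>r c. \<lambda>T\<in>cech_index fs i. r \<odot>\<^bsub>cech_loc R fs M T\<^esub> c T)\<rparr>"

definition cech_diff ::
  "('a, 'b) ring_scheme \<Rightarrow> 'a list \<Rightarrow> ('a, 'm) module \<Rightarrow> nat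
    \<Rightarrow> (nat set \<Rightarrow> ('m \<times> nat) set) \<Rightarrow> (nat set \<Rightarrow> ('m \<times> nat) set)" where
  "cech_diff R fs M i c = (\<lambda>T\<in>cech_index fs (Suc i).
     finsum (cech_loc R fs M T)
       (\<lambda>j. let y = loc_map R M (cech_elem R fs (T - {j})) (fs ! j) (c (T - {j}))
            in if even (card {k\<in>T. k < j}) then y else \<ominus>\<^bsub>cech_loc R fs M T\<^esub> y) T)"

definition cech_cocycles ::
  "('a, 'b) ring_scheme \<Rightarrow> 'a list \<Rightarrow> ('a, 'm) module \<Rightarrow> nat
    \<Rightarrow> (nat set \<Rightarrow> ('m \<times> nat) set) set" where
  "cech_cocycles R fs M i = {c \<in> carrier (cech_module R fs M i).
     cech_diff R fs M i c = \<zero>\<^bsub>cech_module R fs M (Suc i)\<^esub>}"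

definition cech_coboundaries ::
  "('a, 'b) ring_scheme \<Rightarrow> 'a list \<Rightarrow> ('a, 'm) module \<Rightarrow> nat
    \<Rightarrow> (nat set \<Rightarrow> ('m \<times> nat) set) set" where
  "cech_coboundaries R fs M i = (case i of
       0 \<Rightarrow> {\<zero>\<^bsub>cech_module R fs M 0\<^esub>}
     | Suc j \<Rightarrow> cech_diff R fs M j ` carrier (cech_module R fs M j))"

text \<open>\<open>H\<^sup>i\<^sub>I(M)\<close> for the ideal \<open>I\<close> generated by \<open>fs\<close>. Up to canonical isomorphism it depends
  only on \<open>I\<close>. Statements about \<open>H\<^sup>i\<^sub>I\<close> are made for every finite generating family of \<open>I\<close>, so
  that none is singled out; by \<open>generates_exists\<close> there is one over a noetherian ring.\<close>

definition local_cohomology ::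
  "('a, 'b) ring_scheme \<Rightarrow> 'a list \<Rightarrow> ('a, 'm) module \<Rightarrow> nat
    \<Rightarrow> ('a, (nat set \<Rightarrow> ('m \<times> nat) set) set) module" where
  "local_cohomology R fs M i =
     quotient_module ((cech_module R fs M i)\<lparr>carrier := cech_cocycles R fs M i\<rparr>)
       (cech_coboundaries R fs M i)"

text \<open>The maps into the Cech complex of \<open>N\<close>, and into its cohomology, that are given termwise by
  a map \<open>g\<close> between representatives of fractions.\<close>

definition cech_map ::
  "('a, 'b) ring_scheme \<Rightarrow> 'a list \<Rightarrow> ('a, 'n) module \<Rightarrow> ('m \<times> nat \<Rightarrow> 'n \<times> nat) \<Rightarrow> nat
    \<Rightarrow> (nat set \<Rightarrow> ('m \<times> nat) set) \<Rightarrow> (nat set \<Rightarrow> ('n \<times> nat) set)" where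
  "cech_map R fs N g i c =
     (\<lambda>T\<in>cech_index fs i. frac_map R N (cech_elem R fs T) g (c T))"

definition cohomology_map ::
  "('a, 'b) ring_scheme \<Rightarrow> 'a list \<Rightarrow> ('a, 'n) module \<Rightarrow> ('m \<times> nat \<Rightarrow> 'n \<times> nat) \<Rightarrow> nat
    \<Rightarrow> (nat set \<Rightarrow> ('m \<times> nat) set) set \<Rightarrow> (nat set \<Rightarrow> ('n \<times> nat) set) set" where
  "cohomology_map R fs N g i X =
     (\<Union>c\<in>X. cech_coboundaries R fs N i +>\<^bsub>cech_module R fs N i\<^esub> cech_map R fs N g i c)"

text \<open>The homomorphism \<open>H\<^sup>i\<^sub>I(\<phi>)\<close> into \<open>H\<^sup>i\<^sub>I(N)\<close> induced by a module homomorphism \<open>\<phi>\<close> into \<open>N\<close>.\<close>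

definition local_cohomology_hom ::
  "('a, 'b) ring_scheme \<Rightarrow> 'a list \<Rightarrow> ('a, 'n) module \<Rightarrow> ('m \<Rightarrow> 'n) \<Rightarrow> nat
    \<Rightarrow> (nat set \<Rightarrow> ('m \<times> nat) set) set \<Rightarrow> (nat set \<Rightarrow> ('n \<times> nat) set) set" where
  "local_cohomology_hom R fs N \<phi> i = cohomology_map R fs N (\<lambda>(m, a). (\<phi> m, a)) i"


section \<open>F-injectivity\<close>

abbreviation self_module :: "('a, 'b) ring_scheme \<Rightarrow> ('a, 'a) module" where
  "self_module A \<equiv> ring_module A (\<lambda>a. a)"

text \<open>On each localization Frobenius sends \<open>a / f\<^sup>n\<close> to \<open>a\<^sup>p / f\<^sup>p\<^sup>n\<close>.\<close>

definition frobenius_action ::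
  "nat \<Rightarrow> ('a, 'b) ring_scheme \<Rightarrow> 'a list \<Rightarrow> nat
    \<Rightarrow> (nat set \<Rightarrow> ('a \<times> nat) set) set \<Rightarrow> (nat set \<Rightarrow> ('a \<times> nat) set) set" where
  "frobenius_action p A fs i =
     cohomology_map A fs (self_module A) (\<lambda>(a, n). (a [^]\<^bsub>A\<^esub> p, p * n)) i"

definition F_injective :: "nat \<Rightarrow> ('a, 'b) ring_scheme \<Rightarrow> 'a set \<Rightarrow> bool" where
  "F_injective p A \<nn> \<longleftrightarrow> local_ring A \<nn> \<and> prime p \<and> has_char A p \<and>
     (\<forall>fs. generates A fs \<nn> \<longrightarrow>
       (\<forall>i. inj_on (frobenius_action p A fs i)
              (carrier (local_cohomology A fs (self_module A) i))))"


section \<open>The natural surjection between quotient rings\<close>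

text \<open>For ideals \<open>I \<subseteq> J\<close>, the map from \<open>R / I\<close> to \<open>R / J\<close> sending the class of \<open>a\<close> to the class
  of \<open>a\<close>.\<close>

definition quotient_proj :: "('a, 'b) ring_scheme \<Rightarrow> 'a set \<Rightarrow> 'a set \<Rightarrow> 'a set" where
  "quotient_proj R J X = (\<Union>a\<in>X. J +>\<^bsub>R\<^esub> a)"

end

theory Submission
  imports Defs
begin

text \<open>All cohomology classes are handled through cocycles of the Cech complex \<open>C\<close> of \<open>R\<close>, on which
  \<open>x\<close> is regular. Since \<open>C(R/I)\<close> is \<open>C / I C\<close> for a principal ideal \<open>I\<close>, every statement about
  \<open>R / x\<^sup>l R\<close> becomes a congruence in \<open>C\<close>.

  A cocycle \<open>\<eta>\<close> of \<open>C\<close> is \<open>x\<close>-power torsion modulo coboundaries, say \<open>x\<^sup>k \<eta> = d \<theta>\<close>. The surjectivity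
  hypothesis permits replacing \<open>\<theta>\<close>, modulo \<open>x C\<close> and coboundaries, by some \<open>\<theta>'\<close> with \<open>d \<theta>'\<close> divisible
  by \<open>x\<^sup>k\<^sup>+\<^sup>1\<close>; dividing by \<open>x\<close> lowers \<open>k\<close>, so that \<open>\<eta>\<close> is a coboundary modulo \<open>x C\<close> (this is the
  injectivity of the connecting maps from \<open>H\<^sup>i(R/x)\<close> to \<open>H\<^sup>i\<^sup>+\<^sup>1(R)\<close>).

  Now let \<open>F \<xi> = d \<omega>\<close>. Multiplying \<open>\<xi>\<close> by a power of \<open>x\<close>, one may assume \<open>x \<xi> = d \<theta>\<close>. Then
  \<open>F \<theta> - x\<^sup>p \<omega>\<close> is a cocycle, hence a coboundary modulo \<open>x C\<close>, and so is \<open>F \<theta>\<close>. As \<open>R/x\<close> is F-injective,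
  \<open>\<theta>\<close> is a coboundary modulo \<open>x C\<close>, and dividing \<open>x \<xi> = d \<theta>\<close> by \<open>x\<close> shows that \<open>\<xi>\<close> is a coboundary.\<close>


section \<open>Localization of a module at one element\<close>

text \<open>The hypotheses on \<open>R/x\<close> live on different complexes: F-injectivity concerns
  the ring \<open>R/x\<close> over itself with the images of the generators, the surjections concern
  \<open>R\<close>-modules. Both are reached by reducing cochains of \<open>R\<close>, so maps are
  treated once for a change of ring \<open>\<phi>\<close> and an exponent \<open>q\<close>, with
  \<open>q = p\<close> for Frobenius and \<open>q = 1\<close> for linear maps. Since
  \<open>x\<close> need not be one of the generators, torsion is proved for each generator and then
  passed to \<open>x\<close>; characteristic \<open>p\<close> gives this passage cheaply. The
  exponent \<open>k\<close> that kills a class depends on the class, hence surjectivity is asked for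
  every power of \<open>x\<close>. No long exact sequence is formed. A regular \<open>x\<close>
  stays regular on cochains, and cancelling \<open>x\<close> in a cochain equation does the work of
  the connecting map. That map is not compatible with Frobenius as it stands:
  \<open>F (x \<xi>) = x^p F \<xi>\<close>. The excess \<open>x^p \<omega>\<close> is harmless
  because \<open>p > 0\<close> makes it vanish modulo \<open>x\<close>. In degree 0 the only
  coboundary is zero, so torsion and regularity leave no nonzero cocycle there.\<close>

locale plain_module = module R M
  for R :: "('a, 'b) ring_scheme" (structure) and M :: "('a, 'm) module" (structure)
begin

lemma smult_pow_add:
  assumes "f \<in> carrier R" "m \<in> carrier M"
  shows "f [^] (a::nat) \<odot>\<^bsub>M\<^esub> (f [^] (b::nat) \<odot>\<^bsub>M\<^esub> m) = f [^] (a + b) \<odot>\<^bsub>M\<^esub> m"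
  using assms by (simp add: smult_assoc1[symmetric] nat_pow_mult)

lemma smult_left_commute:
  assumes "r \<in> carrier R" "s \<in> carrier R" "m \<in> carrier M"
  shows "r \<odot>\<^bsub>M\<^esub> (s \<odot>\<^bsub>M\<^esub> m) = s \<odot>\<^bsub>M\<^esub> (r \<odot>\<^bsub>M\<^esub> m)"
  using assms by (metis m_comm smult_assoc1)

lemma frac_rel_equiv:
  assumes f: "f \<in> carrier R"
  shows "equiv (carrier M \<times> UNIV) (frac_rel R M f)"
proof (rule equivI)
  show "frac_rel R M f \<subseteq> (carrier M \<times> UNIV) \<times> (carrier M \<times> UNIV)"
    by (auto simp: frac_rel_def)
  show "refl_on (carrier M \<times> UNIV) (frac_rel R M f)"
    by (auto simp: frac_rel_def refl_on_def)
  show "sym (frac_rel R M f)"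
    by (rule symI) (auto simp: frac_rel_def intro: sym)
  show "trans (frac_rel R M f)"
  proof (rule transI)
    fix u v w
    assume "(u, v) \<in> frac_rel R M f" "(v, w) \<in> frac_rel R M f"
    then obtain m a m' b m'' e c d
      where uvw: "u = (m, a)" "v = (m', b)" "w = (m'', e)"
        and m: "m \<in> carrier M" "m' \<in> carrier M" "m'' \<in> carrier M"
        and c: "f [^] (c + b) \<odot>\<^bsub>M\<^esub> m = f [^] (c + a) \<odot>\<^bsub>M\<^esub> m'"
        and d: "f [^] (d + e) \<odot>\<^bsub>M\<^esub> m' = f [^] (d + b) \<odot>\<^bsub>M\<^esub> m''"
      by (auto simp: frac_rel_def)
    \<comment> \<open>The witness \<open>c + d + b\<close> arises by multiplying the first relation
      by \<open>f^(d+e)\<close> and the second by \<open>f^(c+a)\<close>: both then contain the same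
      multiple of \<open>m'\<close>, and the middle denominator \<open>b\<close> is
      absorbed.\<close>
    have "f [^] ((c + d + b) + e) \<odot>\<^bsub>M\<^esub> m = f [^] (d + e) \<odot>\<^bsub>M\<^esub> (f [^] (c + b) \<odot>\<^bsub>M\<^esub> m)"
      using f m by (simp add: smult_pow_add ac_simps)
    also have "\<dots> = f [^] (c + a) \<odot>\<^bsub>M\<^esub> (f [^] (d + e) \<odot>\<^bsub>M\<^esub> m')"
      unfolding c using f m by (simp add: smult_left_commute)
    also have "\<dots> = f [^] ((c + d + b) + a) \<odot>\<^bsub>M\<^esub> m''"
      unfolding d using f m by (simp add: smult_pow_add ac_simps)
    finally show "(u, w) \<in> frac_rel R M f"
      unfolding frac_rel_def uvw using m by blast
  qed
qed

lemma frac_eq_iff: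
  assumes "f \<in> carrier R" "m \<in> carrier M" "m' \<in> carrier M"
  shows "frac R M f (m, a) = frac R M f (m', b) \<longleftrightarrow>
    (\<exists>c. f [^] (c + b) \<odot>\<^bsub>M\<^esub> m = f [^] (c + a) \<odot>\<^bsub>M\<^esub> m')"
proof -
  have "frac R M f (m, a) = frac R M f (m', b) \<longleftrightarrow> ((m, a), (m', b)) \<in> frac_rel R M f"
    unfolding frac_def using frac_rel_equiv assms
    by (intro eq_equiv_class_iff) auto
  then show ?thesis
    using assms by (auto simp: frac_rel_def)
qed

lemma frac_cancel:
  assumes "f \<in> carrier R" "m \<in> carrier M"
  shows "frac R M f (f [^] (c::nat) \<odot>\<^bsub>M\<^esub> m, a + c) = frac R M f (m, a)"
  using assms by (auto simp: frac_eq_iff smult_pow_add ac_simps)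

lemma mem_frac_iff:
  assumes "f \<in> carrier R" "m \<in> carrier M"
  shows "(m', b) \<in> frac R M f (m, a) \<longleftrightarrow> m' \<in> carrier M \<and> frac R M f (m', b) = frac R M f (m, a)"
proof -
  have "(m', b) \<in> frac R M f (m, a) \<longleftrightarrow> ((m', b), (m, a)) \<in> frac_rel R M f"
    using frac_rel_equiv[OF assms(1)] by (auto simp: frac_def elim!: equivE dest: symD)
  moreover have "m' \<in> carrier M \<Longrightarrow>
      frac R M f (m', b) = frac R M f (m, a) \<longleftrightarrow> ((m', b), (m, a)) \<in> frac_rel R M f"
    unfolding frac_def using frac_rel_equiv assms
    by (intro eq_equiv_class_iff) auto
  moreover have "((m', b), (m, a)) \<in> frac_rel R M f \<Longrightarrow> m' \<in> carrier M"
    by (simp add: frac_rel_def)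
  ultimately show ?thesis by blast
qed

text \<open>Operations on fractions are defined as unions over representatives. A body that is
  constant on a class has that constant as its union, so each operation is evaluated by comparing
  two representatives.\<close>

lemma UN_frac:
  assumes "f \<in> carrier R" "m \<in> carrier M"
    and "\<And>m' b. \<lbrakk>m' \<in> carrier M; frac R M f (m', b) = frac R M f (m, a)\<rbrakk> \<Longrightarrow> B (m', b) = B (m, a)"
  shows "(\<Union>q\<in>frac R M f (m, a). B q) = B (m, a)"
proof -
  have "B q = B (m, a)" if "q \<in> frac R M f (m, a)" for q
    using that assms by (metis mem_frac_iff surj_pair)
  moreover have "(m, a) \<in> frac R M f (m, a)"
    using assms by (simp add: mem_frac_iff)
  ultimately show ?thesis by blast
qed

lemma carrier_localization:
  "carrier (localization R M f) = {frac R M f (m, a) |m a. m \<in> carrier M}"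
  by (auto simp: localization_def quotient_def frac_def)

lemma frac_closed [simp]:
  "m \<in> carrier M \<Longrightarrow> frac R M f (m, a) \<in> carrier (localization R M f)"
  by (auto simp: carrier_localization)

lemma localization_cases:
  assumes "X \<in> carrier (localization R M f)"
  obtains m a where "m \<in> carrier M" "X = frac R M f (m, a)"
  using assms by (auto simp: carrier_localization)

text \<open>With a common denominator the operations on fractions act on numerators.\<close>

lemma localization_cases2:
  assumes "f \<in> carrier R" "X \<in> carrier (localization R M f)" "Y \<in> carrier (localization R M f)"
  obtains m m' a where "m \<in> carrier M" "m' \<in> carrier M"
    "X = frac R M f (m, a)" "Y = frac R M f (m', a)"
proof -
  obtain m a m' b where "m \<in> carrier M" "m' \<in> carrier M"
      "X = frac R M f (m, a)" "Y = frac R M f (m', b)"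
    using assms(2,3) by (auto elim!: localization_cases)
  then show thesis
    using that[of "f [^] b \<odot>\<^bsub>M\<^esub> m" "f [^] a \<odot>\<^bsub>M\<^esub> m'" "a + b"] assms(1)
      frac_cancel[of f m b a] frac_cancel[of f m' a b]
    by (simp add: add.commute)
qed

lemma localization_cases3:
  assumes f: "f \<in> carrier R" and "X \<in> carrier (localization R M f)"
    "Y \<in> carrier (localization R M f)" "Z \<in> carrier (localization R M f)"
  obtains m m' m'' a where "m \<in> carrier M" "m' \<in> carrier M" "m'' \<in> carrier M"
    "X = frac R M f (m, a)" "Y = frac R M f (m', a)" "Z = frac R M f (m'', a)"
proof -
  obtain m a m' m'' b where *: "m \<in> carrier M" "m' \<in> carrier M" "m'' \<in> carrier M"
      "X = frac R M f (m, a)" "Y = frac R M f (m', b)" "Z = frac R M f (m'', b)"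
    using localization_cases[OF assms(2)] localization_cases2[OF f assms(3,4)] by metis
  then show thesis
    using that[of "f [^] b \<odot>\<^bsub>M\<^esub> m" "f [^] a \<odot>\<^bsub>M\<^esub> m'" "f [^] a \<odot>\<^bsub>M\<^esub> m''" "a + b"] f
      frac_cancel[OF f *(1), of b a] frac_cancel[OF f *(2), of a b] frac_cancel[OF f *(3), of a b]
    by (simp add: add.commute)
qed

text \<open>Independence of the representative is checked in the first argument only
  (\<open>wd\<close>); the symmetry \<open>comm\<close> carries it to the second, and the double
  union collapses from the inside outwards.\<close>

lemma add_frac:
  assumes f: "f \<in> carrier R" and m: "m \<in> carrier M" and m': "m' \<in> carrier M"
  shows "frac R M f (m, a) \<oplus>\<^bsub>localization R M f\<^esub> frac R M f (m', b) =
    frac R M f (f [^] b \<odot>\<^bsub>M\<^esub> m \<oplus>\<^bsub>M\<^esub> f [^] a \<odot>\<^bsub>M\<^esub> m', a + b)"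
proof -
  define B where "B = (\<lambda>(n, i) (n', j). frac R M f (f [^] j \<odot>\<^bsub>M\<^esub> n \<oplus>\<^bsub>M\<^esub> f [^] i \<odot>\<^bsub>M\<^esub> n', i + j))"
  have comm: "B (n, i) (n', j) = B (n', j) (n, i)"
    if "n \<in> carrier M" "n' \<in> carrier M" for n i n' j
    using that f by (simp add: B_def M.a_comm add.commute)
  have wd: "B (n, i) (n'', k) = B (n', j) (n'', k)"
    if n: "n \<in> carrier M" "n' \<in> carrier M" "n'' \<in> carrier M"
      and eq: "frac R M f (n, i) = frac R M f (n', j)" for n i n' j n'' k
  proof -
    obtain c where c: "f [^] (c + j) \<odot>\<^bsub>M\<^esub> n = f [^] (c + i) \<odot>\<^bsub>M\<^esub> n'"
      using eq n f by (auto simp: frac_eq_iff)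
    \<comment> \<open>Multiplying the relation \<open>c\<close> by \<open>f^(2k)\<close> fits it to
      the new denominators \<open>i + k\<close> and \<open>j + k\<close>. The summands with
      \<open>n''\<close> then need no relation, both being \<open>f^(c+i+j+k) n''\<close>.\<close>
    have "f [^] (c + (j + k)) \<odot>\<^bsub>M\<^esub> (f [^] k \<odot>\<^bsub>M\<^esub> n) = f [^] (k + k) \<odot>\<^bsub>M\<^esub> (f [^] (c + j) \<odot>\<^bsub>M\<^esub> n)"
      using f n by (simp add: smult_pow_add ac_simps)
    also have "\<dots> = f [^] (c + (i + k)) \<odot>\<^bsub>M\<^esub> (f [^] k \<odot>\<^bsub>M\<^esub> n')"
      unfolding c using f n by (simp add: smult_pow_add ac_simps)
    finally have "f [^] (c + (j + k)) \<odot>\<^bsub>M\<^esub> (f [^] k \<odot>\<^bsub>M\<^esub> n \<oplus>\<^bsub>M\<^esub> f [^] i \<odot>\<^bsub>M\<^esub> n'') =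
      f [^] (c + (i + k)) \<odot>\<^bsub>M\<^esub> (f [^] k \<odot>\<^bsub>M\<^esub> n' \<oplus>\<^bsub>M\<^esub> f [^] j \<odot>\<^bsub>M\<^esub> n'')"
      using f n by (simp add: smult_r_distr smult_pow_add ac_simps)
    then show ?thesis
      unfolding B_def using f n by (auto simp: frac_eq_iff)
  qed
  have inner: "(\<Union>q'\<in>frac R M f (m', b). B (n, i) q') = B (n, i) (m', b)"
    if n: "n \<in> carrier M" for n i
  proof (rule UN_frac)
    fix k j assume "k \<in> carrier M" "frac R M f (k, j) = frac R M f (m', b)"
    then show "B (n, i) (k, j) = B (n, i) (m', b)"
      using comm wd n m' by metis
  qed (use f m' in auto)
  have "frac R M f (m, a) \<oplus>\<^bsub>localization R M f\<^esub> frac R M f (m', b) =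
     (\<Union>q\<in>frac R M f (m, a). \<Union>q'\<in>frac R M f (m', b). B q q')"
    by (simp add: localization_def B_def case_prod_unfold)
  also have "\<dots> = (\<Union>q\<in>frac R M f (m, a). B q (m', b))"
    using inner f m by (intro SUP_cong refl) (metis mem_frac_iff surj_pair)
  also have "\<dots> = B (m, a) (m', b)"
    by (rule UN_frac[OF f m]) (rule wd[OF _ m m'])
  finally show ?thesis by (simp add: B_def)
qed

lemma add_frac_same:
  assumes "f \<in> carrier R" "m \<in> carrier M" "m' \<in> carrier M"
  shows "frac R M f (m, a) \<oplus>\<^bsub>localization R M f\<^esub> frac R M f (m', a) = frac R M f (m \<oplus>\<^bsub>M\<^esub> m', a)"
  using assms frac_cancel[of f "m \<oplus>\<^bsub>M\<^esub> m'" a a] by (simp add: add_frac smult_r_distr)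

lemma smult_frac:
  assumes f: "f \<in> carrier R" and r: "r \<in> carrier R" and m: "m \<in> carrier M"
  shows "r \<odot>\<^bsub>localization R M f\<^esub> frac R M f (m, a) = frac R M f (r \<odot>\<^bsub>M\<^esub> m, a)"
proof -
  have "(\<Union>q\<in>frac R M f (m, a). (\<lambda>(m, a). frac R M f (r \<odot>\<^bsub>M\<^esub> m, a)) q) =
      (\<lambda>(m, a). frac R M f (r \<odot>\<^bsub>M\<^esub> m, a)) (m, a)"
  proof (rule UN_frac)
    fix m' b assume m': "m' \<in> carrier M" and "frac R M f (m', b) = frac R M f (m, a)"
    then obtain c where "f [^] (c + a) \<odot>\<^bsub>M\<^esub> m' = f [^] (c + b) \<odot>\<^bsub>M\<^esub> m"
      using f m by (subst (asm) frac_eq_iff) blast+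
    then have "r \<odot>\<^bsub>M\<^esub> (f [^] (c + a) \<odot>\<^bsub>M\<^esub> m') = r \<odot>\<^bsub>M\<^esub> (f [^] (c + b) \<odot>\<^bsub>M\<^esub> m)"
      by simp
    then have "f [^] (c + a) \<odot>\<^bsub>M\<^esub> (r \<odot>\<^bsub>M\<^esub> m') = f [^] (c + b) \<odot>\<^bsub>M\<^esub> (r \<odot>\<^bsub>M\<^esub> m)"
      using f r m m' smult_left_commute[OF r] R.nat_pow_closed by metis
    then show "(case (m', b) of (m, a) \<Rightarrow> frac R M f (r \<odot>\<^bsub>M\<^esub> m, a)) =
        (case (m, a) of (m, a) \<Rightarrow> frac R M f (r \<odot>\<^bsub>M\<^esub> m, a))"
      using f r m m' by (auto simp: frac_eq_iff)
  qed (use f m in auto)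
  then show ?thesis by (simp add: localization_def case_prod_unfold)
qed

lemma zero_localization:
  "f \<in> carrier R \<Longrightarrow> \<zero>\<^bsub>localization R M f\<^esub> = frac R M f (\<zero>\<^bsub>M\<^esub>, a)"
  by (auto simp: localization_def frac_eq_iff)

lemma localization_module:
  assumes f: "f \<in> carrier R"
  shows "module R (localization R M f)"
proof (rule moduleI)
  let ?L = "localization R M f"
  show "cring R" by (rule R.is_cring)
  show "abelian_group ?L"
  proof (rule abelian_groupI)
    fix X Y assume XY: "X \<in> carrier ?L" "Y \<in> carrier ?L"
    obtain m m' a where *: "m \<in> carrier M" "m' \<in> carrier M"
        "X = frac R M f (m, a)" "Y = frac R M f (m', a)"
      by (rule localization_cases2[OF f XY])
    then show "X \<oplus>\<^bsub>?L\<^esub> Y \<in> carrier ?L" "X \<oplus>\<^bsub>?L\<^esub> Y = Y \<oplus>\<^bsub>?L\<^esub> X"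
      using f by (simp_all add: add_frac_same M.a_comm)
  next
    fix X Y Z assume XYZ: "X \<in> carrier ?L" "Y \<in> carrier ?L" "Z \<in> carrier ?L"
    obtain m m' m'' a where "m \<in> carrier M" "m' \<in> carrier M" "m'' \<in> carrier M"
        "X = frac R M f (m, a)" "Y = frac R M f (m', a)" "Z = frac R M f (m'', a)"
      by (rule localization_cases3[OF f XYZ])
    then show "X \<oplus>\<^bsub>?L\<^esub> Y \<oplus>\<^bsub>?L\<^esub> Z = X \<oplus>\<^bsub>?L\<^esub> (Y \<oplus>\<^bsub>?L\<^esub> Z)"
      using f by (simp add: add_frac_same M.a_assoc)
  next
    show "\<zero>\<^bsub>?L\<^esub> \<in> carrier ?L"
      using f by (simp add: zero_localization[where a = 0])
  next
    fix X assume "X \<in> carrier ?L"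
    then obtain m a where m: "m \<in> carrier M" and X: "X = frac R M f (m, a)"
      by (rule localization_cases)
    show "\<zero>\<^bsub>?L\<^esub> \<oplus>\<^bsub>?L\<^esub> X = X"
      using f m unfolding X by (simp add: zero_localization[where a = a] add_frac_same)
    have "frac R M f (\<ominus>\<^bsub>M\<^esub> m, a) \<oplus>\<^bsub>?L\<^esub> X = \<zero>\<^bsub>?L\<^esub>"
      using f m unfolding X by (simp add: add_frac_same M.l_neg zero_localization[symmetric])
    then show "\<exists>Y\<in>carrier ?L. Y \<oplus>\<^bsub>?L\<^esub> X = \<zero>\<^bsub>?L\<^esub>"
      using m by (meson M.a_inv_closed frac_closed)
  qed
next
  let ?L = "localization R M f"
  fix X assume X: "X \<in> carrier ?L"
  then obtain m a where m: "m \<in> carrier M" and Xm: "X = frac R M f (m, a)"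
    by (rule localization_cases)
  show "\<one> \<odot>\<^bsub>?L\<^esub> X = X"
    using f m by (simp add: Xm smult_frac)
  fix r assume r: "r \<in> carrier R"
  show "r \<odot>\<^bsub>?L\<^esub> X \<in> carrier ?L"
    using f r m by (simp add: Xm smult_frac)
  fix s assume s: "s \<in> carrier R"
  show "(r \<oplus> s) \<odot>\<^bsub>?L\<^esub> X = r \<odot>\<^bsub>?L\<^esub> X \<oplus>\<^bsub>?L\<^esub> s \<odot>\<^bsub>?L\<^esub> X"
    using f r s m by (simp add: Xm smult_frac add_frac_same smult_l_distr)
  show "r \<otimes> s \<odot>\<^bsub>?L\<^esub> X = r \<odot>\<^bsub>?L\<^esub> (s \<odot>\<^bsub>?L\<^esub> X)"
    using f r s m by (simp add: Xm smult_frac smult_assoc1)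
next
  let ?L = "localization R M f"
  fix r X Y assume r: "r \<in> carrier R" and XY: "X \<in> carrier ?L" "Y \<in> carrier ?L"
  obtain m m' a where "m \<in> carrier M" "m' \<in> carrier M"
      "X = frac R M f (m, a)" "Y = frac R M f (m', a)"
    by (rule localization_cases2[OF f XY])
  then show "r \<odot>\<^bsub>?L\<^esub> (X \<oplus>\<^bsub>?L\<^esub> Y) = r \<odot>\<^bsub>?L\<^esub> X \<oplus>\<^bsub>?L\<^esub> r \<odot>\<^bsub>?L\<^esub> Y"
    using f r by (simp add: smult_frac add_frac_same smult_r_distr)
qed

end


section \<open>Semilinear maps and canonical maps between localizations\<close>

lemma abelian_group_homI':
  assumes "abelian_group G" "abelian_group H"
    and "\<And>x. x \<in> carrier G \<Longrightarrow> h x \<in> carrier H"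
    and "\<And>x y. \<lbrakk>x \<in> carrier G; y \<in> carrier G\<rbrakk> \<Longrightarrow> h (x \<oplus>\<^bsub>G\<^esub> y) = h x \<oplus>\<^bsub>H\<^esub> h y"
  shows "abelian_group_hom G H h"
  using assms
  by (intro abelian_group_homI group_hom.intro group_hom_axioms.intro abelian_group.a_group)
    (auto simp: hom_def)

lemma (in abelian_group_hom) hom_finsum:
  assumes "finite T" "\<And>j. j \<in> T \<Longrightarrow> s j \<in> carrier G"
  shows "h (finsum G s T) = finsum H (\<lambda>j. h (s j)) T"
  using assms by (induction T) (auto simp: Pi_def)

text \<open>The combinatorial core of \<open>d d = 0\<close>. A new index \<open>t\<close> adds a
  row of terms \<open>s t k\<close> and a column of terms \<open>s j t\<close>, which cancel
  pairwise. No order on the indices is involved, so the signs are dealt with elsewhere.\<close>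

lemma (in abelian_group) finsum_antisymmetric:
  assumes "finite T"
    and "\<And>j k. \<lbrakk>j \<in> T; k \<in> T; j \<noteq> k\<rbrakk> \<Longrightarrow> s j k \<in> carrier G"
    and "\<And>j k. \<lbrakk>j \<in> T; k \<in> T; j \<noteq> k\<rbrakk> \<Longrightarrow> s j k \<oplus> s k j = \<zero>"
  shows "(\<Oplus>j\<in>T. \<Oplus>k\<in>T - {j}. s j k) = \<zero>"
  using assms
proof (induction T)
  case (insert t T)
  have ne: "j \<noteq> t" if "j \<in> T" for j using that insert.hyps by auto
  have cl: "(\<Oplus>k\<in>T - {j}. s j k) \<in> carrier G" if "j \<in> T" for j
    using that insert.prems(1) by (intro finsum_closed) auto
  have row: "(\<Oplus>k\<in>insert t T - {j}. s j k) = s j t \<oplus> (\<Oplus>k\<in>T - {j}. s j k)" if "j \<in> T" for j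
  proof -
    have "insert t T - {j} = insert t (T - {j})" using that ne by auto
    then show ?thesis
      using that insert ne by (auto intro!: finsum_insert)
  qed
  have "(\<Oplus>j\<in>insert t T. \<Oplus>k\<in>insert t T - {j}. s j k) =
      (\<Oplus>k\<in>insert t T - {t}. s t k) \<oplus> (\<Oplus>j\<in>T. \<Oplus>k\<in>insert t T - {j}. s j k)"
    using insert.hyps insert.prems(1) by (intro finsum_insert) (auto intro!: finsum_closed)
  also have "(\<Oplus>k\<in>insert t T - {t}. s t k) = (\<Oplus>k\<in>T. s t k)"
    using insert.hyps by (simp add: insert_Diff_if)
  also have "(\<Oplus>j\<in>T. \<Oplus>k\<in>insert t T - {j}. s j k) = (\<Oplus>j\<in>T. s j t \<oplus> (\<Oplus>k\<in>T - {j}. s j k))"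
    using row insert.prems(1) ne cl by (intro finsum_cong' refl) auto
  also have "\<dots> = (\<Oplus>j\<in>T. s j t) \<oplus> (\<Oplus>j\<in>T. \<Oplus>k\<in>T - {j}. s j k)"
    using insert.prems(1) ne cl by (intro finsum_addf) auto
  also have "(\<Oplus>j\<in>T. \<Oplus>k\<in>T - {j}. s j k) = \<zero>"
    using insert by auto
  also have "(\<Oplus>k\<in>T. s t k) \<oplus> ((\<Oplus>j\<in>T. s j t) \<oplus> \<zero>) = (\<Oplus>k\<in>T. s t k) \<oplus> (\<Oplus>j\<in>T. s j t)"
    using insert.prems(1) ne by (auto intro!: finsum_closed)
  also have "\<dots> = (\<Oplus>j\<in>T. s t j \<oplus> s j t)"
    using insert.prems(1) ne by (intro finsum_addf[symmetric]) auto
  also have "\<dots> = (\<Oplus>j\<in>T. \<zero>)"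
    using insert.prems(2) ne by (intro finsum_cong' refl) auto
  finally show ?case by simp
qed simp

text \<open>One interface for Frobenius, reduction modulo an ideal and the projections between
  quotients. As \<open>h\<close> turns a factor \<open>f^a\<close> into
  \<open>\<phi>(f)^(q a)\<close>, the denominator exponent must be multiplied by the same
  \<open>q\<close>; \<open>map_rep\<close> fixes this for the map \<open>g\<close> on
  representatives.\<close>

locale semilinear_map = M: plain_module R M + N: plain_module A N
  for R :: "('a, 'b) ring_scheme" and M :: "('a, 'm) module"
    and A :: "('c, 'd) ring_scheme" and N :: "('c, 'n) module" +
  fixes \<phi> :: "'a \<Rightarrow> 'c" and q :: nat and h :: "'m \<Rightarrow> 'n" and g :: "'m \<times> nat \<Rightarrow> 'n \<times> nat"
  assumes ring_hom: "\<phi> \<in> ring_hom R A"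
    and map_closed [simp]: "m \<in> carrier M \<Longrightarrow> h m \<in> carrier N"
    and map_add: "\<lbrakk>m \<in> carrier M; m' \<in> carrier M\<rbrakk> \<Longrightarrow> h (m \<oplus>\<^bsub>M\<^esub> m') = h m \<oplus>\<^bsub>N\<^esub> h m'"
    and map_smult: "\<lbrakk>r \<in> carrier R; m \<in> carrier M\<rbrakk> \<Longrightarrow> h (r \<odot>\<^bsub>M\<^esub> m) = (\<phi> r [^]\<^bsub>A\<^esub> q) \<odot>\<^bsub>N\<^esub> h m"
    and map_rep: "g (m, a) = (h m, q * a)"
begin

sublocale \<phi>: ring_hom_cring R A \<phi>
  by (intro ring_hom_cring.intro ring_hom_cring_axioms.intro ring_hom M.R.is_cring N.R.is_cring)

lemma map_pow_smult:
  assumes "r \<in> carrier R" "m \<in> carrier M"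
  shows "h ((r [^]\<^bsub>R\<^esub> a) \<odot>\<^bsub>M\<^esub> m) = (\<phi> r [^]\<^bsub>A\<^esub> (q * a)) \<odot>\<^bsub>N\<^esub> h m"
  using assms \<phi>.ring.hom_nat_pow
  by (simp add: map_smult N.R.nat_pow_pow mult.commute)

lemma frac_map_frac:
  assumes f: "f \<in> carrier R" and m: "m \<in> carrier M"
  shows "frac_map A N (\<phi> f) g (frac R M f (m, a)) = frac A N (\<phi> f) (h m, q * a)"
proof -
  have "(\<Union>u\<in>frac R M f (m, a). frac A N (\<phi> f) (g u)) = frac A N (\<phi> f) (g (m, a))"
  proof (rule M.UN_frac[OF f m])
    fix m' b assume m': "m' \<in> carrier M" and "frac R M f (m', b) = frac R M f (m, a)"
    then obtain c where "(f [^]\<^bsub>R\<^esub> (c + a)) \<odot>\<^bsub>M\<^esub> m' = (f [^]\<^bsub>R\<^esub> (c + b)) \<odot>\<^bsub>M\<^esub> m"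
      using M.frac_eq_iff[OF f m' m] by blast
    then have "h ((f [^]\<^bsub>R\<^esub> (c + a)) \<odot>\<^bsub>M\<^esub> m') = h ((f [^]\<^bsub>R\<^esub> (c + b)) \<odot>\<^bsub>M\<^esub> m)"
      by simp
    \<comment> \<open>Applying \<open>h\<close> multiplies all exponents by \<open>q\<close>, so
      \<open>q * c\<close> witnesses the equality of the images.\<close>
    then have "(\<phi> f [^]\<^bsub>A\<^esub> (q * c + q * a)) \<odot>\<^bsub>N\<^esub> h m' = (\<phi> f [^]\<^bsub>A\<^esub> (q * c + q * b)) \<odot>\<^bsub>N\<^esub> h m"
      using f m m' by (simp add: map_pow_smult add_mult_distrib2)
    then show "frac A N (\<phi> f) (g (m', b)) = frac A N (\<phi> f) (g (m, a))"
      using f m m' by (subst map_rep)+ (subst N.frac_eq_iff; auto)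
  qed
  then show ?thesis
    by (simp add: frac_map_def map_rep)
qed

lemma frac_map_hom:
  assumes f: "f \<in> carrier R"
  shows "abelian_group_hom (localization R M f) (localization A N (\<phi> f)) (frac_map A N (\<phi> f) g)"
proof (rule abelian_group_homI')
  show "abelian_group (localization R M f)" "abelian_group (localization A N (\<phi> f))"
    using f by (auto intro!: module.axioms M.localization_module N.localization_module)
next
  fix X assume "X \<in> carrier (localization R M f)"
  then show "frac_map A N (\<phi> f) g X \<in> carrier (localization A N (\<phi> f))"
    using f by (auto elim!: M.localization_cases simp: frac_map_frac)
next
  fix X Y assume XY: "X \<in> carrier (localization R M f)" "Y \<in> carrier (localization R M f)"
  obtain m m' a where "m \<in> carrier M" "m' \<in> carrier M"
      "X = frac R M f (m, a)" "Y = frac R M f (m', a)"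
    by (rule M.localization_cases2[OF f XY])
  then show "frac_map A N (\<phi> f) g (X \<oplus>\<^bsub>localization R M f\<^esub> Y) =
      frac_map A N (\<phi> f) g X \<oplus>\<^bsub>localization A N (\<phi> f)\<^esub> frac_map A N (\<phi> f) g Y"
    using f by (simp add: frac_map_frac M.add_frac_same N.add_frac_same map_add)
qed

lemma frac_map_smult:
  assumes "f \<in> carrier R" "r \<in> carrier R" "X \<in> carrier (localization R M f)"
  shows "frac_map A N (\<phi> f) g (r \<odot>\<^bsub>localization R M f\<^esub> X) =
    (\<phi> r [^]\<^bsub>A\<^esub> q) \<odot>\<^bsub>localization A N (\<phi> f)\<^esub> frac_map A N (\<phi> f) g X"
  using assms
  by (auto elim!: M.localization_cases simp: frac_map_frac M.smult_frac N.smult_frac map_smult)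

end

section \<open>Canonical maps between the localizations of one module\<close>

context plain_module
begin

lemma loc_map_frac:
  assumes f: "f \<in> carrier R" and e: "e \<in> carrier R" and m: "m \<in> carrier M"
  shows "loc_map R M f e (frac R M f (m, a)) = frac R M (f \<otimes> e) (e [^] a \<odot>\<^bsub>M\<^esub> m, a)"
proof -
  have "(\<Union>u\<in>frac R M f (m, a). frac R M (f \<otimes> e) ((\<lambda>(m, a). (e [^] a \<odot>\<^bsub>M\<^esub> m, a)) u)) =
     frac R M (f \<otimes> e) ((\<lambda>(m, a). (e [^] a \<odot>\<^bsub>M\<^esub> m, a)) (m, a))"
  proof (rule UN_frac[OF f m])
    fix m' b assume m': "m' \<in> carrier M" and "frac R M f (m', b) = frac R M f (m, a)"
    then obtain c where c: "f [^] (c + a) \<odot>\<^bsub>M\<^esub> m' = f [^] (c + b) \<odot>\<^bsub>M\<^esub> m"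
      using frac_eq_iff[OF f m' m] by blast
    have "(f \<otimes> e) [^] (c + a) \<odot>\<^bsub>M\<^esub> (e [^] b \<odot>\<^bsub>M\<^esub> m') = e [^] (c + a + b) \<odot>\<^bsub>M\<^esub> (f [^] (c + a) \<odot>\<^bsub>M\<^esub> m')"
      using f e m' by (simp add: nat_pow_distrib smult_assoc1 smult_left_commute[of "f [^] (c + a)"] smult_pow_add)
    also have "\<dots> = e [^] (c + b + a) \<odot>\<^bsub>M\<^esub> (f [^] (c + b) \<odot>\<^bsub>M\<^esub> m)"
      unfolding c by (simp add: ac_simps)
    also have "\<dots> = (f \<otimes> e) [^] (c + b) \<odot>\<^bsub>M\<^esub> (e [^] a \<odot>\<^bsub>M\<^esub> m)"
      using f e m by (simp add: nat_pow_distrib smult_assoc1 smult_left_commute[of "f [^] (c + b)"] smult_pow_add)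
    finally show "frac R M (f \<otimes> e) ((\<lambda>(m, a). (e [^] a \<odot>\<^bsub>M\<^esub> m, a)) (m', b)) =
        frac R M (f \<otimes> e) ((\<lambda>(m, a). (e [^] a \<odot>\<^bsub>M\<^esub> m, a)) (m, a))"
      using f e m m' by (auto simp: frac_eq_iff)
  qed
  then show ?thesis
    by (simp add: loc_map_def frac_map_def)
qed

lemma loc_map_hom:
  assumes f: "f \<in> carrier R" and e: "e \<in> carrier R"
  shows "abelian_group_hom (localization R M f) (localization R M (f \<otimes> e)) (loc_map R M f e)"
proof (rule abelian_group_homI')
  show "abelian_group (localization R M f)" "abelian_group (localization R M (f \<otimes> e))"
    using f e by (auto intro!: module.axioms localization_module)
next
  fix X assume "X \<in> carrier (localization R M f)"
  then show "loc_map R M f e X \<in> carrier (localization R M (f \<otimes> e))"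
    using f e by (auto elim!: localization_cases simp: loc_map_frac)
next
  fix X Y assume XY: "X \<in> carrier (localization R M f)" "Y \<in> carrier (localization R M f)"
  obtain m m' a where "m \<in> carrier M" "m' \<in> carrier M"
      "X = frac R M f (m, a)" "Y = frac R M f (m', a)"
    by (rule localization_cases2[OF f XY])
  then show "loc_map R M f e (X \<oplus>\<^bsub>localization R M f\<^esub> Y) =
      loc_map R M f e X \<oplus>\<^bsub>localization R M (f \<otimes> e)\<^esub> loc_map R M f e Y"
    using f e by (simp add: loc_map_frac add_frac_same smult_r_distr)
qed

lemma loc_map_smult:
  assumes "f \<in> carrier R" "e \<in> carrier R" "r \<in> carrier R" "X \<in> carrier (localization R M f)"
  shows "loc_map R M f e (r \<odot>\<^bsub>localization R M f\<^esub> X) =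
    r \<odot>\<^bsub>localization R M (f \<otimes> e)\<^esub> loc_map R M f e X"
  using assms
  by (auto elim!: localization_cases simp: loc_map_frac smult_frac smult_left_commute)

text \<open>The order in which two factors are inverted does not matter. This is the unsigned half
  of the cancellation in \<open>d d = 0\<close>.\<close>

lemma loc_map_commute:
  assumes "f \<in> carrier R" "d \<in> carrier R" "e \<in> carrier R" "X \<in> carrier (localization R M f)"
  shows "loc_map R M (f \<otimes> d) e (loc_map R M f d X) = loc_map R M (f \<otimes> e) d (loc_map R M f e X)"
  using assms
  by (auto elim!: localization_cases simp: loc_map_frac smult_left_commute[of "d [^] _"] R.m_assoc R.m_comm[of d e])

end

lemma (in semilinear_map) frac_map_loc_map:
  assumes "f \<in> carrier R" "e \<in> carrier R" "X \<in> carrier (localization R M f)"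
  shows "frac_map A N (\<phi> f \<otimes>\<^bsub>A\<^esub> \<phi> e) g (loc_map R M f e X) =
    loc_map A N (\<phi> f) (\<phi> e) (frac_map A N (\<phi> f) g X)"
proof -
  obtain m a where m: "m \<in> carrier M" and X: "X = frac R M f (m, a)"
    using assms(3) by (rule M.localization_cases)
  have "frac_map A N (\<phi> (f \<otimes>\<^bsub>R\<^esub> e)) g (loc_map R M f e X) =
      frac A N (\<phi> (f \<otimes>\<^bsub>R\<^esub> e)) (\<phi> e [^]\<^bsub>A\<^esub> (q * a) \<odot>\<^bsub>N\<^esub> h m, q * a)"
    unfolding X using assms(1,2) m
    by (subst M.loc_map_frac) (simp_all add: frac_map_frac map_pow_smult del: \<phi>.hom_mult)
  then show ?thesis
    unfolding X using assms(1,2) m by (simp add: frac_map_frac N.loc_map_frac)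
qed


section \<open>The Cech complex\<close>

text \<open>A single signed summand of the differential. Isolating it lets additivity, linearity,
  naturality and cancellation be proved summand by summand and then summed.\<close>

definition cech_face ::
  "('a, 'b) ring_scheme \<Rightarrow> 'a list \<Rightarrow> ('a, 'm) module \<Rightarrow> nat set \<Rightarrow> nat
    \<Rightarrow> ('m \<times> nat) set \<Rightarrow> ('m \<times> nat) set" where
  "cech_face R fs M T j y = (let z = loc_map R M (cech_elem R fs (T - {j})) (fs ! j) y
     in if even (card {k\<in>T. k < j}) then z else \<ominus>\<^bsub>cech_loc R fs M T\<^esub> z)"

lemma cech_diff_face:
  "cech_diff R fs M i c = (\<lambda>T\<in>cech_index fs (Suc i).
     finsum (cech_loc R fs M T) (\<lambda>j. cech_face R fs M T j (c (T - {j}))) T)"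
  by (simp add: cech_diff_def cech_face_def)

lemma cech_index_subset: "T \<in> cech_index fs i \<Longrightarrow> T \<subseteq> {..<length fs}"
  by (simp add: cech_index_def)

lemma cech_index_finite: "T \<in> cech_index fs i \<Longrightarrow> finite T"
  by (auto simp: cech_index_def intro: finite_subset)

lemma cech_index_remove:
  "\<lbrakk>T \<in> cech_index fs (Suc i); j \<in> T\<rbrakk> \<Longrightarrow> T - {j} \<in> cech_index fs i"
  by (auto simp: cech_index_def intro: finite_subset)

lemma cech_module_carrier_iff:
  "c \<in> carrier (cech_module R fs M i) \<longleftrightarrow>
    c \<in> extensional (cech_index fs i) \<and> (\<forall>T\<in>cech_index fs i. c T \<in> carrier (cech_loc R fs M T))"
  by (auto simp: cech_module_def PiE_def Pi_def)

lemma cech_module_eqI: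
  assumes "c \<in> carrier (cech_module R fs M i)" "d \<in> carrier (cech_module R fs M i)"
    and "\<And>T. T \<in> cech_index fs i \<Longrightarrow> c T = d T"
  shows "c = d"
  using assms by (auto simp: cech_module_carrier_iff intro: extensionalityI)

lemma cech_module_apply:
  assumes "T \<in> cech_index fs i"
  shows "(c \<oplus>\<^bsub>cech_module R fs M i\<^esub> d) T = c T \<oplus>\<^bsub>cech_loc R fs M T\<^esub> d T"
    and "\<zero>\<^bsub>cech_module R fs M i\<^esub> T = \<zero>\<^bsub>cech_loc R fs M T\<^esub>"
    and "(r \<odot>\<^bsub>cech_module R fs M i\<^esub> c) T = r \<odot>\<^bsub>cech_loc R fs M T\<^esub> c T"
  using assms by (simp_all add: cech_module_def)

lemma cech_diff_apply:
  "T \<in> cech_index fs (Suc i) \<Longrightarrow> cech_diff R fs M i c T =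
     finsum (cech_loc R fs M T) (\<lambda>j. cech_face R fs M T j (c (T - {j}))) T"
  by (simp add: cech_diff_face)

locale cech = plain_module R M
  for R :: "('a, 'b) ring_scheme" (structure) and M :: "('a, 'm) module" (structure) +
  fixes fs :: "'a list"
  assumes fs_closed: "set fs \<subseteq> carrier R"
begin

abbreviation "E T \<equiv> cech_elem R fs T"
abbreviation "L T \<equiv> cech_loc R fs M T"
abbreviation "C i \<equiv> cech_module R fs M i"

lemma nth_closed: "j < length fs \<Longrightarrow> fs ! j \<in> carrier R"
  using fs_closed nth_mem by blast

lemma elem_closed: "T \<subseteq> {..<length fs} \<Longrightarrow> E T \<in> carrier R"
  unfolding cech_elem_def by (rule R.finprod_closed) (use nth_closed in auto)

text \<open>\<open>loc_map\<close> lands in the localization at a product of two factors. This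
  equality of ring elements makes that localization literally \<open>L T\<close>, so no
  identification has to be carried along.\<close>

lemma elem_remove:
  assumes "T \<subseteq> {..<length fs}" "j \<in> T"
  shows "E (T - {j}) \<otimes> fs ! j = E T"
proof -
  have "finite T" using assms(1) finite_subset by blast
  then have "finprod R ((!) fs) (insert j (T - {j})) = fs ! j \<otimes> E (T - {j})"
    unfolding cech_elem_def using assms nth_closed by (intro R.finprod_insert) auto
  moreover have "insert j (T - {j}) = T" using assms by auto
  moreover have "E (T - {j}) \<in> carrier R" using assms by (intro elem_closed) auto
  ultimately show ?thesis
    using assms nth_closed[of j] by (auto simp: R.m_comm cech_elem_def)
qed

lemma loc_module: "T \<subseteq> {..<length fs} \<Longrightarrow> module R (L T)"
  by (simp add: localization_module elem_closed)

lemma loc_abelian_group: "T \<subseteq> {..<length fs} \<Longrightarrow> abelian_group (L T)"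
  using loc_module module.axioms by blast

lemma face_loc_map_hom:
  assumes "T \<subseteq> {..<length fs}" "j \<in> T"
  shows "abelian_group_hom (L (T - {j})) (L T) (loc_map R M (E (T - {j})) (fs ! j))"
proof -
  have "E (T - {j}) \<in> carrier R" "fs ! j \<in> carrier R"
    using assms by (auto intro!: elem_closed nth_closed)
  from loc_map_hom[OF this] show ?thesis
    by (simp add: elem_remove[OF assms])
qed

lemma face_hom:
  assumes T: "T \<subseteq> {..<length fs}" "j \<in> T"
  shows "abelian_group_hom (L (T - {j})) (L T) (cech_face R fs M T j)"
proof -
  interpret abelian_group_hom "L (T - {j})" "L T" "loc_map R M (E (T - {j})) (fs ! j)"
    by (rule face_loc_map_hom[OF T])
  show ?thesis
    by (rule abelian_group_homI')
      (auto simp: cech_face_def Let_def G.abelian_group_axioms H.abelian_group_axioms H.minus_add)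
qed

lemma face_smult:
  assumes T: "T \<subseteq> {..<length fs}" "j \<in> T" and r: "r \<in> carrier R" and y: "y \<in> carrier (L (T - {j}))"
  shows "cech_face R fs M T j (r \<odot>\<^bsub>L (T - {j})\<^esub> y) = r \<odot>\<^bsub>L T\<^esub> cech_face R fs M T j y"
proof -
  interpret L: module R "L T" by (rule loc_module[OF T(1)])
  interpret abelian_group_hom "L (T - {j})" "L T" "loc_map R M (E (T - {j})) (fs ! j)"
    by (rule face_loc_map_hom[OF T])
  have "T - {j} \<subseteq> {..<length fs}" "j < length fs" using T by auto
  then have "loc_map R M (E (T - {j})) (fs ! j) (r \<odot>\<^bsub>L (T - {j})\<^esub> y) =
      r \<odot>\<^bsub>L T\<^esub> loc_map R M (E (T - {j})) (fs ! j) y"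
    using loc_map_smult[OF elem_closed nth_closed r y] elem_remove[OF T] by simp
  then show ?thesis
    using r y by (simp add: cech_face_def Let_def L.smult_r_minus)
qed

text \<open>Both orders of removal give the same unsigned element \<open>u\<close>. For
  \<open>j < k\<close>, removing \<open>j\<close> first lowers the number of indices below
  \<open>k\<close> by one, while removing \<open>k\<close> first leaves the number below
  \<open>j\<close> unchanged; so the two signs are opposite.\<close>

lemma face_face_cancel:
  assumes T: "T \<subseteq> {..<length fs}" and jk: "j \<in> T" "k \<in> T" "j < k"
    and y: "y \<in> carrier (L (T - {j} - {k}))"
  shows "cech_face R fs M T j (cech_face R fs M (T - {j}) k y) \<oplus>\<^bsub>L T\<^esub>
      cech_face R fs M T k (cech_face R fs M (T - {k}) j y) = \<zero>\<^bsub>L T\<^esub>"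
proof -
  let ?S = "T - {j} - {k}"
  have S: "T - {k} - {j} = ?S" by auto
  interpret j: abelian_group_hom "L (T - {j})" "L T" "loc_map R M (E (T - {j})) (fs ! j)"
    using T jk by (intro face_loc_map_hom)
  interpret k: abelian_group_hom "L (T - {k})" "L T" "loc_map R M (E (T - {k})) (fs ! k)"
    using T jk by (intro face_loc_map_hom)
  interpret jk: abelian_group_hom "L ?S" "L (T - {j})" "loc_map R M (E ?S) (fs ! k)"
    using T jk by (intro face_loc_map_hom) auto
  interpret kj: abelian_group_hom "L ?S" "L (T - {k})" "loc_map R M (E ?S) (fs ! j)"
    using face_loc_map_hom[of "T - {k}" j] T jk unfolding S by auto
  define u where "u = loc_map R M (E (T - {j})) (fs ! j) (loc_map R M (E ?S) (fs ! k) y)"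
  have u: "u \<in> carrier (L T)"
    unfolding u_def using y by simp
  have E: "E ?S \<otimes> fs ! k = E (T - {j})" "E ?S \<otimes> fs ! j = E (T - {k})"
    using elem_remove[of "T - {j}" k] elem_remove[of "T - {k}" j] T jk unfolding S by auto
  have "E ?S \<in> carrier R" "fs ! j \<in> carrier R" "fs ! k \<in> carrier R"
    using T jk by (auto intro!: elem_closed nth_closed)
  then have u': "u = loc_map R M (E (T - {k})) (fs ! k) (loc_map R M (E ?S) (fs ! j) y)"
    using loc_map_commute[of "E ?S" "fs ! k" "fs ! j" y] y unfolding u_def E by simp
  have n: "{l \<in> T. l < k} = insert j {l \<in> T - {j}. l < k}" "{l \<in> T - {k}. l < j} = {l \<in> T. l < j}"
    using jk by auto
  have card: "card {l \<in> T. l < k} = Suc (card {l \<in> T - {j}. l < k})"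
    unfolding n(1) using T by (intro card_insert_disjoint) (auto intro: finite_subset)
  show ?thesis
    unfolding cech_face_def Let_def card n(2) S
    using y u by (simp add: u_def[symmetric] u'[symmetric] j.H.r_neg j.H.l_neg)
qed

section \<open>The terms of the complex and its differential\<close>

lemma C_zero_closed: "\<zero>\<^bsub>C i\<^esub> \<in> carrier (C i)"
  using loc_abelian_group[OF cech_index_subset]
  by (auto simp: cech_module_def intro!: abelian_monoid.zero_closed abelian_group.axioms(1))

lemma C_add_closed:
  "\<lbrakk>c \<in> carrier (C i); d \<in> carrier (C i)\<rbrakk> \<Longrightarrow> c \<oplus>\<^bsub>C i\<^esub> d \<in> carrier (C i)"
  using loc_abelian_group[OF cech_index_subset]
  by (auto simp: cech_module_def PiE_def Pi_def intro!: abelian_monoid.a_closed abelian_group.axioms(1))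

lemma C_smult_closed:
  "\<lbrakk>r \<in> carrier R; c \<in> carrier (C i)\<rbrakk> \<Longrightarrow> r \<odot>\<^bsub>C i\<^esub> c \<in> carrier (C i)"
  using loc_module[OF cech_index_subset]
  by (auto simp: cech_module_def PiE_def Pi_def intro!: module.smult_closed)

lemma C_module: "module R (C i)"
proof -
  have L: "module R (L T)" if "T \<in> cech_index fs i" for T
    using that cech_index_subset loc_module by blast
  note grp = module.axioms(2)[OF L]
  note mon = abelian_group.axioms(1)[OF grp]
  note C_apply = cech_module_apply C_zero_closed C_add_closed C_smult_closed
  note eqI = cech_module_eqI[of _ R fs M i]
  have mem: "c T \<in> carrier (L T)" if "c \<in> carrier (C i)" "T \<in> cech_index fs i" for c T
    using that by (simp add: cech_module_carrier_iff)
  have "abelian_group (C i)"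
  proof (rule abelian_groupI)
    fix c assume c: "c \<in> carrier (C i)"
    define d where "d = (\<lambda>T\<in>cech_index fs i. \<ominus>\<^bsub>L T\<^esub> c T)"
    have d: "d \<in> carrier (C i)"
      using mem[OF c] abelian_group.a_inv_closed[OF grp] by (auto simp: d_def cech_module_carrier_iff)
    have "d \<oplus>\<^bsub>C i\<^esub> c = \<zero>\<^bsub>C i\<^esub>"
    proof (rule eqI)
      fix T assume T: "T \<in> cech_index fs i"
      show "(d \<oplus>\<^bsub>C i\<^esub> c) T = \<zero>\<^bsub>C i\<^esub> T"
        using abelian_group.l_neg[OF grp[OF T] mem[OF c T]] T by (simp add: C_apply d_def)
    qed (simp_all add: C_apply c d)
    with d show "\<exists>d\<in>carrier (C i). d \<oplus>\<^bsub>C i\<^esub> c = \<zero>\<^bsub>C i\<^esub>" by blast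
    show "\<zero>\<^bsub>C i\<^esub> \<oplus>\<^bsub>C i\<^esub> c = c"
      using c by (intro eqI) (simp_all add: C_apply abelian_monoid.l_zero[OF mon] mem)
  next
    fix c d assume cd: "c \<in> carrier (C i)" "d \<in> carrier (C i)"
    then show "c \<oplus>\<^bsub>C i\<^esub> d \<in> carrier (C i)"
      by (rule C_add_closed)
    show "c \<oplus>\<^bsub>C i\<^esub> d = d \<oplus>\<^bsub>C i\<^esub> c"
      using cd by (intro eqI) (simp_all add: C_apply abelian_monoid.a_comm[OF mon] mem)
    fix e assume "e \<in> carrier (C i)"
    with cd show "(c \<oplus>\<^bsub>C i\<^esub> d) \<oplus>\<^bsub>C i\<^esub> e = c \<oplus>\<^bsub>C i\<^esub> (d \<oplus>\<^bsub>C i\<^esub> e)"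
      by (intro eqI) (simp_all add: C_apply abelian_monoid.a_assoc[OF mon] mem)
  qed (rule C_zero_closed)
  then show ?thesis
    by (intro moduleI R.is_cring eqI)
      (simp_all add: C_apply module.smult_l_distr[OF L] module.smult_r_distr[OF L]
        module.smult_assoc1[OF L] module.smult_one[OF L] mem)
qed

lemma C_abelian_group: "abelian_group (C i)"
  using C_module module.axioms by blast

lemma face_closed:
  assumes "T \<in> cech_index fs (Suc i)" "j \<in> T" "c \<in> carrier (C i)"
  shows "cech_face R fs M T j (c (T - {j})) \<in> carrier (L T)"
proof -
  have "c (T - {j}) \<in> carrier (L (T - {j}))"
    using cech_index_remove[OF assms(1,2)] assms(3) by (simp add: cech_module_carrier_iff)
  then show ?thesis
    by (rule abelian_group_hom.hom_closed[OF face_hom[OF cech_index_subset[OF assms(1)] assms(2)]])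
qed

lemma diff_hom: "abelian_group_hom (C i) (C (Suc i)) (cech_diff R fs M i)"
proof (rule abelian_group_homI')
  fix c assume c: "c \<in> carrier (C i)"
  have "finsum (L T) (\<lambda>j. cech_face R fs M T j (c (T - {j}))) T \<in> carrier (L T)"
    if T: "T \<in> cech_index fs (Suc i)" for T
    using face_closed[OF T _ c] loc_abelian_group[OF cech_index_subset[OF T]]
    by (intro abelian_monoid.finsum_closed) (auto intro: abelian_group.axioms)
  then show dc: "cech_diff R fs M i c \<in> carrier (C (Suc i))"
    by (auto simp: cech_module_carrier_iff cech_diff_apply) (simp add: cech_diff_face)
next
  fix c d assume c: "c \<in> carrier (C i)" and d: "d \<in> carrier (C i)"
  have "cech_diff R fs M i (c \<oplus>\<^bsub>C i\<^esub> d) T =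
      cech_diff R fs M i c T \<oplus>\<^bsub>L T\<^esub> cech_diff R fs M i d T"
    if T: "T \<in> cech_index fs (Suc i)" for T
  proof -
    interpret L: abelian_group "L T"
      by (rule loc_abelian_group[OF cech_index_subset[OF T]])
    have "cech_face R fs M T j ((c \<oplus>\<^bsub>C i\<^esub> d) (T - {j})) =
        cech_face R fs M T j (c (T - {j})) \<oplus>\<^bsub>L T\<^esub> cech_face R fs M T j (d (T - {j}))"
      if j: "j \<in> T" for j
      using abelian_group_hom.hom_add[OF face_hom[OF cech_index_subset[OF T] j]] c d
        cech_index_remove[OF T j]
      by (auto simp: cech_module_apply cech_module_carrier_iff)
    then have "finsum (L T) (\<lambda>j. cech_face R fs M T j ((c \<oplus>\<^bsub>C i\<^esub> d) (T - {j}))) T =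
      finsum (L T) (\<lambda>j. cech_face R fs M T j (c (T - {j})) \<oplus>\<^bsub>L T\<^esub> cech_face R fs M T j (d (T - {j}))) T"
      using face_closed[OF T _ c] face_closed[OF T _ d] by (intro L.finsum_cong' refl) auto
    also have "\<dots> = finsum (L T) (\<lambda>j. cech_face R fs M T j (c (T - {j}))) T \<oplus>\<^bsub>L T\<^esub>
        finsum (L T) (\<lambda>j. cech_face R fs M T j (d (T - {j}))) T"
      using face_closed[OF T _ c] face_closed[OF T _ d] by (intro L.finsum_addf) auto
    finally show ?thesis using T by (simp add: cech_diff_apply)
  qed
  then show "cech_diff R fs M i (c \<oplus>\<^bsub>C i\<^esub> d) =
      cech_diff R fs M i c \<oplus>\<^bsub>C (Suc i)\<^esub> cech_diff R fs M i d"
    by (auto simp: cech_diff_face cech_module_def fun_eq_iff)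
qed (rule C_abelian_group)+

lemma diff_smult:
  assumes r: "r \<in> carrier R" and c: "c \<in> carrier (C i)"
  shows "cech_diff R fs M i (r \<odot>\<^bsub>C i\<^esub> c) = r \<odot>\<^bsub>C (Suc i)\<^esub> cech_diff R fs M i c"
proof (rule cech_module_eqI)
  show "cech_diff R fs M i (r \<odot>\<^bsub>C i\<^esub> c) \<in> carrier (C (Suc i))"
    "r \<odot>\<^bsub>C (Suc i)\<^esub> cech_diff R fs M i c \<in> carrier (C (Suc i))"
    using r c by (auto intro!: abelian_group_hom.hom_closed[OF diff_hom] module.smult_closed[OF C_module])
  fix T assume T: "T \<in> cech_index fs (Suc i)"
  interpret L: module R "L T"
    by (rule loc_module[OF cech_index_subset[OF T]])
  have "finsum (L T) (\<lambda>j. cech_face R fs M T j ((r \<odot>\<^bsub>C i\<^esub> c) (T - {j}))) T =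
      finsum (L T) (\<lambda>j. r \<odot>\<^bsub>L T\<^esub> cech_face R fs M T j (c (T - {j}))) T"
    using face_closed[OF T _ c] r c cech_index_remove[OF T] cech_index_subset[OF T]
    by (intro L.finsum_cong' refl) (auto simp: cech_module_apply face_smult cech_module_carrier_iff)
  also have "\<dots> = r \<odot>\<^bsub>L T\<^esub> finsum (L T) (\<lambda>j. cech_face R fs M T j (c (T - {j}))) T"
    using face_closed[OF T _ c] r cech_index_finite[OF T] by (intro L.finsum_smult_ldistr[symmetric]) auto
  finally show "cech_diff R fs M i (r \<odot>\<^bsub>C i\<^esub> c) T = (r \<odot>\<^bsub>C (Suc i)\<^esub> cech_diff R fs M i c) T"
    using T by (simp add: cech_diff_apply cech_module_apply)
qed

lemma diff_diff:
  assumes c: "c \<in> carrier (C i)"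
  shows "cech_diff R fs M (Suc i) (cech_diff R fs M i c) = \<zero>\<^bsub>C (Suc (Suc i))\<^esub>"
proof (rule cech_module_eqI)
  show "cech_diff R fs M (Suc i) (cech_diff R fs M i c) \<in> carrier (C (Suc (Suc i)))"
    using c by (intro abelian_group_hom.hom_closed[OF diff_hom])
  show "\<zero>\<^bsub>C (Suc (Suc i))\<^esub> \<in> carrier (C (Suc (Suc i)))"
    by (meson C_abelian_group abelian_group.axioms(1) abelian_monoid.zero_closed)
  fix T assume T: "T \<in> cech_index fs (Suc (Suc i))"
  note sub = cech_index_subset[OF T]
  interpret L: abelian_group "L T"
    by (rule loc_abelian_group[OF sub])
  \<comment> \<open>The contribution to \<open>d d c\<close> at \<open>T\<close> of the ordered pair
    \<open>(j, k)\<close>: the value of \<open>c\<close> at \<open>T\<close> without both indices,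
    with \<open>k\<close> put back first and then \<open>j\<close>.\<close>
  define s where "s j k = cech_face R fs M T j (cech_face R fs M (T - {j}) k (c (T - {j} - {k})))" for j k
  have mem: "c (T - {j} - {k}) \<in> carrier (L (T - {j} - {k}))" if "j \<in> T" "k \<in> T" "j \<noteq> k" for j k
    using that cech_index_remove[OF cech_index_remove[OF T]] c by (auto simp: cech_module_carrier_iff)
  have s_closed: "s j k \<in> carrier (L T)" if jk: "j \<in> T" "k \<in> T" "j \<noteq> k" for j k
    unfolding s_def
    using abelian_group_hom.hom_closed[OF face_hom[OF sub jk(1)]]
      face_closed[OF cech_index_remove[OF T jk(1)], of k c] jk c by auto
  have "cech_face R fs M T j (cech_diff R fs M i c (T - {j})) = finsum (L T) (s j) (T - {j})"
    if j: "j \<in> T" for j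
    unfolding cech_diff_apply[OF cech_index_remove[OF T j]] s_def
    using face_closed[OF cech_index_remove[OF T j] _ c] cech_index_finite[OF T]
    by (intro abelian_group_hom.hom_finsum[OF face_hom[OF sub j]]) auto
  then have "cech_diff R fs M (Suc i) (cech_diff R fs M i c) T =
      finsum (L T) (\<lambda>j. finsum (L T) (s j) (T - {j})) T"
    unfolding cech_diff_apply[OF T] using s_closed
    by (intro L.finsum_cong' refl) (auto intro!: L.finsum_closed)
  also have "\<dots> = \<zero>\<^bsub>L T\<^esub>"
  proof (rule L.finsum_antisymmetric[OF cech_index_finite[OF T] s_closed])
    fix j k assume jk: "j \<in> T" "k \<in> T" "j \<noteq> k"
    have eq: "T - {j} - {k} = T - {k} - {j}" by auto
    show "s j k \<oplus>\<^bsub>L T\<^esub> s k j = \<zero>\<^bsub>L T\<^esub>"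
    proof (cases "j < k")
      case True
      then show ?thesis
        using face_face_cancel[OF sub jk(1,2) True mem[OF jk]] eq by (simp add: s_def)
    next
      case False
      then have "k < j" using jk by auto
      then have "s k j \<oplus>\<^bsub>L T\<^esub> s j k = \<zero>\<^bsub>L T\<^esub>"
        using face_face_cancel[OF sub jk(2,1) _ mem[of k j]] eq jk by (simp add: s_def)
      then show ?thesis
        using s_closed jk by (metis L.a_comm)
    qed
  qed
  finally show "cech_diff R fs M (Suc i) (cech_diff R fs M i c) T = \<zero>\<^bsub>C (Suc (Suc i))\<^esub> T"
    using T by (simp add: cech_module_apply)
qed

end


section \<open>Maps of Cech complexes\<close>

text \<open>The target complex is taken on the images \<open>map \<phi> fs\<close>. For the identity
  \<open>\<phi>\<close> this is the same family, and for reduction modulo \<open>x\<close> it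
  generates the image ideal. Index sets depend only on the length of the family, hence agree on both
  sides.\<close>

locale cech_semilinear = semilinear_map R M A N \<phi> q h g + cech R M fs
  for R :: "('a, 'b) ring_scheme" and M :: "('a, 'm) module"
    and A :: "('c, 'd) ring_scheme" and N :: "('c, 'n) module"
    and \<phi> q h g fs
begin

sublocale N: cech A N "map \<phi> fs"
  using fs_closed by unfold_locales auto

abbreviation "\<Phi> i \<equiv> cech_map A (map \<phi> fs) N g i"

lemma index_map [simp]: "cech_index (map \<phi> fs) i = cech_index fs i"
  by (simp add: cech_index_def)

lemma elem_map:
  assumes "T \<subseteq> {..<length fs}"
  shows "N.E T = \<phi> (E T)"
proof -
  have "\<phi> (E T) = finprod A (\<phi> \<circ> (!) fs) T"
    unfolding cech_elem_def using assms nth_closed by (intro \<phi>.hom_finprod) auto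
  also have "\<dots> = N.E T"
    unfolding cech_elem_def using assms N.nth_closed by (intro N.R.finprod_cong' refl) auto
  finally show ?thesis by simp
qed

lemma map_apply:
  "T \<in> cech_index fs i \<Longrightarrow> \<Phi> i c T = frac_map A N (\<phi> (E T)) g (c T)"
  using elem_map[of T] by (simp add: cech_map_def cech_index_subset)

lemma component_hom:
  assumes "T \<subseteq> {..<length fs}"
  shows "abelian_group_hom (L T) (N.L T) (frac_map A N (\<phi> (E T)) g)"
  using frac_map_hom[OF elem_closed] assms by (simp add: elem_map)

lemma map_hom: "abelian_group_hom (C i) (N.C i) (\<Phi> i)"
proof (rule abelian_group_homI')
  have comp: "abelian_group_hom (L T) (N.L T) (frac_map A N (\<phi> (E T)) g)"
    if "T \<in> cech_index fs i" for T
    using that by (simp add: component_hom cech_index_subset)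
  fix c assume c: "c \<in> carrier (C i)"
  have "\<Phi> i c T \<in> carrier (N.L T)" if T: "T \<in> cech_index fs i" for T
    using c T abelian_group_hom.hom_closed[OF comp[OF T]] by (simp add: map_apply cech_module_carrier_iff)
  then show "\<Phi> i c \<in> carrier (N.C i)"
    by (simp add: cech_module_carrier_iff) (simp add: cech_map_def)
  fix d assume d: "d \<in> carrier (C i)"
  have "\<Phi> i (c \<oplus>\<^bsub>C i\<^esub> d) T = \<Phi> i c T \<oplus>\<^bsub>N.L T\<^esub> \<Phi> i d T" if T: "T \<in> cech_index fs i" for T
    using c d T abelian_group_hom.hom_add[OF comp[OF T]]
    by (simp add: map_apply cech_module_apply cech_module_carrier_iff)
  then show "\<Phi> i (c \<oplus>\<^bsub>C i\<^esub> d) = \<Phi> i c \<oplus>\<^bsub>N.C i\<^esub> \<Phi> i d"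
    by (auto simp: fun_eq_iff cech_module_def cech_map_def)
qed (rule C_abelian_group N.C_abelian_group)+

lemma map_smult:
  assumes r: "r \<in> carrier R" and c: "c \<in> carrier (C i)"
  shows "\<Phi> i (r \<odot>\<^bsub>C i\<^esub> c) = (\<phi> r [^]\<^bsub>A\<^esub> q) \<odot>\<^bsub>N.C i\<^esub> \<Phi> i c"
proof (rule cech_module_eqI)
  show "\<Phi> i (r \<odot>\<^bsub>C i\<^esub> c) \<in> carrier (N.C i)" "(\<phi> r [^]\<^bsub>A\<^esub> q) \<odot>\<^bsub>N.C i\<^esub> \<Phi> i c \<in> carrier (N.C i)"
    using r c by (auto intro!: N.C_smult_closed C_smult_closed abelian_group_hom.hom_closed[OF map_hom])
  fix T assume "T \<in> cech_index (map \<phi> fs) i"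
  then have T: "T \<in> cech_index fs i" by simp
  then show "\<Phi> i (r \<odot>\<^bsub>C i\<^esub> c) T = ((\<phi> r [^]\<^bsub>A\<^esub> q) \<odot>\<^bsub>N.C i\<^esub> \<Phi> i c) T"
    using r c frac_map_smult[OF elem_closed r, of T "c T"]
    by (simp add: map_apply cech_module_apply cech_module_carrier_iff cech_index_subset elem_map)
qed

lemma face_map:
  assumes T: "T \<subseteq> {..<length fs}" "j \<in> T" and y: "y \<in> carrier (L (T - {j}))"
  shows "frac_map A N (\<phi> (E T)) g (cech_face R fs M T j y) =
    cech_face A (map \<phi> fs) N T j (frac_map A N (\<phi> (E (T - {j}))) g y)"
proof -
  interpret T: abelian_group_hom "L T" "N.L T" "frac_map A N (\<phi> (E T)) g"
    by (rule component_hom[OF T(1)])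
  interpret j: abelian_group_hom "L (T - {j})" "L T" "loc_map R M (E (T - {j})) (fs ! j)"
    by (rule face_loc_map_hom[OF T])
  have T': "T - {j} \<subseteq> {..<length fs}" and j: "j < length fs"
    using T by auto
  have "\<phi> (E T) = \<phi> (E (T - {j})) \<otimes>\<^bsub>A\<^esub> \<phi> (fs ! j)"
    using elem_closed[OF T'] nth_closed[OF j] by (simp add: elem_remove[OF T, symmetric])
  then have "frac_map A N (\<phi> (E T)) g (loc_map R M (E (T - {j})) (fs ! j) y) =
      loc_map A N (N.E (T - {j})) (map \<phi> fs ! j) (frac_map A N (\<phi> (E (T - {j}))) g y)"
    using frac_map_loc_map[OF elem_closed[OF T'] nth_closed[OF j] y] elem_map[OF T'] j by simp
  then show ?thesis
    using y by (simp add: cech_face_def Let_def)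
qed

lemma map_diff:
  assumes c: "c \<in> carrier (C i)"
  shows "\<Phi> (Suc i) (cech_diff R fs M i c) = cech_diff A (map \<phi> fs) N i (\<Phi> i c)"
proof (rule cech_module_eqI)
  show "\<Phi> (Suc i) (cech_diff R fs M i c) \<in> carrier (N.C (Suc i))"
    "cech_diff A (map \<phi> fs) N i (\<Phi> i c) \<in> carrier (N.C (Suc i))"
    using c by (auto intro!: abelian_group_hom.hom_closed[OF map_hom]
        abelian_group_hom.hom_closed[OF diff_hom] abelian_group_hom.hom_closed[OF N.diff_hom])
  fix T assume "T \<in> cech_index (map \<phi> fs) (Suc i)"
  then have T: "T \<in> cech_index fs (Suc i)" by simp
  note sub = cech_index_subset[OF T]
  interpret N: abelian_group "N.L T"
    by (rule N.loc_abelian_group) (use sub in simp)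
  have "\<Phi> (Suc i) (cech_diff R fs M i c) T =
      finsum (N.L T) (\<lambda>j. frac_map A N (\<phi> (E T)) g (cech_face R fs M T j (c (T - {j})))) T"
    unfolding map_apply[OF T] cech_diff_apply[OF T]
    by (rule abelian_group_hom.hom_finsum[OF component_hom[OF sub] cech_index_finite[OF T]])
      (rule face_closed[OF T _ c])
  also have "\<dots> = finsum (N.L T) (\<lambda>j. cech_face A (map \<phi> fs) N T j (\<Phi> i c (T - {j}))) T"
  proof (rule N.finsum_cong')
    fix j assume j: "j \<in> T"
    show "frac_map A N (\<phi> (E T)) g (cech_face R fs M T j (c (T - {j}))) =
        cech_face A (map \<phi> fs) N T j (\<Phi> i c (T - {j}))"
      using c cech_index_remove[OF T j]
      by (simp add: face_map[OF sub j] map_apply cech_module_carrier_iff)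
  qed (use N.face_closed[of T i _ "\<Phi> i c"] T abelian_group_hom.hom_closed[OF map_hom c] in auto)
  finally show "\<Phi> (Suc i) (cech_diff R fs M i c) T = cech_diff A (map \<phi> fs) N i (\<Phi> i c) T"
    using T by (simp add: cech_diff_apply)
qed

text \<open>With \<open>q = 1\<close> denominators are kept, so lifting each numerator lifts the
  fraction. The components are chosen independently because the terms of the complex are
  products.\<close>

lemma map_surj:
  assumes surj: "h ` carrier M = carrier N" and q: "q = 1" and c: "c \<in> carrier (N.C i)"
  obtains b where "b \<in> carrier (C i)" "\<Phi> i b = c"
proof -
  have "\<exists>y\<in>carrier (L T). frac_map A N (\<phi> (E T)) g y = c T" if T: "T \<in> cech_index fs i" for T
  proof -
    have "c T \<in> carrier (N.L T)"
      using c T by (simp add: cech_module_carrier_iff)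
    then obtain n a where "n \<in> carrier N" "c T = frac A N (N.E T) (n, a)"
      by (rule N.localization_cases)
    moreover then obtain m where "m \<in> carrier M" "n = h m" using surj by blast
    ultimately show ?thesis
      using frac_map_frac[OF elem_closed[OF cech_index_subset[OF T]], of m a]
        elem_map[OF cech_index_subset[OF T]] q by (intro bexI[of _ "frac R M (E T) (m, a)"]) auto
  qed
  then obtain y where y: "\<And>T. T \<in> cech_index fs i \<Longrightarrow> y T \<in> carrier (L T) \<and> frac_map A N (\<phi> (E T)) g (y T) = c T"
    by metis
  show thesis
  proof
    show b: "restrict y (cech_index fs i) \<in> carrier (C i)"
      using y by (simp add: cech_module_carrier_iff)
    show "\<Phi> i (restrict y (cech_index fs i)) = c"
      by (rule cech_module_eqI[OF abelian_group_hom.hom_closed[OF map_hom b] c])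
        (use y in \<open>simp add: map_apply\<close>)
  qed
qed

text \<open>Localization preserves the exactness: if \<open>h m / e^a\<close> vanishes, then
  \<open>h\<close> kills \<open>e^(k+a) m\<close>, which is therefore some \<open>t n\<close>;
  enlarging the denominator by \<open>e^(k+a)\<close> rewrites \<open>m / e^a\<close> as
  \<open>t\<close> times a fraction. With \<open>map_smult_zero\<close> this identifies the cochains
  modulo \<open>t\<close> with the cochains of the quotient.\<close>

lemma map_kernel:
  assumes q: "q = 1" and t: "t \<in> carrier R"
    and ker: "\<And>m. \<lbrakk>m \<in> carrier M; h m = \<zero>\<^bsub>N\<^esub>\<rbrakk> \<Longrightarrow> \<exists>n\<in>carrier M. m = t \<odot>\<^bsub>M\<^esub> n"
    and c: "c \<in> carrier (C i)" "\<Phi> i c = \<zero>\<^bsub>N.C i\<^esub>"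
  obtains b where "b \<in> carrier (C i)" "c = t \<odot>\<^bsub>C i\<^esub> b"
proof -
  have "\<exists>y\<in>carrier (L T). c T = t \<odot>\<^bsub>L T\<^esub> y" if T: "T \<in> cech_index fs i" for T
  proof -
    have e: "E T \<in> carrier R"
      using T by (simp add: elem_closed cech_index_subset)
    have "c T \<in> carrier (L T)"
      using c T by (simp add: cech_module_carrier_iff)
    then obtain m a where m: "m \<in> carrier M" and cT: "c T = frac R M (E T) (m, a)"
      by (rule M.localization_cases)
    have "\<Phi> i c T = \<zero>\<^bsub>N.L T\<^esub>"
      using c(2) T by (simp add: cech_module_apply)
    then have "frac A N (\<phi> (E T)) (h m, a) = frac A N (\<phi> (E T)) (\<zero>\<^bsub>N\<^esub>, a)"
      using e m T q N.zero_localization[of "\<phi> (E T)" a]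
      by (simp add: map_apply cT frac_map_frac elem_map cech_index_subset)
    then obtain k where "(\<phi> (E T) [^]\<^bsub>A\<^esub> (k + a)) \<odot>\<^bsub>N\<^esub> h m = (\<phi> (E T) [^]\<^bsub>A\<^esub> (k + a)) \<odot>\<^bsub>N\<^esub> \<zero>\<^bsub>N\<^esub>"
      using N.frac_eq_iff[of "\<phi> (E T)" "h m" "\<zero>\<^bsub>N\<^esub>" a a] e m by auto
    then have "h ((E T [^]\<^bsub>R\<^esub> (k + a)) \<odot>\<^bsub>M\<^esub> m) = \<zero>\<^bsub>N\<^esub>"
      using e m q by (simp add: map_pow_smult)
    then obtain n where n: "n \<in> carrier M" "(E T [^]\<^bsub>R\<^esub> (k + a)) \<odot>\<^bsub>M\<^esub> m = t \<odot>\<^bsub>M\<^esub> n"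
      using ker[of "(E T [^]\<^bsub>R\<^esub> (k + a)) \<odot>\<^bsub>M\<^esub> m"] e m by auto
    then have "c T = t \<odot>\<^bsub>L T\<^esub> frac R M (E T) (n, a + (k + a))"
      unfolding cT using e m t M.frac_cancel[OF e m, of "k + a" a] by (simp add: M.smult_frac)
    then show ?thesis using n by auto
  qed
  then obtain y where y: "\<And>T. T \<in> cech_index fs i \<Longrightarrow> y T \<in> carrier (L T) \<and> c T = t \<odot>\<^bsub>L T\<^esub> y T"
    by metis
  show thesis
  proof
    show b: "restrict y (cech_index fs i) \<in> carrier (C i)"
      using y by (simp add: cech_module_carrier_iff)
    show "c = t \<odot>\<^bsub>C i\<^esub> restrict y (cech_index fs i)"
      by (rule cech_module_eqI[OF c(1) C_smult_closed[OF t b]])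
        (use y in \<open>simp add: cech_module_apply\<close>)
  qed
qed

lemma map_smult_zero:
  assumes t: "t \<in> carrier R" and ann: "\<And>m. m \<in> carrier M \<Longrightarrow> h (t \<odot>\<^bsub>M\<^esub> m) = \<zero>\<^bsub>N\<^esub>"
    and c: "c \<in> carrier (C i)"
  shows "\<Phi> i (t \<odot>\<^bsub>C i\<^esub> c) = \<zero>\<^bsub>N.C i\<^esub>"
proof (rule cech_module_eqI)
  show "\<Phi> i (t \<odot>\<^bsub>C i\<^esub> c) \<in> carrier (N.C i)" "\<zero>\<^bsub>N.C i\<^esub> \<in> carrier (N.C i)"
    using t c by (auto intro!: N.C_zero_closed C_smult_closed abelian_group_hom.hom_closed[OF map_hom])
  fix T assume "T \<in> cech_index (map \<phi> fs) i"
  then have T: "T \<in> cech_index fs i" by simp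
  have e: "E T \<in> carrier R"
    using T by (simp add: elem_closed cech_index_subset)
  have "c T \<in> carrier (L T)"
    using c T by (simp add: cech_module_carrier_iff)
  then obtain m a where m: "m \<in> carrier M" and cT: "c T = frac R M (E T) (m, a)"
    by (rule M.localization_cases)
  show "\<Phi> i (t \<odot>\<^bsub>C i\<^esub> c) T = \<zero>\<^bsub>N.C i\<^esub> T"
    using T e m t ann[OF m] N.zero_localization[of "\<phi> (E T)" "q * a"]
    by (simp add: map_apply cech_module_apply cT M.smult_frac frac_map_frac elem_map cech_index_subset)
qed

end

context cech
begin

text \<open>Regularity passes to localizations: the power of \<open>E T\<close> that kills
  \<open>t m\<close> commutes with \<open>t\<close>, so regularity applied to the multiple of
  \<open>m\<close> by that power shows that the fraction is already zero.\<close>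

lemma smult_cancel:
  assumes t: "t \<in> carrier R" and reg: "\<And>m. \<lbrakk>m \<in> carrier M; t \<odot>\<^bsub>M\<^esub> m = \<zero>\<^bsub>M\<^esub>\<rbrakk> \<Longrightarrow> m = \<zero>\<^bsub>M\<^esub>"
    and c: "c \<in> carrier (C i)" "t \<odot>\<^bsub>C i\<^esub> c = \<zero>\<^bsub>C i\<^esub>"
  shows "c = \<zero>\<^bsub>C i\<^esub>"
proof (rule cech_module_eqI[OF c(1) C_zero_closed])
  fix T assume T: "T \<in> cech_index fs i"
  have e: "E T \<in> carrier R"
    using T by (simp add: elem_closed cech_index_subset)
  have "c T \<in> carrier (L T)"
    using c T by (simp add: cech_module_carrier_iff)
  then obtain m a where m: "m \<in> carrier M" and cT: "c T = frac R M (E T) (m, a)"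
    by (rule localization_cases)
  have "frac R M (E T) (t \<odot>\<^bsub>M\<^esub> m, a) = frac R M (E T) (\<zero>\<^bsub>M\<^esub>, a)"
    using arg_cong[OF c(2), of "\<lambda>c. c T"] T e m t zero_localization[OF e, of a]
    by (simp add: cech_module_apply cT smult_frac)
  then obtain k where "E T [^] (k + a) \<odot>\<^bsub>M\<^esub> (t \<odot>\<^bsub>M\<^esub> m) = E T [^] (k + a) \<odot>\<^bsub>M\<^esub> \<zero>\<^bsub>M\<^esub>"
    using frac_eq_iff[of "E T" "t \<odot>\<^bsub>M\<^esub> m" "\<zero>\<^bsub>M\<^esub>" a a] e m t by auto
  then have "t \<odot>\<^bsub>M\<^esub> (E T [^] (k + a) \<odot>\<^bsub>M\<^esub> m) = \<zero>\<^bsub>M\<^esub>"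
    using e m t smult_left_commute[of t "E T [^] (k + a)" m] by simp
  then have "E T [^] (k + a) \<odot>\<^bsub>M\<^esub> m = \<zero>\<^bsub>M\<^esub>"
    using reg e m by simp
  then have "frac R M (E T) (m, a) = frac R M (E T) (\<zero>\<^bsub>M\<^esub>, a)"
    using e m by (subst frac_eq_iff) (auto intro!: exI[of _ k])
  then show "c T = \<zero>\<^bsub>C i\<^esub> T"
    using T zero_localization[OF e, of a] by (simp add: cech_module_apply cT)
qed

end


section \<open>Powers in prime characteristic\<close>

lemma (in cring) binomial:
  assumes a: "a \<in> carrier R" and b: "b \<in> carrier R"
  shows "(a \<oplus> b) [^] n = (\<Oplus>k\<in>{..n}. [(n choose k)] \<cdot> (a [^] k \<otimes> b [^] (n - k)))"
proof -
  define t where "t n k = [(n choose k)] \<cdot> (a [^] k \<otimes> b [^] (n - k))" for n k :: nat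
  have t_closed [simp]: "t n k \<in> carrier R" for n k
    using a b by (simp add: t_def)
  have step0: "t (Suc n) 0 = b \<otimes> t n 0" for n
    using a b by (simp add: t_def m_comm)
  have step: "t (Suc n) (Suc k) = a \<otimes> t n k \<oplus> b \<otimes> t n (Suc k)" if "k \<le> n" for n k
  proof -
    have 1: "a \<otimes> t n k = [(n choose k)] \<cdot> (a [^] Suc k \<otimes> b [^] (n - k))"
      using a b by (simp add: t_def add_pow_rdistr[symmetric] m_ac)
    have 2: "b \<otimes> t n (Suc k) = [(n choose Suc k)] \<cdot> (a [^] Suc k \<otimes> b [^] (n - k))"
    proof (cases "k < n")
      case True
      then have "n - k = Suc (n - Suc k)" by simp
      then have "b [^] (n - k) = b [^] (n - Suc k) \<otimes> b"
        using b by (simp del: diff_Suc_Suc)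
      then show ?thesis
        using a b by (simp add: t_def add_pow_rdistr[symmetric] m_ac)
    next
      \<comment> \<open>Here \<open>k = n\<close>, and truncated subtraction gives no factor
        \<open>b\<close> to split off. Both sides still agree because the coefficient
        \<open>n choose Suc k\<close> is zero.\<close>
      case False
      then have "n choose Suc k = 0" by simp
      then show ?thesis
        using a b by (simp only: t_def) simp
    qed
    show ?thesis
      unfolding 1 2 using a b by (simp add: t_def add.nat_pow_mult[symmetric])
  qed
  have "(a \<oplus> b) [^] n = finsum R (t n) {..n}"
  proof (induction n)
    case 0
    then show ?case using a b by (simp add: t_def)
  next
    case (Suc n)
    let ?S = "finsum R (t n) {..n}"
    have S: "?S \<in> carrier R" by (rule finsum_closed) simp
    have "finsum R (t (Suc n)) {..Suc n} = finsum R (\<lambda>k. t (Suc n) (Suc k)) {..n} \<oplus> t (Suc n) 0"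
      by (rule finsum_Suc2) simp
    also have "finsum R (\<lambda>k. t (Suc n) (Suc k)) {..n} =
        finsum R (\<lambda>k. a \<otimes> t n k \<oplus> b \<otimes> t n (Suc k)) {..n}"
      using a b step by (intro finsum_cong' refl) auto
    also have "\<dots> = finsum R (\<lambda>k. a \<otimes> t n k) {..n} \<oplus> finsum R (\<lambda>k. b \<otimes> t n (Suc k)) {..n}"
      using a b by (intro finsum_addf) auto
    also have "\<dots> = a \<otimes> ?S \<oplus> b \<otimes> finsum R (\<lambda>k. t n (Suc k)) {..n}"
      using a b by (subst (1 2) finsum_rdistr) auto
    also have "(\<dots>) \<oplus> t (Suc n) 0 = a \<otimes> ?S \<oplus> b \<otimes> (finsum R (\<lambda>k. t n (Suc k)) {..n} \<oplus> t n 0)"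
      using a b by (simp add: step0 r_distr a_assoc finsum_closed)
    \<comment> \<open>After the shift of index the sum runs to \<open>Suc n\<close>; its extra top
      term has coefficient \<open>n choose Suc n = 0\<close> and drops out.\<close>
    also have "finsum R (\<lambda>k. t n (Suc k)) {..n} \<oplus> t n 0 = finsum R (t n) {..Suc n}"
      by (rule finsum_Suc2[symmetric]) simp
    also have "\<dots> = t n (Suc n) \<oplus> ?S"
      by (rule finsum_Suc) simp
    also have "t n (Suc n) = \<zero>"
      using a b binomial_eq_0[of n "Suc n"] by (simp only: t_def) simp
    also have "a \<otimes> ?S \<oplus> b \<otimes> (\<zero> \<oplus> ?S) = (a \<oplus> b) [^] Suc n"
      using a b S Suc.IH by (simp add: l_distr m_comm)
    finally show ?case ..
  qed
  then show ?thesis unfolding t_def .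
qed

lemma (in cring) freshmans_dream:
  assumes p: "prime p" "has_char R p" and a: "a \<in> carrier R" and b: "b \<in> carrier R"
  shows "(a \<oplus> b) [^] p = a [^] p \<oplus> b [^] p"
proof -
  define t where "t k = [(p choose k)] \<cdot> (a [^] k \<otimes> b [^] (p - k))" for k
  have t_closed [simp]: "t k \<in> carrier R" for k
    using a b by (simp add: t_def)
  have p0: "p > 0" using p prime_gt_0_nat by blast
  have t0: "t k = \<zero>" if "0 < k" "k < p" for k
  proof -
    have "p dvd (p choose k)" using p that by (intro dvd_choose_prime) auto
    then have "[(p choose k)] \<cdot> \<one> = \<zero>" using p by (simp add: has_char_def)
    then show ?thesis
      using a b add_pow_ldistr[of \<one> "a [^] k \<otimes> b [^] (p - k)" "p choose k"] by (simp add: t_def)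
  qed
  have "(a \<oplus> b) [^] p = finsum R t {..p}"
    unfolding binomial[OF a b] t_def ..
  also have "{..p} = insert p (insert 0 {0<..<p})"
    using p0 by auto
  also have "finsum R t (insert p (insert 0 {0<..<p})) = t p \<oplus> (t 0 \<oplus> finsum R t {0<..<p})"
    using p0 by (simp add: Pi_def)
  also have "finsum R t {0<..<p} = finsum R (\<lambda>_. \<zero>) {0<..<p}"
    using t0 by (intro finsum_cong' refl) auto
  finally show ?thesis
    using a b by (simp add: t_def)
qed

lemma (in cring) freshmans_dream_iterated:
  assumes "prime p" "has_char R p" and a: "a \<in> carrier R" and b: "b \<in> carrier R"
  shows "(a \<oplus> b) [^] (p ^ e) = a [^] (p ^ e) \<oplus> b [^] (p ^ e)"
proof (induction e)
  case (Suc e)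
  have "(a \<oplus> b) [^] (p ^ Suc e) = ((a \<oplus> b) [^] (p ^ e)) [^] p"
    using a b by (simp add: nat_pow_pow mult.commute)
  also have "\<dots> = (a [^] (p ^ e) \<oplus> b [^] (p ^ e)) [^] p"
    unfolding Suc ..
  also have "\<dots> = a [^] (p ^ Suc e) \<oplus> b [^] (p ^ Suc e)"
    using assms by (simp add: freshmans_dream nat_pow_pow mult.commute)
  finally show ?case .
qed (use a b in simp)

text \<open>The elements with some \<open>p\<^sup>e\<close>-th power in \<open>J\<close> form an ideal because Frobenius is additive.\<close>

lemma (in cring) genideal_power_mem:
  assumes p: "prime p" "has_char R p" and J: "ideal J R" and F: "F \<subseteq> carrier R"
    and pow: "\<And>f. f \<in> F \<Longrightarrow> \<exists>n::nat. f [^] n \<in> J"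
    and r: "r \<in> Idl F"
  shows "\<exists>n::nat. r [^] n \<in> J"
proof -
  interpret J: ideal J R by (rule J)
  define K where "K = {r \<in> carrier R. \<exists>e. r [^] (p ^ e) \<in> J}"
  have mono: "r [^] n \<in> J" if "r [^] m \<in> J" "r \<in> carrier R" "m \<le> n" for r and m n :: nat
  proof -
    have "r [^] n = r [^] m \<otimes> r [^] (n - m)"
      using that by (simp add: nat_pow_mult)
    then show ?thesis using that by (simp add: J.I_r_closed)
  qed
  have pe: "p ^ e \<le> p ^ e'" if "e \<le> e'" for e e'
    using that p prime_gt_0_nat[of p] by (intro power_increasing) auto
  have mult: "s \<otimes> r \<in> K" if r: "r \<in> K" and s: "s \<in> carrier R" for r s
  proof -
    obtain e where "r \<in> carrier R" "r [^] (p ^ e) \<in> J" using r by (auto simp: K_def)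
    then show ?thesis
      using s by (auto simp: K_def nat_pow_distrib intro!: exI[of _ e] J.I_l_closed)
  qed
  have "ideal K R"
  proof (rule idealI)
    show "subgroup K (add_monoid R)"
    proof (rule add.subgroupI)
      have "\<zero> [^] (p ^ 0) \<in> J" by simp
      then show "K \<noteq> {}" unfolding K_def by blast
      fix a assume a: "a \<in> K"
      \<comment> \<open>Negation is multiplication by a ring element, so no parity of the exponent
        \<open>p^e\<close> enters.\<close>
      then have "(\<ominus> \<one>) \<otimes> a \<in> K" by (rule mult) simp
      then show "\<ominus> a \<in> K" using a by (simp add: K_def l_minus)
      fix b assume b: "b \<in> K"
      obtain d e where de: "a [^] (p ^ d) \<in> J" "b [^] (p ^ e) \<in> J"
        using a b by (auto simp: K_def)
      have "a [^] (p ^ (d + e)) \<in> J" "b [^] (p ^ (d + e)) \<in> J"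
        using a b by (auto simp: K_def intro!: mono[OF de(1)] mono[OF de(2)] pe)
      then have "(a \<oplus> b) [^] (p ^ (d + e)) \<in> J"
        using a b p by (subst freshmans_dream_iterated) (auto simp: K_def)
      then show "a \<oplus> b \<in> K" using a b by (auto simp: K_def)
    qed (auto simp: K_def)
  next
    fix a s assume "a \<in> K" "s \<in> carrier R"
    then show "s \<otimes> a \<in> K" by (intro mult)
    then show "a \<otimes> s \<in> K"
      using \<open>a \<in> K\<close> \<open>s \<in> carrier R\<close> by (simp add: K_def m_comm)
  qed (rule ring_axioms)
  moreover have "F \<subseteq> K"
  proof
    fix f assume f: "f \<in> F"
    then obtain n where n: "f [^] (n::nat) \<in> J" using pow by blast
    \<comment> \<open>Any exponent is dominated by a power of \<open>p\<close>, so arbitrary powers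
      in \<open>J\<close> give membership in \<open>K\<close>.\<close>
    have "n \<le> p ^ n"
      using p prime_ge_2_nat[of p] by (meson less_exp less_imp_le order_trans power_mono zero_le)
    then show "f \<in> K" using mono[OF n] f F by (auto simp: K_def)
  qed
  ultimately have "Idl F \<subseteq> K" by (rule genideal_minimal)
  then show ?thesis using r by (auto simp: K_def)
qed


section \<open>Cocycles are torsion\<close>

lemma cech_index_insert:
  assumes "T \<in> cech_index fs i" "j < length fs" "j \<notin> T"
  shows "insert j T \<in> cech_index fs (Suc i)"
  using assms cech_index_finite[OF assms(1)] by (auto simp: cech_index_def)

lemma cech_index_0: "cech_index fs 0 = {{}}"
  by (auto simp: cech_index_def card_eq_0_iff finite_subset)

context cech
begin

text \<open>At \<open>T\<close> without \<open>j\<close>, the cocycle condition on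
  \<open>insert j T\<close> has one surviving summand, the face that inserts \<open>j\<close>: all
  others come from index sets that contain \<open>j\<close>. Its vanishing means that
  \<open>c T\<close> dies once \<open>fs ! j\<close> is inverted, hence under a power of
  \<open>fs ! j\<close>.\<close>

lemma vanishing_power_torsion:
  assumes c: "c \<in> carrier (C i)" "cech_diff R fs M i c = \<zero>\<^bsub>C (Suc i)\<^esub>"
    and j: "j < length fs"
    and vanish: "\<And>T. \<lbrakk>T \<in> cech_index fs i; j \<in> T\<rbrakk> \<Longrightarrow> c T = \<zero>\<^bsub>L T\<^esub>"
  obtains n where "fs ! j [^] (n::nat) \<odot>\<^bsub>C i\<^esub> c = \<zero>\<^bsub>C i\<^esub>"
proof -
  have f: "fs ! j \<in> carrier R" by (rule nth_closed[OF j])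
  have "\<exists>n::nat. fs ! j [^] n \<odot>\<^bsub>L T\<^esub> c T = \<zero>\<^bsub>L T\<^esub>" if T: "T \<in> cech_index fs i" for T
  proof (cases "j \<in> T")
    case True
    interpret L: module R "L T" by (rule loc_module[OF cech_index_subset[OF T]])
    show ?thesis using vanish[OF T True] f by simp
  next
    case False
    let ?S = "insert j T"
    have S: "?S \<in> cech_index fs (Suc i)" and ST: "?S - {j} = T"
      using cech_index_insert[OF T j False] False by auto
    note sub = cech_index_subset[OF S]
    interpret S: abelian_group "L ?S" by (rule loc_abelian_group[OF sub])
    have e: "E T \<in> carrier R"
      using T by (simp add: elem_closed cech_index_subset)
    have cT: "c T \<in> carrier (L T)"
      using c T by (simp add: cech_module_carrier_iff)
    then obtain m a where m: "m \<in> carrier M" and cTm: "c T = frac R M (E T) (m, a)"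
      by (rule localization_cases)
    have others: "cech_face R fs M ?S k (c (?S - {k})) = \<zero>\<^bsub>L ?S\<^esub>" if k: "k \<in> T" for k
    proof -
      have "?S - {k} \<in> cech_index fs i" using k by (intro cech_index_remove[OF S]) auto
      then have "c (?S - {k}) = \<zero>\<^bsub>L (?S - {k})\<^esub>"
        using k False by (intro vanish) auto
      moreover have "abelian_group_hom (L (?S - {k})) (L ?S) (cech_face R fs M ?S k)"
        using k by (intro face_hom sub) auto
      ultimately show ?thesis using abelian_group_hom.hom_zero by metis
    qed
    have face: "cech_face R fs M ?S j (c T) \<in> carrier (L ?S)"
      using face_closed[OF S, of j c] c ST by simp
    have "\<zero>\<^bsub>L ?S\<^esub> = cech_diff R fs M i c ?S"
      unfolding c(2) cech_module_apply(2)[OF S] ..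
    also have "\<dots> = finsum (L ?S) (\<lambda>k. cech_face R fs M ?S k (c (?S - {k}))) ?S"
      by (rule cech_diff_apply[OF S])
    also have "finsum (L ?S) (\<lambda>k. cech_face R fs M ?S k (c (?S - {k}))) ?S =
        cech_face R fs M ?S j (c T) \<oplus>\<^bsub>L ?S\<^esub> finsum (L ?S) (\<lambda>k. cech_face R fs M ?S k (c (?S - {k}))) T"
      using False cech_index_finite[OF T] others face ST by (subst S.finsum_insert) auto
    also have "finsum (L ?S) (\<lambda>k. cech_face R fs M ?S k (c (?S - {k}))) T = finsum (L ?S) (\<lambda>k. \<zero>\<^bsub>L ?S\<^esub>) T"
      using others by (intro S.finsum_cong' refl) auto
    finally have "cech_face R fs M ?S j (c T) = \<zero>\<^bsub>L ?S\<^esub>"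
      using face by simp
    moreover have "loc_map R M (E T) (fs ! j) (c T) \<in> carrier (L ?S)"
      using abelian_group_hom.hom_closed[OF face_loc_map_hom[OF sub, of j]] cT ST by simp
    ultimately have "loc_map R M (E T) (fs ! j) (c T) = \<zero>\<^bsub>L ?S\<^esub>"
      unfolding cech_face_def ST Let_def by (auto split: if_splits dest: S.minus_minus)
    moreover have ES: "E ?S = E T \<otimes> fs ! j"
      using elem_remove[OF sub, of j] ST by simp
    ultimately have "frac R M (E T \<otimes> fs ! j) (fs ! j [^] a \<odot>\<^bsub>M\<^esub> m, a) = frac R M (E T \<otimes> fs ! j) (\<zero>\<^bsub>M\<^esub>, a)"
      using e f m zero_localization[of "E T \<otimes> fs ! j" a] by (simp add: cTm loc_map_frac)
    then obtain n where "(E T \<otimes> fs ! j) [^] (n + a) \<odot>\<^bsub>M\<^esub> (fs ! j [^] a \<odot>\<^bsub>M\<^esub> m) =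
        (E T \<otimes> fs ! j) [^] (n + a) \<odot>\<^bsub>M\<^esub> \<zero>\<^bsub>M\<^esub>"
      using frac_eq_iff[of "E T \<otimes> fs ! j" "fs ! j [^] a \<odot>\<^bsub>M\<^esub> m" "\<zero>\<^bsub>M\<^esub>" a a] e f m by auto
    \<comment> \<open>Splitting the power of the product: the factor \<open>fs ! j^n\<close> joins
      the numerator, while the power of \<open>E T\<close> can stay because \<open>E T\<close> is
      already inverted in \<open>L T\<close>.\<close>
    then have "E T [^] (n + a) \<odot>\<^bsub>M\<^esub> (fs ! j [^] (n + a + a) \<odot>\<^bsub>M\<^esub> m) = \<zero>\<^bsub>M\<^esub>"
      using e f m by (simp add: nat_pow_distrib smult_assoc1 smult_pow_add)
    then have "frac R M (E T) (fs ! j [^] (n + a + a) \<odot>\<^bsub>M\<^esub> m, a) = frac R M (E T) (\<zero>\<^bsub>M\<^esub>, a)"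
      using e f m by (subst frac_eq_iff) (auto intro!: exI[of _ n])
    then have "fs ! j [^] (n + a + a) \<odot>\<^bsub>L T\<^esub> c T = \<zero>\<^bsub>L T\<^esub>"
      using e f m zero_localization[OF e, of a] by (simp add: cTm smult_frac)
    then show ?thesis ..
  qed
  then obtain n where n: "\<And>T. T \<in> cech_index fs i \<Longrightarrow> fs ! j [^] (n T :: nat) \<odot>\<^bsub>L T\<^esub> c T = \<zero>\<^bsub>L T\<^esub>"
    by metis
  have fin: "finite (cech_index fs i)"
    by (simp add: cech_index_def)
  \<comment> \<open>There are finitely many index sets, and the sum of their exponents bounds each
    of them.\<close>
  define K where "K = sum n (cech_index fs i)"
  have "fs ! j [^] K \<odot>\<^bsub>C i\<^esub> c = \<zero>\<^bsub>C i\<^esub>"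
  proof (rule cech_module_eqI)
    fix T assume T: "T \<in> cech_index fs i"
    interpret L: module R "L T" by (rule loc_module[OF cech_index_subset[OF T]])
    have cT: "c T \<in> carrier (L T)"
      using c T by (simp add: cech_module_carrier_iff)
    have "n T \<le> K" unfolding K_def using fin T by (simp add: member_le_sum)
    then have "fs ! j [^] K = fs ! j [^] (K - n T) \<otimes> fs ! j [^] n T"
      using f by (simp add: nat_pow_mult)
    then have "fs ! j [^] K \<odot>\<^bsub>L T\<^esub> c T = \<zero>\<^bsub>L T\<^esub>"
      using f cT n[OF T] by (simp add: L.smult_assoc1)
    then show "(fs ! j [^] K \<odot>\<^bsub>C i\<^esub> c) T = \<zero>\<^bsub>C i\<^esub> T"
      using T by (simp add: cech_module_apply)
  qed (use f c in \<open>auto intro!: C_smult_closed C_zero_closed\<close>)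
  then show thesis by (rule that)
qed

text \<open>After inverting \<open>fs ! j\<close> the complex is contractible by
  \<open>(h c) S = c (insert j S)\<close> up to sign; this is that homotopy with its denominators
  cleared. Since \<open>b\<close> is zero wherever the index set contains \<open>j\<close>, only the
  face inserting \<open>j\<close> contributes to \<open>d b\<close> at a set \<open>T\<close>
  containing \<open>j\<close>.\<close>

lemma lift_faces:
  assumes c: "c \<in> carrier (C (Suc i))" and j: "j < length fs"
  obtains n b where "b \<in> carrier (C i)"
    "\<And>T. \<lbrakk>T \<in> cech_index fs (Suc i); j \<in> T\<rbrakk> \<Longrightarrow>
      cech_diff R fs M i b T = fs ! j [^] (n::nat) \<odot>\<^bsub>L T\<^esub> c T"
proof -
  have f: "fs ! j \<in> carrier R" by (rule nth_closed[OF j])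
  have "\<exists>n y. y \<in> carrier (L (T - {j})) \<and> cech_face R fs M T j y = fs ! j [^] (n::nat) \<odot>\<^bsub>L T\<^esub> c T"
    if T: "T \<in> cech_index fs (Suc i)" "j \<in> T" for T
  proof -
    note sub = cech_index_subset[OF T(1)]
    interpret j: abelian_group_hom "L (T - {j})" "L T" "cech_face R fs M T j"
      by (rule face_hom[OF sub T(2)])
    have e: "E (T - {j}) \<in> carrier R"
      using sub by (intro elem_closed) auto
    have eT: "E T = E (T - {j}) \<otimes> fs ! j"
      by (rule elem_remove[OF sub T(2), symmetric])
    have "c T \<in> carrier (L T)"
      using c T by (simp add: cech_module_carrier_iff)
    then obtain m a where m: "m \<in> carrier M" and cT: "c T = frac R M (E T) (m, a)"
      by (rule localization_cases)
    \<comment> \<open>The same numerator and exponent over the smaller denominator: passing to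
      \<open>L T\<close> multiplies the numerator by \<open>fs ! j^a\<close>, which is where the
      power in the conclusion comes from.\<close>
    define y where "y = frac R M (E (T - {j})) (m, a)"
    have y: "y \<in> carrier (L (T - {j}))" using m by (simp add: y_def)
    have "loc_map R M (E (T - {j})) (fs ! j) y = fs ! j [^] a \<odot>\<^bsub>L T\<^esub> c T"
      unfolding cT eT y_def using e f m by (simp add: loc_map_frac smult_frac)
    then have "cech_face R fs M T j y = fs ! j [^] a \<odot>\<^bsub>L T\<^esub> c T \<or>
        \<ominus>\<^bsub>L T\<^esub> cech_face R fs M T j y = fs ! j [^] a \<odot>\<^bsub>L T\<^esub> c T"
      unfolding cech_face_def Let_def using abelian_group_hom.hom_closed[OF face_loc_map_hom[OF sub T(2)] y] by simp
    \<comment> \<open>An odd sign is absorbed by replacing \<open>y\<close> with its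
      negative.\<close>
    then show ?thesis
      using y j.hom_a_inv[OF y] j.G.a_inv_closed by metis
  qed
  then obtain n y where y: "\<And>T. \<lbrakk>T \<in> cech_index fs (Suc i); j \<in> T\<rbrakk> \<Longrightarrow>
      y T \<in> carrier (L (T - {j})) \<and> cech_face R fs M T j (y T) = fs ! j [^] (n T :: nat) \<odot>\<^bsub>L T\<^esub> c T"
    by metis
  have fin: "finite (cech_index fs (Suc i))"
    by (simp add: cech_index_def)
  define K where "K = sum n (cech_index fs (Suc i))"
  \<comment> \<open>The factor with exponent \<open>K - n (insert j T)\<close> evens out the
    exponents, so that one power \<open>K\<close> serves all index sets.\<close>
  define b where "b = (\<lambda>T\<in>cech_index fs i. if j \<in> T then \<zero>\<^bsub>L T\<^esub>
    else fs ! j [^] (K - n (insert j T)) \<odot>\<^bsub>L T\<^esub> y (insert j T))"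
  note ins = cech_index_insert[OF _ j]
  have b_closed: "b \<in> carrier (C i)"
  proof -
    have "b T \<in> carrier (L T)" if T: "T \<in> cech_index fs i" for T
    proof -
      interpret L: module R "L T" by (rule loc_module[OF cech_index_subset[OF T]])
      show ?thesis
        using T f y[OF ins[OF T]] by (auto simp: b_def)
    qed
    then show ?thesis by (simp add: cech_module_carrier_iff) (simp add: b_def)
  qed
  show thesis
  proof
    show "b \<in> carrier (C i)" by (rule b_closed)
    fix T assume T: "T \<in> cech_index fs (Suc i)" "j \<in> T"
    note sub = cech_index_subset[OF T(1)]
    interpret L: module R "L T" by (rule loc_module[OF sub])
    have cT: "c T \<in> carrier (L T)"
      using c T by (simp add: cech_module_carrier_iff)
    have others: "cech_face R fs M T k (b (T - {k})) = \<zero>\<^bsub>L T\<^esub>" if k: "k \<in> T - {j}" for k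
    proof -
      have "T - {k} \<in> cech_index fs i" using k by (intro cech_index_remove[OF T(1)]) auto
      then have "b (T - {k}) = \<zero>\<^bsub>L (T - {k})\<^esub>"
        using k T by (auto simp: b_def)
      moreover have "abelian_group_hom (L (T - {k})) (L T) (cech_face R fs M T k)"
        using k by (intro face_hom sub) auto
      ultimately show ?thesis using abelian_group_hom.hom_zero by metis
    qed
    have "n T \<le> K" unfolding K_def using fin T by (simp add: member_le_sum)
    then have K: "fs ! j [^] K = fs ! j [^] (K - n T) \<otimes> fs ! j [^] n T"
      using f by (simp add: nat_pow_mult)
    have "b (T - {j}) = fs ! j [^] (K - n T) \<odot>\<^bsub>L (T - {j})\<^esub> y T"
      using cech_index_remove[OF T] T by (simp add: b_def insert_absorb)
    then have face: "cech_face R fs M T j (b (T - {j})) = fs ! j [^] K \<odot>\<^bsub>L T\<^esub> c T"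
      using face_smult[OF sub T(2), of "fs ! j [^] (K - n T)" "y T"] y[OF T] f cT
      by (simp add: K L.smult_assoc1)
    have "cech_diff R fs M i b T =
        finsum (L T) (\<lambda>k. cech_face R fs M T k (b (T - {k}))) (insert j (T - {j}))"
      unfolding cech_diff_apply[OF T(1)] using T(2) by (simp add: insert_absorb)
    also have "\<dots> = cech_face R fs M T j (b (T - {j})) \<oplus>\<^bsub>L T\<^esub>
        finsum (L T) (\<lambda>k. cech_face R fs M T k (b (T - {k}))) (T - {j})"
      using cech_index_finite[OF T(1)] face_closed[OF T(1) _ b_closed] T(2)
      by (intro L.finsum_insert) auto
    also have "finsum (L T) (\<lambda>k. cech_face R fs M T k (b (T - {k}))) (T - {j}) =
        finsum (L T) (\<lambda>k. \<zero>\<^bsub>L T\<^esub>) (T - {j})"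
      using others by (intro L.finsum_cong' refl) auto
    finally show "cech_diff R fs M i b T = fs ! j [^] K \<odot>\<^bsub>L T\<^esub> c T"
      using face f cT by simp
  qed
qed

text \<open>A multiple \<open>f\<^sub>j\<^sup>n c\<close> agrees with a coboundary on the index sets that contain \<open>j\<close>; on an index set
  \<open>T\<close> not containing \<open>j\<close>, the cocycle condition at \<open>T \<union> {j}\<close> makes the difference vanish in the
  localization at \<open>f\<^sub>j\<close>.\<close>

lemma nth_power_torsion:
  assumes c: "c \<in> cech_cocycles R fs M i" and j: "j < length fs"
  shows "\<exists>n::nat. fs ! j [^] n \<odot>\<^bsub>C i\<^esub> c \<in> cech_coboundaries R fs M i"
proof (cases i)
  case 0
  obtain n where "fs ! j [^] (n::nat) \<odot>\<^bsub>C i\<^esub> c = \<zero>\<^bsub>C i\<^esub>"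
  proof (rule vanishing_power_torsion)
    fix T assume "T \<in> cech_index fs i" "j \<in> T"
    then show "c T = \<zero>\<^bsub>L T\<^esub>"
      using 0 by (simp add: cech_index_0)
  qed (use c j in \<open>auto simp: cech_cocycles_def\<close>)
  then show ?thesis using 0 by (auto simp: cech_coboundaries_def)
next
  case (Suc k)
  have f: "fs ! j \<in> carrier R" by (rule nth_closed[OF j])
  interpret C: module R "C i" by (rule C_module)
  interpret d: abelian_group_hom "C i" "C (Suc i)" "cech_diff R fs M i" by (rule diff_hom)
  interpret d': abelian_group_hom "C k" "C i" "cech_diff R fs M k"
    unfolding Suc by (rule diff_hom)
  have cC: "c \<in> carrier (C i)" and dc: "cech_diff R fs M i c = \<zero>\<^bsub>C (Suc i)\<^esub>"
    using c by (auto simp: cech_cocycles_def)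
  obtain n b where b: "b \<in> carrier (C k)" and
    db: "\<And>T. \<lbrakk>T \<in> cech_index fs i; j \<in> T\<rbrakk> \<Longrightarrow>
      cech_diff R fs M k b T = fs ! j [^] (n::nat) \<odot>\<^bsub>L T\<^esub> c T"
    using lift_faces[of c k j] cC j Suc by metis
  define z where "z = fs ! j [^] n \<odot>\<^bsub>C i\<^esub> c \<ominus>\<^bsub>C i\<^esub> cech_diff R fs M k b"
  have z: "z \<in> carrier (C i)"
    using cC b f by (simp add: z_def)
  have dz: "cech_diff R fs M i z = \<zero>\<^bsub>C (Suc i)\<^esub>"
  proof -
    have "cech_diff R fs M i (fs ! j [^] n \<odot>\<^bsub>C i\<^esub> c) = \<zero>\<^bsub>C (Suc i)\<^esub>"
      using cC f dc by (simp add: diff_smult module.smult_r_null[OF C_module])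
    moreover have "cech_diff R fs M i (cech_diff R fs M k b) = \<zero>\<^bsub>C (Suc i)\<^esub>"
      using diff_diff[OF b] by (simp add: Suc)
    ultimately show ?thesis
      using cC b f by (simp add: z_def a_minus_def)
  qed
  have zd: "fs ! j [^] n \<odot>\<^bsub>C i\<^esub> c = z \<oplus>\<^bsub>C i\<^esub> cech_diff R fs M k b"
    using cC b f by (simp add: z_def a_minus_def C.a_assoc C.l_neg)
  have "z T = \<zero>\<^bsub>L T\<^esub>" if T: "T \<in> cech_index fs i" "j \<in> T" for T
  proof -
    interpret L: abelian_group "L T" by (rule loc_abelian_group[OF cech_index_subset[OF T(1)]])
    have "z T \<in> carrier (L T)" "cech_diff R fs M k b T \<in> carrier (L T)"
      using T z d'.hom_closed[OF b] by (simp_all add: cech_module_carrier_iff)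
    moreover have "cech_diff R fs M k b T = z T \<oplus>\<^bsub>L T\<^esub> cech_diff R fs M k b T"
      using arg_cong[OF zd, of "\<lambda>c. c T"] db[OF T] T by (simp add: cech_module_apply)
    ultimately show ?thesis by (metis L.add.r_cancel_one)
  qed
  then obtain l where l: "fs ! j [^] (l::nat) \<odot>\<^bsub>C i\<^esub> z = \<zero>\<^bsub>C i\<^esub>"
    using vanishing_power_torsion[OF z dz j] by metis
  have "fs ! j [^] (l + n) \<odot>\<^bsub>C i\<^esub> c = fs ! j [^] l \<odot>\<^bsub>C i\<^esub> (fs ! j [^] n \<odot>\<^bsub>C i\<^esub> c)"
    using f cC by (simp add: nat_pow_mult[symmetric] C.smult_assoc1)
  also have "\<dots> = fs ! j [^] l \<odot>\<^bsub>C i\<^esub> cech_diff R fs M k b"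
    unfolding zd using f z b l by (simp add: C.smult_r_distr)
  also have "\<dots> = cech_diff R fs M k (fs ! j [^] l \<odot>\<^bsub>C k\<^esub> b)"
    using f b Suc by (simp add: diff_smult)
  finally show ?thesis
    using f b C_smult_closed[of "fs ! j [^] l" b k] Suc unfolding cech_coboundaries_def
    by (intro exI[of _ "l + n"]) auto
qed

end


section \<open>Maps of cohomology modules\<close>

context cech
begin

lemma coboundaries_subgroup: "abelian_subgroup (cech_coboundaries R fs M i) (C i)"
proof -
  interpret C: abelian_group "C i" by (rule C_abelian_group)
  have "subgroup (cech_coboundaries R fs M i) (add_monoid (C i))"
  proof (cases i)
    case 0
    then show ?thesis
      using C.add.triv_subgroup by (simp add: cech_coboundaries_def)
  next
    case (Suc k)
    interpret d: abelian_group_hom "C k" "C (Suc k)" "cech_diff R fs M k" by (rule diff_hom)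
    show ?thesis
      using group_hom.img_is_subgroup[OF d.a_group_hom] Suc by (simp add: cech_coboundaries_def)
  qed
  then show ?thesis
    by (intro abelian_subgroupI3 additive_subgroup.intro C_abelian_group)
qed

lemma coboundaries_smult:
  assumes "r \<in> carrier R" "b \<in> cech_coboundaries R fs M i"
  shows "r \<odot>\<^bsub>C i\<^esub> b \<in> cech_coboundaries R fs M i"
proof (cases i)
  case 0
  then show ?thesis
    using assms module.smult_r_null[OF C_module] by (simp add: cech_coboundaries_def)
next
  case (Suc k)
  then obtain a where "a \<in> carrier (C k)" "b = cech_diff R fs M k a"
    using assms by (auto simp: cech_coboundaries_def)
  then show ?thesis
    using assms Suc C_smult_closed[of r a k] by (auto simp: cech_coboundaries_def diff_smult[symmetric])
qed

lemma coboundaries_cocycles: "cech_coboundaries R fs M i \<subseteq> cech_cocycles R fs M i"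
  using abelian_group_hom.hom_zero[OF diff_hom] abelian_group_hom.hom_closed[OF diff_hom]
  by (cases i) (auto simp: cech_coboundaries_def cech_cocycles_def C_zero_closed diff_diff)

text \<open>Cosets are formed by addition alone, so restricting the carrier to cocycles affects
  which cosets occur but not the cosets themselves. All computations can therefore be done in the
  full module \<open>C i\<close>.\<close>

lemma carrier_local_cohomology:
  "carrier (local_cohomology R fs M i) =
    (\<lambda>c. cech_coboundaries R fs M i +>\<^bsub>C i\<^esub> c) ` cech_cocycles R fs M i"
  by (auto simp: local_cohomology_def quotient_module_def A_RCOSETS_def RCOSETS_def
      a_r_coset_def r_coset_def)

lemma coset_eq_iff:
  assumes "c \<in> carrier (C i)" "c' \<in> carrier (C i)"
  shows "cech_coboundaries R fs M i +>\<^bsub>C i\<^esub> c = cech_coboundaries R fs M i +>\<^bsub>C i\<^esub> c' \<longleftrightarrow>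
    c \<ominus>\<^bsub>C i\<^esub> c' \<in> cech_coboundaries R fs M i"
proof -
  interpret B: abelian_subgroup "cech_coboundaries R fs M i" "C i"
    by (rule coboundaries_subgroup)
  have "c \<in> cech_coboundaries R fs M i +>\<^bsub>C i\<^esub> c' \<longleftrightarrow> c \<ominus>\<^bsub>C i\<^esub> c' \<in> cech_coboundaries R fs M i"
    unfolding a_minus_def by (rule B.a_rcos_module[OF assms(2,1)])
  then show ?thesis
    using assms B.a_rcos_self B.a_repr_independence' by metis
qed

text \<open>The annihilator of the class of \<open>c\<close>, here also for a cochain that need not
  be a cocycle. It serves as the ideal \<open>J\<close> of
  \<open>genideal_power_mem\<close>.\<close>

lemma ideal_annihilating_coboundary:
  assumes c: "c \<in> carrier (C i)"
  shows "ideal {r \<in> carrier R. r \<odot>\<^bsub>C i\<^esub> c \<in> cech_coboundaries R fs M i} R"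
proof (rule idealI)
  interpret C: module R "C i" by (rule C_module)
  interpret B: abelian_subgroup "cech_coboundaries R fs M i" "C i"
    by (rule coboundaries_subgroup)
  let ?J = "{r \<in> carrier R. r \<odot>\<^bsub>C i\<^esub> c \<in> cech_coboundaries R fs M i}"
  show "subgroup ?J (add_monoid R)"
  proof (rule R.add.subgroupI)
    show "?J \<noteq> {}" using c B.zero_closed by (intro ex_in_conv[THEN iffD1] exI[of _ \<zero>]) simp
  qed (use c in \<open>auto simp: C.smult_l_distr C.smult_l_minus\<close>)
  fix a r assume "a \<in> ?J" "r \<in> carrier R"
  then show "r \<otimes> a \<in> ?J" "a \<otimes> r \<in> ?J"
    using c coboundaries_smult[of r "a \<odot>\<^bsub>C i\<^esub> c" i] by (auto simp: C.smult_assoc1 R.m_comm[of a])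
qed (rule R.ring_axioms)

text \<open>Each generator has a power that annihilates the class of \<open>c\<close>; in
  characteristic \<open>p\<close> the elements with this property form an ideal, which then contains
  everything the generators generate.\<close>

lemma power_torsion:
  assumes p: "prime p" "has_char R p" and c: "c \<in> cech_cocycles R fs M i" and x: "x \<in> Idl (set fs)"
  shows "\<exists>n::nat. x [^] n \<odot>\<^bsub>C i\<^esub> c \<in> cech_coboundaries R fs M i"
proof -
  have cC: "c \<in> carrier (C i)" using c by (simp add: cech_cocycles_def)
  have "\<exists>n::nat. x [^] n \<in> {r \<in> carrier R. r \<odot>\<^bsub>C i\<^esub> c \<in> cech_coboundaries R fs M i}"
  proof (rule R.genideal_power_mem[OF p ideal_annihilating_coboundary[OF cC] fs_closed _ x])
    fix f assume "f \<in> set fs"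
    then obtain j where "j < length fs" "f = fs ! j" by (auto simp: in_set_conv_nth)
    then show "\<exists>n::nat. f [^] n \<in> {r \<in> carrier R. r \<odot>\<^bsub>C i\<^esub> c \<in> cech_coboundaries R fs M i}"
      using nth_power_torsion[OF c] nth_closed by auto
  qed
  then show ?thesis by blast
qed

end

context cech_semilinear
begin

lemma map_coboundaries:
  assumes "b \<in> cech_coboundaries R fs M i"
  shows "\<Phi> i b \<in> cech_coboundaries A (map \<phi> fs) N i"
proof (cases i)
  case 0
  then show ?thesis
    using assms abelian_group_hom.hom_zero[OF map_hom] by (simp add: cech_coboundaries_def)
next
  case (Suc k)
  then show ?thesis
    using assms abelian_group_hom.hom_closed[OF map_hom[of k]]
    by (auto simp: cech_coboundaries_def map_diff)
qed

lemma map_coboundaries_surj: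
  assumes surj: "h ` carrier M = carrier N" and q: "q = 1"
    and b: "b \<in> cech_coboundaries A (map \<phi> fs) N i"
  obtains a where "a \<in> cech_coboundaries R fs M i" "\<Phi> i a = b"
proof (cases i)
  case 0
  then show ?thesis
    using that[of "\<zero>\<^bsub>C i\<^esub>"] b abelian_group_hom.hom_zero[OF map_hom] by (simp add: cech_coboundaries_def)
next
  case (Suc k)
  then obtain b' where b': "b' \<in> carrier (N.C k)" "b = cech_diff A (map \<phi> fs) N k b'"
    using b by (auto simp: cech_coboundaries_def)
  obtain a where "a \<in> carrier (C k)" "\<Phi> k a = b'"
    using map_surj[OF surj q b'(1)] by metis
  then show ?thesis
    using that[of "cech_diff R fs M k a"] b' Suc by (auto simp: cech_coboundaries_def map_diff)
qed

text \<open>The union over a coset collapses as it does for fractions: two members differ by a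
  coboundary, which is sent to a coboundary.\<close>

lemma cohomology_map_coset:
  assumes c: "c \<in> carrier (C i)"
  shows "cohomology_map A (map \<phi> fs) N g i (cech_coboundaries R fs M i +>\<^bsub>C i\<^esub> c) =
    cech_coboundaries A (map \<phi> fs) N i +>\<^bsub>N.C i\<^esub> \<Phi> i c"
proof -
  interpret B: abelian_subgroup "cech_coboundaries R fs M i" "C i"
    by (rule coboundaries_subgroup)
  interpret B': abelian_subgroup "cech_coboundaries A (map \<phi> fs) N i" "N.C i"
    by (rule N.coboundaries_subgroup)
  interpret abelian_group_hom "C i" "N.C i" "\<Phi> i" by (rule map_hom)
  have "cech_coboundaries A (map \<phi> fs) N i +>\<^bsub>N.C i\<^esub> \<Phi> i c' =
      cech_coboundaries A (map \<phi> fs) N i +>\<^bsub>N.C i\<^esub> \<Phi> i c"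
    if "c' \<in> cech_coboundaries R fs M i +>\<^bsub>C i\<^esub> c" for c'
  proof -
    obtain b where b: "b \<in> cech_coboundaries R fs M i" "c' = b \<oplus>\<^bsub>C i\<^esub> c"
      using \<open>c' \<in> _\<close> by (auto simp: a_r_coset_def r_coset_def)
    have bC: "b \<in> carrier (C i)" using b B.a_subset by blast
    then have "\<Phi> i c' \<ominus>\<^bsub>N.C i\<^esub> \<Phi> i c = \<Phi> i b"
      using c b by (simp add: a_minus_def B'.a_assoc B'.r_neg)
    then show ?thesis
      using c bC b map_coboundaries[OF b(1)] by (subst N.coset_eq_iff) auto
  qed
  moreover have "c \<in> cech_coboundaries R fs M i +>\<^bsub>C i\<^esub> c"
    by (rule B.a_rcos_self[OF c])
  ultimately show ?thesis
    unfolding cohomology_map_def by blast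
qed

end

text \<open>A composite of two termwise maps, evaluated on one fraction. Two composites, such as
  reduction after Frobenius and Frobenius after reduction, are compared by comparing these
  values.\<close>

lemma cech_map_comp:
  assumes g: "cech_semilinear R M A N \<phi> q h g fs"
    and g': "cech_semilinear A N A' N' \<phi>' q' h' g' (map \<phi> fs)"
    and T: "T \<in> cech_index fs i" and m: "m \<in> carrier M" "c T = frac R M (cech_elem R fs T) (m, a)"
  shows "cech_map A' (map \<phi>' (map \<phi> fs)) N' g' i (cech_map A (map \<phi> fs) N g i c) T =
    frac A' N' (\<phi>' (\<phi> (cech_elem R fs T))) (h' (h m), q' * (q * a))"
proof -
  interpret G: cech_semilinear R M A N \<phi> q h g fs by (rule g)
  interpret H: cech_semilinear A N A' N' \<phi>' q' h' g' "map \<phi> fs" by (rule g')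
  have e: "G.E T \<in> carrier R"
    using T by (simp add: G.elem_closed cech_index_subset)
  show ?thesis
    using T m e G.elem_map[OF cech_index_subset[OF T]] H.map_apply[of T i]
    by (simp add: G.map_apply G.frac_map_frac H.frac_map_frac)
qed

section \<open>Rings and their quotients as modules, with the maps between them\<close>

lemma ring_module_simps [simp]:
  "carrier (ring_module A \<phi>) = carrier A" "zero (ring_module A \<phi>) = zero A"
  "add (ring_module A \<phi>) = add A" "smult (ring_module A \<phi>) r a = \<phi> r \<otimes>\<^bsub>A\<^esub> a"
  by (simp_all add: ring_module_def)

lemma ring_module_plain_module:
  assumes "cring R" "cring A" "\<phi> \<in> ring_hom R A"
  shows "plain_module R (ring_module A \<phi>)"
proof -
  interpret ring_hom_cring R A \<phi>
    using assms by (intro ring_hom_cring.intro ring_hom_cring_axioms.intro)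
  show ?thesis
    by (intro plain_module.intro moduleI abelian_groupI assms)
      (auto simp: S.l_distr S.r_distr S.m_assoc S.a_assoc intro: S.a_comm S.add.l_inv_ex[simplified])
qed

lemma self_module_plain_module: "cring R \<Longrightarrow> plain_module R (self_module R)"
  using id_ring_hom by (intro ring_module_plain_module) (auto simp: id_def)

lemma self_module_cech: "\<lbrakk>cring R; set fs \<subseteq> carrier R\<rbrakk> \<Longrightarrow> cech R (self_module R) fs"
  by (intro cech.intro cech_axioms.intro self_module_plain_module)

text \<open>Here \<open>\<phi>\<close> is the identity and the twist sits entirely in
  \<open>q = p\<close>: a scalar \<open>r\<close> comes out as \<open>r^p\<close>. Additivity is
  where the characteristic enters.\<close>

lemma frobenius_semilinear:
  assumes "cring R" "prime p" "has_char R p" "set fs \<subseteq> carrier R"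
  shows "cech_semilinear R (self_module R) R (self_module R) (\<lambda>a. a) p (\<lambda>a. a [^]\<^bsub>R\<^esub> p)
    (\<lambda>(a, n). (a [^]\<^bsub>R\<^esub> p, p * n)) fs"
proof -
  interpret cring R by (rule assms)
  show ?thesis
    using assms id_ring_hom
    by (intro cech_semilinear.intro semilinear_map.intro semilinear_map_axioms.intro
        self_module_plain_module self_module_cech)
      (auto simp: id_def freshmans_dream nat_pow_distrib)
qed

context ideal
begin

lemma quotient_ring_module_plain_module:
  assumes "cring R"
  shows "plain_module R (quotient_ring_module R I)"
  unfolding quotient_ring_module_def
  by (intro ring_module_plain_module quotient_is_cring rcos_ring_hom assms)

lemma rcos_surj: "(+>) I ` carrier R = carrier (R Quot I)"
  by (auto simp: FactRing_def A_RCOSETS_def')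

text \<open>Reduction onto \<open>R/I\<close> viewed as an \<open>R\<close>-module, the form in
  which the surjectivity hypothesis speaks of \<open>R/I\<close>.\<close>

lemma rcos_smult_semilinear:
  assumes R: "cring R" and fs: "set fs \<subseteq> carrier R"
  shows "cech_semilinear R (self_module R) R (quotient_ring_module R I) (\<lambda>a. a) 1 ((+>) I)
    (\<lambda>(m, a). (I +> m, a)) fs"
proof -
  interpret Q: ring_hom_cring R "R Quot I" "(+>) I" by (rule rcos_ring_hom_cring[OF R])
  show ?thesis
    using R fs id_ring_hom
    by (intro cech_semilinear.intro semilinear_map.intro semilinear_map_axioms.intro
        self_module_plain_module self_module_cech quotient_ring_module_plain_module)
      (auto simp: id_def quotient_ring_module_def Q.hom_closed Q.hom_add Q.hom_mult)
qed

text \<open>The same reduction onto \<open>R/I\<close> as a module over itself. The base ring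
  changes along with the module, as F-injectivity of \<open>R/I\<close> requires.\<close>

lemma rcos_ring_semilinear:
  assumes R: "cring R" and fs: "set fs \<subseteq> carrier R"
  shows "cech_semilinear R (self_module R) (R Quot I) (self_module (R Quot I)) ((+>) I) 1 ((+>) I)
    (\<lambda>(m, a). (I +> m, a)) fs"
proof -
  interpret Q: ring_hom_cring R "R Quot I" "(+>) I" by (rule rcos_ring_hom_cring[OF R])
  show ?thesis
    using R fs rcos_ring_hom quotient_is_cring
    by (intro cech_semilinear.intro semilinear_map.intro semilinear_map_axioms.intro
        self_module_plain_module self_module_cech)
      (auto simp: Q.hom_closed Q.hom_add Q.hom_mult)
qed

lemma quotient_proj_coset:
  assumes J: "ideal J R" and IJ: "I \<subseteq> J" and a: "a \<in> carrier R"
  shows "quotient_proj R J (I +> a) = J +> a"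
proof -
  interpret J: ideal J R by (rule J)
  have "J +> b = J +> a" if "b \<in> I +> a" for b
  proof -
    have "b \<in> J +> a" using that IJ by (auto simp: a_r_coset_def r_coset_def)
    then show ?thesis using J.a_repr_independence'[OF _ a] by simp
  qed
  moreover have "a \<in> I +> a" using a by (rule a_rcos_self)
  ultimately show ?thesis unfolding quotient_proj_def by blast
qed

lemma quotient_proj_semilinear:
  assumes R: "cring R" and fs: "set fs \<subseteq> carrier R" and J: "ideal J R" and IJ: "I \<subseteq> J"
  shows "cech_semilinear R (quotient_ring_module R I) R (quotient_ring_module R J) (\<lambda>a. a) 1
    (quotient_proj R J) (\<lambda>(m, a). (quotient_proj R J m, a)) fs"
proof -
  interpret J: ideal J R by (rule J)
  interpret Q: ring_hom_cring R "R Quot I" "(+>) I" by (rule rcos_ring_hom_cring[OF R])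
  interpret QJ: ring_hom_cring R "R Quot J" "(+>) J" by (rule J.rcos_ring_hom_cring[OF R])
  note proj = quotient_proj_coset[OF J IJ]
  have surj: "\<exists>m\<in>carrier R. X = I +> m" if "X \<in> carrier (R Quot I)" for X
    using that rcos_surj by blast
  have closed: "quotient_proj R J X \<in> carrier (R Quot J)" if "X \<in> carrier (R Quot I)" for X
    using surj[OF that] by (auto simp: proj)
  have add: "quotient_proj R J (X \<oplus>\<^bsub>R Quot I\<^esub> Y) = quotient_proj R J X \<oplus>\<^bsub>R Quot J\<^esub> quotient_proj R J Y"
    if "X \<in> carrier (R Quot I)" "Y \<in> carrier (R Quot I)" for X Y
    using surj[OF that(1)] surj[OF that(2)]
    by (auto simp: proj Q.hom_add[symmetric] simp del: Q.hom_add)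
  have smult: "quotient_proj R J ((I +> r) \<otimes>\<^bsub>R Quot I\<^esub> X) = (J +> r) \<otimes>\<^bsub>R Quot J\<^esub> quotient_proj R J X"
    if "r \<in> carrier R" "X \<in> carrier (R Quot I)" for r X
    using surj[OF that(2)] that(1)
    by (auto simp: proj Q.hom_mult[symmetric] simp del: Q.hom_mult)
  show ?thesis
    using R fs id_ring_hom closed add smult
    by (intro cech_semilinear.intro semilinear_map.intro semilinear_map_axioms.intro cech.intro
        cech_axioms.intro quotient_ring_module_plain_module J.quotient_ring_module_plain_module)
      (auto simp: id_def quotient_ring_module_def)
qed

end


section \<open>Deformation of F-injectivity\<close>

context cech
begin

lemma smult_left_cancel:
  assumes t: "t \<in> carrier R" and reg: "\<And>m. \<lbrakk>m \<in> carrier M; t \<odot>\<^bsub>M\<^esub> m = \<zero>\<^bsub>M\<^esub>\<rbrakk> \<Longrightarrow> m = \<zero>\<^bsub>M\<^esub>"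
    and c: "c \<in> carrier (C i)" "c' \<in> carrier (C i)" "t \<odot>\<^bsub>C i\<^esub> c = t \<odot>\<^bsub>C i\<^esub> c'"
  shows "c = c'"
proof -
  interpret C: module R "C i" by (rule C_module)
  have "t \<odot>\<^bsub>C i\<^esub> (c \<ominus>\<^bsub>C i\<^esub> c') = \<zero>\<^bsub>C i\<^esub>"
    using t c by (simp add: a_minus_def C.smult_r_distr C.smult_r_minus C.r_neg)
  then have "c \<ominus>\<^bsub>C i\<^esub> c' = \<zero>\<^bsub>C i\<^esub>"
    using smult_cancel[OF t reg, of "c \<ominus>\<^bsub>C i\<^esub> c'" i] c by simp
  then show ?thesis
    using c C.a_assoc[of c "\<ominus>\<^bsub>C i\<^esub> c'" c'] by (simp add: a_minus_def C.l_neg)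
qed

text \<open>Replacing \<open>\<theta>\<close> costs a term \<open>x \<beta>\<close>, so cancelling
  \<open>x\<close> gives \<open>x^k \<eta> + d \<beta> = x^(k+1) \<zeta>\<close>. Thus the multiple
  by \<open>x^k\<close> of \<open>\<eta> - x \<zeta>\<close>, rather than of \<open>\<eta>\<close>,
  is a coboundary. The induction therefore runs over all cocycles; passing to
  \<open>\<eta> - x \<zeta>\<close> is harmless because the claim is only modulo
  \<open>x\<close>.\<close>

lemma cocycle_mod_coboundaries_divisible:
  assumes x: "x \<in> carrier R" and reg: "\<And>m. \<lbrakk>m \<in> carrier M; x \<odot>\<^bsub>M\<^esub> m = \<zero>\<^bsub>M\<^esub>\<rbrakk> \<Longrightarrow> m = \<zero>\<^bsub>M\<^esub>"
    and lift: "\<And>\<theta> \<zeta> l. \<lbrakk>\<theta> \<in> carrier (C i); \<zeta> \<in> carrier (C (Suc i)); cech_diff R fs M i \<theta> = x \<odot>\<^bsub>C (Suc i)\<^esub> \<zeta>\<rbrakk> \<Longrightarrow>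
      \<exists>\<alpha>\<in>cech_coboundaries R fs M i. \<exists>\<beta>\<in>carrier (C i). \<exists>\<zeta>'\<in>carrier (C (Suc i)).
        cech_diff R fs M i (\<theta> \<oplus>\<^bsub>C i\<^esub> \<alpha> \<oplus>\<^bsub>C i\<^esub> x \<odot>\<^bsub>C i\<^esub> \<beta>) = x [^] Suc l \<odot>\<^bsub>C (Suc i)\<^esub> \<zeta>'"
    and \<eta>: "\<eta> \<in> cech_cocycles R fs M (Suc i)" "x [^] (k::nat) \<odot>\<^bsub>C (Suc i)\<^esub> \<eta> \<in> cech_coboundaries R fs M (Suc i)"
  shows "\<exists>b\<in>cech_coboundaries R fs M (Suc i). \<exists>\<zeta>\<in>carrier (C (Suc i)). \<eta> = b \<oplus>\<^bsub>C (Suc i)\<^esub> x \<odot>\<^bsub>C (Suc i)\<^esub> \<zeta>"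
  using \<eta>
proof (induction k arbitrary: \<eta>)
  case 0
  interpret C': module R "C (Suc i)" by (rule C_module)
  have "\<eta> \<in> carrier (C (Suc i))" using 0 by (simp add: cech_cocycles_def)
  then have "\<eta> \<in> cech_coboundaries R fs M (Suc i)" "\<eta> = \<eta> \<oplus>\<^bsub>C (Suc i)\<^esub> x \<odot>\<^bsub>C (Suc i)\<^esub> \<zero>\<^bsub>C (Suc i)\<^esub>"
    using 0 x by simp_all
  then show ?case using C'.zero_closed by blast
next
  case (Suc k)
  interpret C: module R "C i" by (rule C_module)
  interpret C': module R "C (Suc i)" by (rule C_module)
  interpret C'': module R "C (Suc (Suc i))" by (rule C_module)
  interpret d: abelian_group_hom "C i" "C (Suc i)" "cech_diff R fs M i" by (rule diff_hom)
  interpret d': abelian_group_hom "C (Suc i)" "C (Suc (Suc i))" "cech_diff R fs M (Suc i)" by (rule diff_hom)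
  have \<eta>: "\<eta> \<in> carrier (C (Suc i))" and d\<eta>: "cech_diff R fs M (Suc i) \<eta> = \<zero>\<^bsub>C (Suc (Suc i))\<^esub>"
    using Suc.prems(1) by (auto simp: cech_cocycles_def)
  obtain \<theta> where \<theta>: "\<theta> \<in> carrier (C i)" "cech_diff R fs M i \<theta> = x [^] Suc k \<odot>\<^bsub>C (Suc i)\<^esub> \<eta>"
    using Suc.prems(2) by (auto simp: cech_coboundaries_def)
  have xr: "r \<otimes> x \<odot>\<^bsub>C (Suc i)\<^esub> c = x \<odot>\<^bsub>C (Suc i)\<^esub> (r \<odot>\<^bsub>C (Suc i)\<^esub> c)"
    if "r \<in> carrier R" "c \<in> carrier (C (Suc i))" for r c
    using x that by (simp add: R.m_comm[of r] C'.smult_assoc1)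
  \<comment> \<open>Divisibility by \<open>x^(k+2)\<close> is requested, one factor more than
    \<open>d \<theta>\<close> has. After \<open>x\<close> is cancelled, the right side still
    contains the \<open>x^(k+1)\<close> needed to be subtracted from \<open>x^k \<eta>\<close> as
    \<open>x^k (x \<zeta>)\<close>.\<close>
  obtain \<alpha> \<beta> \<zeta> where \<alpha>: "\<alpha> \<in> cech_coboundaries R fs M i" and \<beta>: "\<beta> \<in> carrier (C i)"
    and \<zeta>: "\<zeta> \<in> carrier (C (Suc i))"
    and eq: "cech_diff R fs M i (\<theta> \<oplus>\<^bsub>C i\<^esub> \<alpha> \<oplus>\<^bsub>C i\<^esub> x \<odot>\<^bsub>C i\<^esub> \<beta>) = x [^] Suc (Suc k) \<odot>\<^bsub>C (Suc i)\<^esub> \<zeta>"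
    using lift[of \<theta> "x [^] k \<odot>\<^bsub>C (Suc i)\<^esub> \<eta>" "Suc k"] \<theta> x \<eta> by (auto simp: xr)
  let ?d = "cech_diff R fs M i"
  have \<alpha>': "\<alpha> \<in> carrier (C i)" "?d \<alpha> = \<zero>\<^bsub>C (Suc i)\<^esub>"
    using \<alpha> coboundaries_cocycles by (auto simp: cech_cocycles_def)
  have "x \<odot>\<^bsub>C (Suc i)\<^esub> (x [^] k \<odot>\<^bsub>C (Suc i)\<^esub> \<eta> \<oplus>\<^bsub>C (Suc i)\<^esub> ?d \<beta>) =
      x [^] Suc k \<odot>\<^bsub>C (Suc i)\<^esub> \<eta> \<oplus>\<^bsub>C (Suc i)\<^esub> ?d (x \<odot>\<^bsub>C i\<^esub> \<beta>)"
    using x \<eta> \<beta> by (simp add: xr diff_smult C'.smult_r_distr)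
  also have "\<dots> = ?d (\<theta> \<oplus>\<^bsub>C i\<^esub> \<alpha> \<oplus>\<^bsub>C i\<^esub> x \<odot>\<^bsub>C i\<^esub> \<beta>)"
    using \<theta>(1) \<alpha>' x \<beta> \<eta> \<theta>(2) by simp
  also have "\<dots> = x \<odot>\<^bsub>C (Suc i)\<^esub> (x [^] Suc k \<odot>\<^bsub>C (Suc i)\<^esub> \<zeta>)"
    unfolding eq using x \<zeta> by (simp add: xr)
  finally have eq': "x \<odot>\<^bsub>C (Suc i)\<^esub> (x [^] k \<odot>\<^bsub>C (Suc i)\<^esub> \<eta> \<oplus>\<^bsub>C (Suc i)\<^esub> ?d \<beta>) =
      x \<odot>\<^bsub>C (Suc i)\<^esub> (x [^] Suc k \<odot>\<^bsub>C (Suc i)\<^esub> \<zeta>)" .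
  have *: "x [^] k \<odot>\<^bsub>C (Suc i)\<^esub> \<eta> \<oplus>\<^bsub>C (Suc i)\<^esub> ?d \<beta> = x [^] Suc k \<odot>\<^bsub>C (Suc i)\<^esub> \<zeta>"
    by (rule smult_left_cancel[OF x reg _ _ eq']) (use x \<eta> \<beta> \<zeta> in auto)
  let ?\<eta> = "\<eta> \<ominus>\<^bsub>C (Suc i)\<^esub> x \<odot>\<^bsub>C (Suc i)\<^esub> \<zeta>"
  \<comment> \<open>The induction hypothesis needs \<open>\<eta> - x \<zeta>\<close> to be a
    cocycle. Applying \<open>d\<close> to the equation \<open>*\<close> shows that
    \<open>x^(k+1)\<close> kills \<open>d \<zeta>\<close>, and powers of \<open>x\<close> are
    regular too.\<close>
  have d\<zeta>: "cech_diff R fs M (Suc i) \<zeta> = \<zero>\<^bsub>C (Suc (Suc i))\<^esub>"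
  proof -
    have "x [^] Suc k \<odot>\<^bsub>C (Suc (Suc i))\<^esub> cech_diff R fs M (Suc i) \<zeta> =
        cech_diff R fs M (Suc i) (x [^] k \<odot>\<^bsub>C (Suc i)\<^esub> \<eta> \<oplus>\<^bsub>C (Suc i)\<^esub> ?d \<beta>)"
      unfolding * using x \<zeta> by (simp add: diff_smult)
    also have "\<dots> = \<zero>\<^bsub>C (Suc (Suc i))\<^esub>"
      using x \<eta> d\<eta> \<beta> by (simp add: diff_smult diff_diff)
    finally have x\<zeta>: "x [^] Suc k \<odot>\<^bsub>C (Suc (Suc i))\<^esub> cech_diff R fs M (Suc i) \<zeta> = \<zero>\<^bsub>C (Suc (Suc i))\<^esub>" .
    have reg': "m = \<zero>\<^bsub>M\<^esub>" if "m \<in> carrier M" "x [^] n \<odot>\<^bsub>M\<^esub> m = \<zero>\<^bsub>M\<^esub>" for m and n :: nat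
      using that
    proof (induction n arbitrary: m)
      case (Suc n)
      then have "x [^] n \<odot>\<^bsub>M\<^esub> (x \<odot>\<^bsub>M\<^esub> m) = \<zero>\<^bsub>M\<^esub>"
        using x by (simp add: smult_assoc1)
      then have "x \<odot>\<^bsub>M\<^esub> m = \<zero>\<^bsub>M\<^esub>"
        by (rule Suc.IH[rotated]) (use x Suc.prems in simp)
      then show ?case
        by (rule reg[OF Suc.prems(1)])
    qed simp
    show ?thesis
      by (rule smult_cancel[OF _ reg'[where n = "Suc k"] _ x\<zeta>]) (use x \<zeta> in \<open>simp_all del: nat_pow_Suc\<close>)
  qed
  have "?\<eta> \<in> cech_cocycles R fs M (Suc i)"
    using \<eta> d\<eta> \<zeta> d\<zeta> x by (simp add: cech_cocycles_def a_minus_def diff_smult)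
  moreover have "x [^] k \<odot>\<^bsub>C (Suc i)\<^esub> ?\<eta> = ?d (\<ominus>\<^bsub>C i\<^esub> \<beta>)"
  proof -
    have "x [^] k \<odot>\<^bsub>C (Suc i)\<^esub> ?\<eta> = x [^] k \<odot>\<^bsub>C (Suc i)\<^esub> \<eta> \<ominus>\<^bsub>C (Suc i)\<^esub> x [^] Suc k \<odot>\<^bsub>C (Suc i)\<^esub> \<zeta>"
      using x \<eta> \<zeta> by (simp add: a_minus_def C'.smult_r_distr C'.smult_r_minus C'.smult_assoc1)
    also have "\<dots> = \<ominus>\<^bsub>C (Suc i)\<^esub> ?d \<beta>"
      unfolding *[symmetric] using x \<eta> \<beta>
      by (simp add: a_minus_def C'.minus_add C'.a_assoc[symmetric] C'.r_neg)
    finally show ?thesis using \<beta> by simp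
  qed
  then have "x [^] k \<odot>\<^bsub>C (Suc i)\<^esub> ?\<eta> \<in> cech_coboundaries R fs M (Suc i)"
    using \<beta> by (simp add: cech_coboundaries_def del: d.hom_a_inv)
  ultimately obtain b \<zeta>' where b: "b \<in> cech_coboundaries R fs M (Suc i)" "\<zeta>' \<in> carrier (C (Suc i))"
    "?\<eta> = b \<oplus>\<^bsub>C (Suc i)\<^esub> x \<odot>\<^bsub>C (Suc i)\<^esub> \<zeta>'"
    using Suc.IH by blast
  have bC: "b \<in> carrier (C (Suc i))"
    using b coboundaries_cocycles by (auto simp: cech_cocycles_def)
  have "\<eta> = ?\<eta> \<oplus>\<^bsub>C (Suc i)\<^esub> x \<odot>\<^bsub>C (Suc i)\<^esub> \<zeta>"
    using x \<eta> \<zeta> by (simp add: a_minus_def C'.a_assoc C'.l_neg)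
  also have "\<dots> = b \<oplus>\<^bsub>C (Suc i)\<^esub> x \<odot>\<^bsub>C (Suc i)\<^esub> (\<zeta>' \<oplus>\<^bsub>C (Suc i)\<^esub> \<zeta>)"
    unfolding b(3) using x \<zeta> b(2) bC by (simp add: C'.smult_r_distr C'.a_assoc)
  finally show ?case
    using b \<zeta> by blast
qed

end

section \<open>The hypotheses on \<open>R/x\<close> in terms of cochains\<close>

lemma frobenius_action_inj_iff:
  assumes A: "cring A" "prime p" "has_char A p" "set fs \<subseteq> carrier A"
  shows "inj_on (frobenius_action p A fs i) (carrier (local_cohomology A fs (self_module A) i)) \<longleftrightarrow>
    (\<forall>c\<in>cech_cocycles A fs (self_module A) i.
      cech_map A fs (self_module A) (\<lambda>(a, n). (a [^]\<^bsub>A\<^esub> p, p * n)) i c \<in> cech_coboundaries A fs (self_module A) i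
      \<longrightarrow> c \<in> cech_coboundaries A fs (self_module A) i)"
proof -
  interpret cech_semilinear A "self_module A" A "self_module A" "\<lambda>a. a" p "\<lambda>a. a [^]\<^bsub>A\<^esub> p"
    "\<lambda>(a, n). (a [^]\<^bsub>A\<^esub> p, p * n)" fs
    by (rule frobenius_semilinear[OF A])
  let ?F = "cech_map A fs (self_module A) (\<lambda>(a, n). (a [^]\<^bsub>A\<^esub> p, p * n)) i"
  interpret F: abelian_group_hom "C i" "C i" ?F
    using map_hom by simp
  interpret d: abelian_group_hom "C i" "C (Suc i)" "cech_diff A fs (self_module A) i"
    by (rule diff_hom)
  let ?B = "cech_coboundaries A fs (self_module A) i" and ?Z = "cech_cocycles A fs (self_module A) i"
  have Z: "c \<in> carrier (C i)" if "c \<in> ?Z" for c using that by (simp add: cech_cocycles_def)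
  have frob: "frobenius_action p A fs i (?B +>\<^bsub>C i\<^esub> c) = ?B +>\<^bsub>C i\<^esub> ?F c" if "c \<in> ?Z" for c
    using cohomology_map_coset[OF Z[OF that]] by (simp add: frobenius_action_def)
  \<comment> \<open>Frobenius is additive, so two classes with equal images differ by a class with
    zero image; injectivity becomes a condition on single cocycles.\<close>
  have inj: "frobenius_action p A fs i (?B +>\<^bsub>C i\<^esub> c) = frobenius_action p A fs i (?B +>\<^bsub>C i\<^esub> c') \<longleftrightarrow>
      ?F (c \<ominus>\<^bsub>C i\<^esub> c') \<in> ?B" if "c \<in> ?Z" "c' \<in> ?Z" for c c'
    using that Z frob coset_eq_iff[of "?F c" i "?F c'"] by (simp add: a_minus_def)
  have zero: "\<zero>\<^bsub>C i\<^esub> \<in> ?Z" by (simp add: cech_cocycles_def)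
  have diff: "c \<ominus>\<^bsub>C i\<^esub> c' \<in> ?Z" if "c \<in> ?Z" "c' \<in> ?Z" for c c'
    using that by (auto simp: cech_cocycles_def a_minus_def)
  have sub0: "c \<ominus>\<^bsub>C i\<^esub> \<zero>\<^bsub>C i\<^esub> = c" if "c \<in> carrier (C i)" for c
    using that by (simp add: a_minus_def)
  show ?thesis
    unfolding carrier_local_cohomology
  proof (intro iffI ballI impI)
    fix c assume inj_on: "inj_on (frobenius_action p A fs i) ((+>\<^bsub>C i\<^esub>) ?B ` ?Z)" and c: "c \<in> ?Z"
      and "?F c \<in> ?B"
    then have "frobenius_action p A fs i (?B +>\<^bsub>C i\<^esub> c) = frobenius_action p A fs i (?B +>\<^bsub>C i\<^esub> \<zero>\<^bsub>C i\<^esub>)"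
      using inj[OF c zero] sub0[OF Z[OF c]] by simp
    then have "?B +>\<^bsub>C i\<^esub> c = ?B +>\<^bsub>C i\<^esub> \<zero>\<^bsub>C i\<^esub>"
      by (rule inj_onD[OF inj_on]) (use c zero in blast)+
    then show "c \<in> ?B"
      using coset_eq_iff[OF Z[OF c] Z[OF zero]] sub0[OF Z[OF c]] by simp
  next
    assume "\<forall>c\<in>?Z. ?F c \<in> ?B \<longrightarrow> c \<in> ?B"
    then have "?B +>\<^bsub>C i\<^esub> c = ?B +>\<^bsub>C i\<^esub> c'"
      if "c \<in> ?Z" "c' \<in> ?Z"
        "frobenius_action p A fs i (?B +>\<^bsub>C i\<^esub> c) = frobenius_action p A fs i (?B +>\<^bsub>C i\<^esub> c')" for c c'
      using that(3) diff[OF that(1,2)] unfolding inj[OF that(1,2)] coset_eq_iff[OF that(1,2)[THEN Z]] by blast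
    then show "inj_on (frobenius_action p A fs i) ((+>\<^bsub>C i\<^esub>) ?B ` ?Z)"
      by (auto intro!: inj_onI simp del: F.hom_add)
  qed
qed

text \<open>F-injectivity of \<open>R/I\<close> is stated for every generating family; this allows
  it to be used for the images of a family in \<open>R\<close>, whose complex is the one that
  reduction reaches.\<close>

lemma (in ideal) generates_quotient:
  assumes R: "cring R" and fs: "generates R fs J" and J: "ideal ((+>) I ` J) (R Quot I)"
  shows "generates (R Quot I) (map ((+>) I) fs) ((+>) I ` J)"
proof -
  interpret Q: ring_hom_cring R "R Quot I" "(+>) I" by (rule rcos_ring_hom_cring[OF R])
  have fsR: "set fs \<subseteq> carrier R" and JI: "J = Idl (set fs)"
    using fs by (auto simp: generates_def)
  let ?K = "Idl\<^bsub>R Quot I\<^esub> (set (map ((+>) I) fs))"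
  have fsQ: "set (map ((+>) I) fs) \<subseteq> carrier (R Quot I)"
    using fsR by auto
  have K: "ideal ?K (R Quot I)"
    by (rule Q.S.genideal_ideal[OF fsQ])
  have "set (map ((+>) I) fs) \<subseteq> (+>) I ` J"
    unfolding JI using genideal_self[OF fsR] by auto
  then have "?K \<subseteq> (+>) I ` J"
    by (rule Q.S.genideal_minimal[OF J])
  moreover have "J \<subseteq> {r \<in> carrier R. I +> r \<in> ?K}"
    unfolding JI
  proof (rule genideal_minimal)
    show "ideal {r \<in> carrier R. I +> r \<in> ?K} R"
      by (rule Q.ring.ideal_vimage[OF K])
    show "set fs \<subseteq> {r \<in> carrier R. I +> r \<in> ?K}"
      using fsR Q.S.genideal_self[OF fsQ] by auto
  qed
  ultimately show ?thesis
    using fsQ by (auto simp: generates_def)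
qed

lemma (in ideal) rcos_eq_zero_iff:
  assumes "a \<in> carrier R"
  shows "I +> a = \<zero>\<^bsub>R Quot I\<^esub> \<longleftrightarrow> a \<in> I"
  using assms a_rcos_self[OF assms] a_rcos_const[of a] by (auto simp: FactRing_def)

lemma (in cring) rcos_principal_kernel:
  assumes x: "x \<in> carrier R"
  shows "m \<in> carrier R \<Longrightarrow> PIdl x +> m = \<zero>\<^bsub>R Quot (PIdl x)\<^esub> \<Longrightarrow> \<exists>n\<in>carrier R. m = x \<otimes> n"
    and "m \<in> carrier R \<Longrightarrow> PIdl x +> (x \<otimes> m) = \<zero>\<^bsub>R Quot (PIdl x)\<^esub>"
  using x ideal.rcos_eq_zero_iff[OF cgenideal_ideal[OF x]] by (auto simp: cgenideal_def m_comm)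

lemma quotient_ring_module_simps:
  "carrier (quotient_ring_module R I) = carrier (R Quot I)"
  "\<zero>\<^bsub>quotient_ring_module R I\<^esub> = \<zero>\<^bsub>R Quot I\<^esub>"
  by (simp_all add: quotient_ring_module_def)

text \<open>The cochain \<open>\<theta>\<close> is a cocycle modulo \<open>x\<close>. By
  surjectivity its class comes from a cocycle modulo \<open>y\<close>, that is, from a cochain
  \<open>\<theta>'\<close> of \<open>R\<close> with \<open>d \<theta>'\<close> divisible by
  \<open>y\<close>. Modulo \<open>x\<close>, the two differ by a coboundary, which lifts to
  \<open>\<alpha>\<close>; what remains lies in the kernel of reduction and is
  \<open>x \<beta>\<close>.\<close>

lemma cocycle_lift:
  assumes R: "cring R" and fs: "set fs \<subseteq> carrier R" and x: "x \<in> carrier R" and y: "y \<in> carrier R"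
    and yx: "PIdl\<^bsub>R\<^esub> y \<subseteq> PIdl\<^bsub>R\<^esub> x"
    and surj: "local_cohomology_hom R fs (quotient_ring_module R (PIdl\<^bsub>R\<^esub> x)) (quotient_proj R (PIdl\<^bsub>R\<^esub> x)) i
         ` carrier (local_cohomology R fs (quotient_ring_module R (PIdl\<^bsub>R\<^esub> y)) i)
       = carrier (local_cohomology R fs (quotient_ring_module R (PIdl\<^bsub>R\<^esub> x)) i)"
    and \<theta>: "\<theta> \<in> carrier (cech_module R fs (self_module R) i)"
    and \<zeta>: "\<zeta> \<in> carrier (cech_module R fs (self_module R) (Suc i))"
    and d\<theta>: "cech_diff R fs (self_module R) i \<theta> = x \<odot>\<^bsub>cech_module R fs (self_module R) (Suc i)\<^esub> \<zeta>"
  shows "\<exists>\<alpha>\<in>cech_coboundaries R fs (self_module R) i. \<exists>\<beta>\<in>carrier (cech_module R fs (self_module R) i).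
    \<exists>\<zeta>'\<in>carrier (cech_module R fs (self_module R) (Suc i)).
      cech_diff R fs (self_module R) i (\<theta> \<oplus>\<^bsub>cech_module R fs (self_module R) i\<^esub> \<alpha>
        \<oplus>\<^bsub>cech_module R fs (self_module R) i\<^esub> x \<odot>\<^bsub>cech_module R fs (self_module R) i\<^esub> \<beta>)
      = y \<odot>\<^bsub>cech_module R fs (self_module R) (Suc i)\<^esub> \<zeta>'"
proof -
  interpret R: cring R by (rule R)
  define I where "I = PIdl\<^bsub>R\<^esub> x"
  define K where "K = PIdl\<^bsub>R\<^esub> y"
  interpret I: ideal I R unfolding I_def by (rule R.cgenideal_ideal[OF x])
  interpret K: ideal K R unfolding K_def by (rule R.cgenideal_ideal[OF y])
  let ?QI = "quotient_ring_module R I" and ?QK = "quotient_ring_module R K"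
  have KI: "K \<subseteq> I" using yx by (simp add: I_def K_def)
  interpret S: cech R "self_module R" fs by (rule self_module_cech[OF R fs])
  interpret PI: cech_semilinear R "self_module R" R ?QI "\<lambda>a. a" 1 "(+>\<^bsub>R\<^esub>) I"
    "\<lambda>(m, a). (I +>\<^bsub>R\<^esub> m, a)" fs by (rule I.rcos_smult_semilinear[OF R fs])
  interpret PK: cech_semilinear R "self_module R" R ?QK "\<lambda>a. a" 1 "(+>\<^bsub>R\<^esub>) K"
    "\<lambda>(m, a). (K +>\<^bsub>R\<^esub> m, a)" fs by (rule K.rcos_smult_semilinear[OF R fs])
  interpret Q: cech_semilinear R ?QK R ?QI "\<lambda>a. a" 1 "quotient_proj R I"
    "\<lambda>(m, a). (quotient_proj R I m, a)" fs
    by (rule K.quotient_proj_semilinear[OF R fs I.is_ideal KI])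
  interpret C: module R "S.C i" by (rule S.C_module)
  interpret CI: abelian_group "cech_module R fs ?QI i" using PI.N.C_abelian_group by simp
  interpret \<pi>I: abelian_group_hom "S.C i" "cech_module R fs ?QI i" "cech_map R fs ?QI (\<lambda>(m, a). (I +>\<^bsub>R\<^esub> m, a)) i"
    using PI.map_hom by simp
  let ?\<pi>I = "cech_map R fs ?QI (\<lambda>(m, a). (I +>\<^bsub>R\<^esub> m, a))"
  let ?\<pi>K = "cech_map R fs ?QK (\<lambda>(m, a). (K +>\<^bsub>R\<^esub> m, a))"
  let ?pr = "cech_map R fs ?QI (\<lambda>(m, a). (quotient_proj R I m, a)) i"
  note ker = R.rcos_principal_kernel
  have surjI: "(+>\<^bsub>R\<^esub>) I ` carrier (self_module R) = carrier ?QI"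
    and surjK: "(+>\<^bsub>R\<^esub>) K ` carrier (self_module R) = carrier ?QK"
    using I.rcos_surj K.rcos_surj by (simp_all add: quotient_ring_module_simps)
  have "cech_diff R fs ?QI i (?\<pi>I i \<theta>) = ?\<pi>I (Suc i) (x \<odot>\<^bsub>S.C (Suc i)\<^esub> \<zeta>)"
    using PI.map_diff[OF \<theta>] d\<theta> by simp
  also have "\<dots> = \<zero>\<^bsub>cech_module R fs ?QI (Suc i)\<^esub>"
    using PI.map_smult_zero[OF x _ \<zeta>] ker(2)[OF x] by (simp add: quotient_ring_module_simps I_def)
  finally have "?\<pi>I i \<theta> \<in> cech_cocycles R fs ?QI i"
    using \<theta> by (simp add: cech_cocycles_def)
  then have "cech_coboundaries R fs ?QI i +>\<^bsub>cech_module R fs ?QI i\<^esub> ?\<pi>I i \<theta>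
      \<in> local_cohomology_hom R fs ?QI (quotient_proj R I) i ` carrier (local_cohomology R fs ?QK i)"
    unfolding surj[folded I_def K_def] using PI.N.carrier_local_cohomology[of i] by simp
  then obtain c where c: "c \<in> cech_cocycles R fs ?QK i"
    and cos: "cech_coboundaries R fs ?QI i +>\<^bsub>cech_module R fs ?QI i\<^esub> ?\<pi>I i \<theta> =
      local_cohomology_hom R fs ?QI (quotient_proj R I) i
        (cech_coboundaries R fs ?QK i +>\<^bsub>cech_module R fs ?QK i\<^esub> c)"
    using PK.N.carrier_local_cohomology[of i] by auto
  have cC: "c \<in> carrier (cech_module R fs ?QK i)"
    and dc: "cech_diff R fs ?QK i c = \<zero>\<^bsub>cech_module R fs ?QK (Suc i)\<^esub>"
    using c by (auto simp: cech_cocycles_def)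
  obtain \<theta>' where \<theta>': "\<theta>' \<in> carrier (S.C i)" "?\<pi>K i \<theta>' = c"
    using PK.map_surj[OF surjK refl, of c i] cC by auto
  have "?\<pi>K (Suc i) (cech_diff R fs (self_module R) i \<theta>') = \<zero>\<^bsub>cech_module R fs ?QK (Suc i)\<^esub>"
    using PK.map_diff[OF \<theta>'(1)] \<theta>'(2) dc by simp
  then obtain \<zeta>' where \<zeta>': "\<zeta>' \<in> carrier (S.C (Suc i))"
    "cech_diff R fs (self_module R) i \<theta>' = y \<odot>\<^bsub>S.C (Suc i)\<^esub> \<zeta>'"
    using PK.map_kernel[OF refl y, of "cech_diff R fs (self_module R) i \<theta>'" "Suc i"] ker(1)[OF y]
      abelian_group_hom.hom_closed[OF S.diff_hom \<theta>'(1)]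
    by (auto simp: quotient_ring_module_simps K_def)
  \<comment> \<open>Composition expects the second map on the image family; the first map leaves the
    base ring fixed, so its family is mapped along the identity.\<close>
  have Q': "cech_semilinear R ?QK R ?QI (\<lambda>a. a) 1 (quotient_proj R I)
      (\<lambda>(m, a). (quotient_proj R I m, a)) (map (\<lambda>a. a) fs)"
    using Q.cech_semilinear_axioms by simp
  have pr: "?pr c = ?\<pi>I i \<theta>'"
  \<comment> \<open>Reducing modulo \<open>y\<close> and then projecting is reduction modulo
    \<open>x\<close>, compared on one fraction in each component.\<close>
  proof (rule cech_module_eqI)
    show "?pr c \<in> carrier (cech_module R fs ?QI i)"
      using abelian_group_hom.hom_closed[OF Q.map_hom[of i]] cC by simp
    show "?\<pi>I i \<theta>' \<in> carrier (cech_module R fs ?QI i)" using \<theta>' by simp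
    fix T assume T: "T \<in> cech_index fs i"
    have "\<theta>' T \<in> carrier (S.L T)" using \<theta>'(1) T by (simp add: cech_module_carrier_iff)
    then obtain m a where m: "m \<in> carrier (self_module R)" "\<theta>' T = frac R (self_module R) (S.E T) (m, a)"
      by (rule S.localization_cases)
    have "?pr c T = frac R ?QI (S.E T) (quotient_proj R I (K +>\<^bsub>R\<^esub> m), a)"
      using cech_map_comp[where c = \<theta>', OF PK.cech_semilinear_axioms Q' T m] \<theta>'(2) by simp
    also have "\<dots> = frac R ?QI (S.E T) (I +>\<^bsub>R\<^esub> m, a)"
      using K.quotient_proj_coset[OF I.is_ideal KI] m by simp
    also have "\<dots> = ?\<pi>I i \<theta>' T"
      using PI.map_apply[OF T] PI.frac_map_frac[OF S.elem_closed[OF cech_index_subset[OF T]] m(1)] m(2) by simp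
    finally show "?pr c T = ?\<pi>I i \<theta>' T" .
  qed
  have "cech_coboundaries R fs ?QI i +>\<^bsub>cech_module R fs ?QI i\<^esub> ?\<pi>I i \<theta>' =
      cech_coboundaries R fs ?QI i +>\<^bsub>cech_module R fs ?QI i\<^esub> ?\<pi>I i \<theta>"
    using cos Q.cohomology_map_coset[of c i] cC by (simp add: pr local_cohomology_hom_def)
  then have "?\<pi>I i \<theta>' \<ominus>\<^bsub>cech_module R fs ?QI i\<^esub> ?\<pi>I i \<theta> \<in> cech_coboundaries R fs ?QI i"
    using PI.N.coset_eq_iff[of "?\<pi>I i \<theta>'" i "?\<pi>I i \<theta>"] \<theta> \<theta>'(1) by simp
  then obtain \<alpha> where \<alpha>: "\<alpha> \<in> cech_coboundaries R fs (self_module R) i"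
    "?\<pi>I i \<alpha> = ?\<pi>I i \<theta>' \<ominus>\<^bsub>cech_module R fs ?QI i\<^esub> ?\<pi>I i \<theta>"
    using PI.map_coboundaries_surj[OF surjI refl, of "?\<pi>I i \<theta>' \<ominus>\<^bsub>cech_module R fs ?QI i\<^esub> ?\<pi>I i \<theta>" i] by auto
  have \<alpha>C: "\<alpha> \<in> carrier (S.C i)"
    using \<alpha> S.coboundaries_cocycles by (auto simp: cech_cocycles_def)
  let ?e = "\<theta>' \<ominus>\<^bsub>S.C i\<^esub> (\<theta> \<oplus>\<^bsub>S.C i\<^esub> \<alpha>)"
  have "?\<pi>I i ?e = \<zero>\<^bsub>cech_module R fs ?QI i\<^esub>"
    using \<theta> \<theta>'(1) \<alpha>C \<alpha>(2)
    by (simp add: a_minus_def CI.minus_add CI.a_ac CI.r_neg CI.l_neg CI.r_neg1 CI.r_neg2)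
  then obtain \<beta> where \<beta>: "\<beta> \<in> carrier (S.C i)" "?e = x \<odot>\<^bsub>S.C i\<^esub> \<beta>"
    using PI.map_kernel[OF refl x, of ?e i] ker(1)[OF x] \<theta> \<theta>'(1) \<alpha>C
    by (auto simp: quotient_ring_module_simps I_def)
  have "\<theta> \<oplus>\<^bsub>S.C i\<^esub> \<alpha> \<oplus>\<^bsub>S.C i\<^esub> x \<odot>\<^bsub>S.C i\<^esub> \<beta> = \<theta>'"
    unfolding \<beta>(2)[symmetric] using \<theta> \<theta>'(1) \<alpha>C
    by (simp add: a_minus_def C.minus_add C.a_ac C.r_neg C.l_neg C.r_neg1 C.r_neg2)
  then show ?thesis
    using \<alpha>(1) \<beta>(1) \<zeta>' by (intro bexI[of _ \<alpha>] bexI[of _ \<beta>] bexI[of _ \<zeta>']) auto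
qed

text \<open>The descent removes one factor of \<open>x\<close>. Both F-injectivity of
  \<open>R/x\<close> and divisibility are used in degree \<open>i\<close>, one below the class
  \<open>\<xi>\<close>: the cochain \<open>\<theta>\<close> with \<open>d \<theta> = x \<xi>\<close>
  plays the part of a preimage of \<open>\<xi>\<close> under the connecting map.\<close>

lemma frobenius_regular_descent:
  fixes R :: "('a, 'b) ring_scheme" (structure) and fs :: "'a list" and p i :: nat and x :: 'a
  defines "C \<equiv> cech_module R fs (self_module R)"
    and "B \<equiv> cech_coboundaries R fs (self_module R)"
    and "F \<equiv> cech_map R fs (self_module R) (\<lambda>(a, n). (a [^] p, p * n))"
    and "Q \<equiv> R Quot PIdl x"
    and "gs \<equiv> map ((+>) (PIdl x)) fs"
  assumes R: "cring R" and p: "prime p" "has_char R p" "has_char Q p" and fs: "set fs \<subseteq> carrier R"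
    and x: "regular_elem R x"
    and F_inj: "\<And>c. \<lbrakk>c \<in> cech_cocycles Q gs (self_module Q) i;
        cech_map Q gs (self_module Q) (\<lambda>(a, n). (a [^]\<^bsub>Q\<^esub> p, p * n)) i c
          \<in> cech_coboundaries Q gs (self_module Q) i\<rbrakk>
      \<Longrightarrow> c \<in> cech_coboundaries Q gs (self_module Q) i"
    and divisible: "\<And>\<eta>. \<eta> \<in> cech_cocycles R fs (self_module R) i \<Longrightarrow>
      \<exists>b\<in>B i. \<exists>\<zeta>\<in>carrier (C i). \<eta> = b \<oplus>\<^bsub>C i\<^esub> x \<odot>\<^bsub>C i\<^esub> \<zeta>"
    and \<xi>: "\<xi> \<in> cech_cocycles R fs (self_module R) (Suc i)" "F (Suc i) \<xi> \<in> B (Suc i)"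
      "x \<odot>\<^bsub>C (Suc i)\<^esub> \<xi> \<in> B (Suc i)"
  shows "\<xi> \<in> B (Suc i)"
proof -
  interpret R: cring R by (rule R)
  have xR: "x \<in> carrier R" and reg: "\<And>a. \<lbrakk>a \<in> carrier R; x \<otimes> a = \<zero>\<rbrakk> \<Longrightarrow> a = \<zero>"
    using x by (auto simp: regular_elem_def)
  interpret I: ideal "PIdl x" R by (rule R.cgenideal_ideal[OF xR])
  have Q: "cring Q" unfolding Q_def by (rule I.quotient_is_cring[OF R])
  interpret S: cech R "self_module R" fs by (rule self_module_cech[OF R fs])
  interpret P: cech_semilinear R "self_module R" Q "self_module Q" "(+>) (PIdl x)" 1 "(+>) (PIdl x)"
      "\<lambda>(m, a). (PIdl x +> m, a)" fs
    unfolding Q_def by (rule I.rcos_ring_semilinear[OF R fs])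
  have FR: "cech_semilinear R (self_module R) R (self_module R) (\<lambda>a. a) p (\<lambda>a. a [^] p)
      (\<lambda>(a, n). (a [^] p, p * n)) fs"
    by (rule frobenius_semilinear[OF R p(1,2) fs])
  have gs: "set gs \<subseteq> carrier Q" using P.N.fs_closed by (simp add: gs_def)
  have FQ: "cech_semilinear Q (self_module Q) Q (self_module Q) (\<lambda>a. a) p (\<lambda>a. a [^]\<^bsub>Q\<^esub> p)
      (\<lambda>(a, n). (a [^]\<^bsub>Q\<^esub> p, p * n)) gs"
    by (rule frobenius_semilinear[OF Q p(1,3) gs])
  have C: "module R (C k)" for k unfolding C_def by (rule S.C_module)
  interpret C: module R "C i" by (rule C)
  interpret C': module R "C (Suc i)" by (rule C)
  let ?d = "cech_diff R fs (self_module R) i"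
  let ?\<pi> = "cech_map Q gs (self_module Q) (\<lambda>(m, a). (PIdl x +> m, a))"
  let ?FQ = "cech_map Q gs (self_module Q) (\<lambda>(a, n). (a [^]\<^bsub>Q\<^esub> p, p * n)) i"
  interpret d: abelian_group_hom "C i" "C (Suc i)" ?d unfolding C_def by (rule S.diff_hom)
  have F: "abelian_group_hom (C k) (C k) (F k)" for k
    using cech_semilinear.map_hom[OF FR] unfolding C_def F_def by simp
  interpret F: abelian_group_hom "C i" "C i" "F i" by (rule F)
  interpret \<pi>: abelian_group_hom "C i" "cech_module Q gs (self_module Q) i" "?\<pi> i"
    using P.map_hom unfolding C_def gs_def by simp
  have B_iff: "b \<in> B (Suc i) \<longleftrightarrow> (\<exists>a\<in>carrier (C i). b = ?d a)" for b
    by (auto simp: B_def C_def cech_coboundaries_def)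
  have \<xi>C: "\<xi> \<in> carrier (C (Suc i))"
    using \<xi>(1) by (simp add: cech_cocycles_def C_def)
  obtain \<omega> where \<omega>: "\<omega> \<in> carrier (C i)" "F (Suc i) \<xi> = ?d \<omega>" using \<xi>(2) B_iff by blast
  obtain \<theta> where \<theta>: "\<theta> \<in> carrier (C i)" "x \<odot>\<^bsub>C (Suc i)\<^esub> \<xi> = ?d \<theta>" using \<xi>(3) B_iff by blast
  \<comment> \<open>Frobenius turns \<open>d \<theta> = x \<xi>\<close> into
    \<open>d (F \<theta>) = x^p F \<xi> = x^p d \<omega>\<close>, so the correction term makes the
    difference closed over \<open>R\<close>, not only modulo \<open>x\<close>.\<close>
  define \<eta> where "\<eta> = F i \<theta> \<ominus>\<^bsub>C i\<^esub> x [^] p \<odot>\<^bsub>C i\<^esub> \<omega>"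
  have "?d (F i \<theta>) = F (Suc i) (x \<odot>\<^bsub>C (Suc i)\<^esub> \<xi>)"
    using cech_semilinear.map_diff[OF FR, of \<theta> i] \<theta> by (simp add: C_def F_def)
  also have "\<dots> = x [^] p \<odot>\<^bsub>C (Suc i)\<^esub> F (Suc i) \<xi>"
    using cech_semilinear.map_smult[OF FR xR \<xi>C[unfolded C_def]] by (simp add: C_def F_def)
  also have "\<dots> = ?d (x [^] p \<odot>\<^bsub>C i\<^esub> \<omega>)"
    unfolding \<omega>(2) C_def by (rule S.diff_smult[symmetric]) (use xR \<omega>(1) in \<open>simp_all add: C_def\<close>)
  finally have "\<eta> \<in> cech_cocycles R fs (self_module R) i"
    using \<theta>(1) \<omega>(1) xR C'.r_neg unfolding \<eta>_def cech_cocycles_def C_def[symmetric]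
    by (simp add: a_minus_def)
  then obtain b \<zeta> where b: "b \<in> B i" and \<zeta>: "\<zeta> \<in> carrier (C i)" and \<eta>: "\<eta> = b \<oplus>\<^bsub>C i\<^esub> x \<odot>\<^bsub>C i\<^esub> \<zeta>"
    using divisible by blast
  have bC: "b \<in> carrier (C i)"
    using b S.coboundaries_cocycles by (auto simp: B_def C_def cech_cocycles_def)
  \<comment> \<open>A prime is positive, so a factor \<open>x\<close> can be split off from
    \<open>x^p\<close>; this puts the correction term into the multiples of
    \<open>x\<close>.\<close>
  obtain n where n: "p = Suc n" using prime_gt_0_nat[OF p(1)] by (cases p) auto
  have "F i \<theta> = \<eta> \<oplus>\<^bsub>C i\<^esub> x [^] p \<odot>\<^bsub>C i\<^esub> \<omega>"
    using \<theta>(1) \<omega>(1) xR by (simp add: \<eta>_def a_minus_def C.a_assoc C.l_neg)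
  also have "x [^] p \<odot>\<^bsub>C i\<^esub> \<omega> = x \<odot>\<^bsub>C i\<^esub> (x [^] n \<odot>\<^bsub>C i\<^esub> \<omega>)"
    using xR \<omega>(1) by (simp add: n R.m_comm[of _ x] C.smult_assoc1)
  also have "\<eta> \<oplus>\<^bsub>C i\<^esub> \<dots> = b \<oplus>\<^bsub>C i\<^esub> x \<odot>\<^bsub>C i\<^esub> (\<zeta> \<oplus>\<^bsub>C i\<^esub> x [^] n \<odot>\<^bsub>C i\<^esub> \<omega>)"
    using xR \<omega>(1) \<zeta> bC by (simp add: \<eta> C.smult_r_distr C.a_assoc)
  finally have F\<theta>: "F i \<theta> = b \<oplus>\<^bsub>C i\<^esub> x \<odot>\<^bsub>C i\<^esub> (\<zeta> \<oplus>\<^bsub>C i\<^esub> x [^] n \<odot>\<^bsub>C i\<^esub> \<omega>)" .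
  have \<pi>x: "?\<pi> k (x \<odot>\<^bsub>C k\<^esub> c) = \<zero>\<^bsub>cech_module Q gs (self_module Q) k\<^esub>" if "c \<in> carrier (C k)" for k c
    using P.map_smult_zero[OF xR, of c k] that R.rcos_principal_kernel(2)[OF xR] by (simp add: C_def Q_def gs_def)
  have "?\<pi> i (F i \<theta>) = ?\<pi> i b"
    unfolding F\<theta> using bC xR \<zeta> \<omega>(1) by (simp add: \<pi>x)
  moreover have "?\<pi> i b \<in> cech_coboundaries Q gs (self_module Q) i"
    using P.map_coboundaries b by (simp add: B_def gs_def)
  moreover have "?\<pi> i (F i \<theta>) = ?FQ (?\<pi> i \<theta>)"
  \<comment> \<open>Reduction is a ring homomorphism and commutes with \<open>p\<close>-th powers:
    both composites send \<open>m / e^a\<close> to the class of \<open>m^p\<close> over the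
    \<open>p a\<close>-th power of the class of \<open>e\<close>.\<close>
  proof (rule cech_module_eqI)
    show "?\<pi> i (F i \<theta>) \<in> carrier (cech_module Q gs (self_module Q) i)" using \<theta>(1) by simp
    show "?FQ (?\<pi> i \<theta>) \<in> carrier (cech_module Q gs (self_module Q) i)"
      using abelian_group_hom.hom_closed[OF cech_semilinear.map_hom[OF FQ, of i]] \<theta>(1) by simp
    fix T assume "T \<in> cech_index gs i"
    then have T: "T \<in> cech_index fs i" by (simp add: gs_def)
    have "\<theta> T \<in> carrier (S.L T)" using \<theta>(1) T by (simp add: cech_module_carrier_iff C_def)
    then obtain m a where m: "m \<in> carrier (self_module R)" "\<theta> T = frac R (self_module R) (S.E T) (m, a)"
      by (rule S.localization_cases)
    have P': "cech_semilinear R (self_module R) Q (self_module Q) ((+>) (PIdl x)) 1 ((+>) (PIdl x))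
        (\<lambda>(m, a). (PIdl x +> m, a)) (map (\<lambda>a. a) fs)"
      using P.cech_semilinear_axioms by simp
    have "?\<pi> i (F i \<theta>) T = frac Q (self_module Q) (PIdl x +> S.E T) (PIdl x +> m [^] p, p * a)"
      using cech_map_comp[where c = \<theta>, OF FR P' T m] by (simp add: F_def gs_def)
    also have "PIdl x +> m [^] p = (PIdl x +> m) [^]\<^bsub>Q\<^esub> p"
      using P.\<phi>.ring.hom_nat_pow m by simp
    also have "frac Q (self_module Q) (PIdl x +> S.E T) ((PIdl x +> m) [^]\<^bsub>Q\<^esub> p, p * a) = ?FQ (?\<pi> i \<theta>) T"
      using cech_map_comp[where c = \<theta>, OF P.cech_semilinear_axioms FQ[unfolded gs_def] T m]
      by (simp add: gs_def o_def)
    finally show "?\<pi> i (F i \<theta>) T = ?FQ (?\<pi> i \<theta>) T" .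
  qed
  moreover have "?\<pi> i \<theta> \<in> cech_cocycles Q gs (self_module Q) i"
  proof -
    have "cech_diff Q gs (self_module Q) i (?\<pi> i \<theta>) = ?\<pi> (Suc i) (x \<odot>\<^bsub>C (Suc i)\<^esub> \<xi>)"
      using P.map_diff[of \<theta> i] \<theta> by (simp add: C_def gs_def)
    then show ?thesis
      using \<theta>(1) \<xi>C by (simp add: \<pi>x cech_cocycles_def)
  qed
  ultimately have "?\<pi> i \<theta> \<in> cech_coboundaries Q gs (self_module Q) i"
    using F_inj by simp
  moreover have surj: "(+>) (PIdl x) ` carrier (self_module R) = carrier (self_module Q)"
    using I.rcos_surj by (simp add: Q_def)
  ultimately obtain \<alpha> where \<alpha>: "\<alpha> \<in> B i" "?\<pi> i \<alpha> = ?\<pi> i \<theta>"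
    using P.map_coboundaries_surj[OF surj refl, of "?\<pi> i \<theta>" i] unfolding gs_def B_def by auto
  have \<alpha>C: "\<alpha> \<in> carrier (C i)" and d\<alpha>: "?d \<alpha> = \<zero>\<^bsub>C (Suc i)\<^esub>"
    using \<alpha>(1) S.coboundaries_cocycles by (auto simp: B_def C_def cech_cocycles_def)
  have e: "\<theta> \<ominus>\<^bsub>C i\<^esub> \<alpha> \<in> carrier (C i)"
    using \<theta>(1) \<alpha>C by simp
  have "?\<pi> i (\<theta> \<ominus>\<^bsub>C i\<^esub> \<alpha>) = \<zero>\<^bsub>cech_module Q gs (self_module Q) i\<^esub>"
    using \<theta>(1) \<alpha>C \<alpha>(2) by (simp add: a_minus_def \<pi>.H.r_neg)
  then obtain \<beta> where \<beta>: "\<beta> \<in> carrier (C i)" "\<theta> \<ominus>\<^bsub>C i\<^esub> \<alpha> = x \<odot>\<^bsub>C i\<^esub> \<beta>"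
    using P.map_kernel[OF refl xR, of "\<theta> \<ominus>\<^bsub>C i\<^esub> \<alpha>" i] R.rcos_principal_kernel(1)[OF xR] e
    unfolding C_def Q_def gs_def by auto
  have "x \<odot>\<^bsub>C (Suc i)\<^esub> \<xi> = ?d (\<theta> \<ominus>\<^bsub>C i\<^esub> \<alpha>)"
    using \<theta> \<alpha>C d\<alpha> by (simp add: a_minus_def)
  also have "\<dots> = x \<odot>\<^bsub>C (Suc i)\<^esub> ?d \<beta>"
    unfolding \<beta>(2) using S.diff_smult[OF xR, of \<beta> i] \<beta>(1) by (simp add: C_def)
  finally have "\<xi> = ?d \<beta>"
    unfolding C_def
    by (rule S.smult_left_cancel[OF xR, rotated 3])
      (use reg \<xi>C d.hom_closed[OF \<beta>(1)] in \<open>simp_all add: C_def\<close>)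
  then show ?thesis using \<beta>(1) B_iff by blast
qed

theorem mainTheorem1:
  fixes R :: "('a, 'b) ring_scheme" and \<mm> :: "'a set" and p :: nat and x :: 'a
  assumes "local_ring R \<mm>"
    and "prime p" and "has_char R p"
    and "x \<in> \<mm>" and "regular_elem R x"
    and "F_injective p (R Quot (PIdl\<^bsub>R\<^esub> x)) ((\<lambda>a. PIdl\<^bsub>R\<^esub> x +>\<^bsub>R\<^esub> a) ` \<mm>)"
    and "\<And>fs (l::nat) (i::nat). \<lbrakk>generates R fs \<mm>; l > 0\<rbrakk> \<Longrightarrow>
       local_cohomology_hom R fs (quotient_ring_module R (PIdl\<^bsub>R\<^esub> x))
           (quotient_proj R (PIdl\<^bsub>R\<^esub> x)) i
         ` carrier (local_cohomology R fs (quotient_ring_module R (PIdl\<^bsub>R\<^esub> (x [^]\<^bsub>R\<^esub> l))) i)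
       = carrier (local_cohomology R fs (quotient_ring_module R (PIdl\<^bsub>R\<^esub> x)) i)"
  shows "F_injective p R \<mm>"
proof -
  interpret local_ring R \<mm> by (rule assms(1))
  have R: "cring R" by (rule is_cring)
  note p = assms(2,3)
  have x: "x \<in> carrier R" and reg: "\<And>a. \<lbrakk>a \<in> carrier R; x \<otimes>\<^bsub>R\<^esub> a = \<zero>\<^bsub>R\<^esub>\<rbrakk> \<Longrightarrow> a = \<zero>\<^bsub>R\<^esub>"
    using assms(5) by (auto simp: regular_elem_def)
  let ?Q = "R Quot (PIdl\<^bsub>R\<^esub> x)"
  interpret I: ideal "PIdl\<^bsub>R\<^esub> x" R by (rule cgenideal_ideal[OF x])
  have Q: "cring ?Q" by (rule I.quotient_is_cring[OF R])
  have pQ: "has_char ?Q p" and local_Q: "local_ring ?Q ((\<lambda>a. PIdl\<^bsub>R\<^esub> x +>\<^bsub>R\<^esub> a) ` \<mm>)"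
    using assms(6) by (auto simp: F_injective_def)
  \<comment> \<open>The F-injectivity assumption includes that \<open>R/x\<close> is local with the
    image of \<open>\<mm>\<close> as its maximal ideal; this supplies the ideal property required of
    the image.\<close>
  have idealQ: "ideal ((+>\<^bsub>R\<^esub>) (PIdl\<^bsub>R\<^esub> x) ` \<mm>) ?Q"
    using local_Q by (auto simp: local_ring_def maximalideal_def)
  have "inj_on (frobenius_action p R fs i) (carrier (local_cohomology R fs (self_module R) i))"
    if gen: "generates R fs \<mm>" for fs i
  proof -
    have fs: "set fs \<subseteq> carrier R" and xfs: "x \<in> Idl\<^bsub>R\<^esub> (set fs)"
      using gen assms(4) by (auto simp: generates_def)
    interpret S: cech R "self_module R" fs by (rule self_module_cech[OF R fs])
    let ?B = "cech_coboundaries R fs (self_module R)" and ?Z = "cech_cocycles R fs (self_module R)"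
    let ?F = "cech_map R fs (self_module R) (\<lambda>(a, n). (a [^]\<^bsub>R\<^esub> p, p * n))"
    let ?gs = "map ((+>\<^bsub>R\<^esub>) (PIdl\<^bsub>R\<^esub> x)) fs"
    have FR: "cech_semilinear R (self_module R) R (self_module R) (\<lambda>a. a) p (\<lambda>a. a [^]\<^bsub>R\<^esub> p)
        (\<lambda>(a, n). (a [^]\<^bsub>R\<^esub> p, p * n)) fs"
      by (rule frobenius_semilinear[OF R p fs])
    have gen': "generates ?Q ?gs ((\<lambda>a. PIdl\<^bsub>R\<^esub> x +>\<^bsub>R\<^esub> a) ` \<mm>)"
      by (rule I.generates_quotient[OF R gen idealQ])
    then have gs: "set ?gs \<subseteq> carrier ?Q" by (simp add: generates_def)
    have Q_inj: "c \<in> cech_coboundaries ?Q ?gs (self_module ?Q) k"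
      if "c \<in> cech_cocycles ?Q ?gs (self_module ?Q) k"
        "cech_map ?Q ?gs (self_module ?Q) (\<lambda>(a, n). (a [^]\<^bsub>?Q\<^esub> p, p * n)) k c
          \<in> cech_coboundaries ?Q ?gs (self_module ?Q) k" for c k
      using that frobenius_action_inj_iff[OF Q p(1) pQ gs, of k] assms(6) gen'
      unfolding F_injective_def by blast
    have torsion: "\<exists>n::nat. (x [^]\<^bsub>R\<^esub> n) \<odot>\<^bsub>S.C k\<^esub> c \<in> ?B k" if "c \<in> ?Z k" for c k
      by (rule S.power_torsion[OF p that xfs])
    have regS: "m = \<zero>\<^bsub>self_module R\<^esub>" if "m \<in> carrier (self_module R)" "x \<odot>\<^bsub>self_module R\<^esub> m = \<zero>\<^bsub>self_module R\<^esub>" for m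
      using that reg[of m] by simp
    \<comment> \<open>A torsion class in degree 0 is a cochain killed by a power of
      \<open>x\<close>, as zero is the only coboundary there; regularity removes the factors one by
      one.\<close>
    have degree_0: "c = \<zero>\<^bsub>S.C 0\<^esub>" if c: "c \<in> ?Z 0" for c
    proof -
      interpret C: module R "S.C 0" by (rule S.C_module)
      have cC: "c \<in> carrier (S.C 0)" using c by (simp add: cech_cocycles_def)
      obtain n where "(x [^]\<^bsub>R\<^esub> (n::nat)) \<odot>\<^bsub>S.C 0\<^esub> c = \<zero>\<^bsub>S.C 0\<^esub>"
        using torsion[OF c] by (auto simp: cech_coboundaries_def)
      then show ?thesis
        using cC
      proof (induction n arbitrary: c)
        case (Suc n)
        have xc: "x \<odot>\<^bsub>S.C 0\<^esub> c = \<zero>\<^bsub>S.C 0\<^esub>"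
          by (rule Suc.IH) (use x Suc.prems in \<open>simp_all add: C.smult_assoc1\<close>)
        show ?case
          by (rule S.smult_cancel[OF x regS Suc.prems(2) xc])
      qed simp
    qed
    have divisible: "\<exists>b\<in>?B k. \<exists>\<zeta>\<in>carrier (S.C k). \<eta> = b \<oplus>\<^bsub>S.C k\<^esub> x \<odot>\<^bsub>S.C k\<^esub> \<zeta>"
      if \<eta>: "\<eta> \<in> ?Z k" for \<eta> k
    proof (cases k)
      case 0
      interpret C: module R "S.C 0" by (rule S.C_module)
      show ?thesis
        using degree_0[of \<eta>] \<eta> 0 x
        by (intro bexI[of _ "\<zero>\<^bsub>S.C k\<^esub>"]) (simp_all add: cech_coboundaries_def)
    next
      \<comment> \<open>Divisibility in degree \<open>k' + 1\<close> uses surjectivity in degree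
        \<open>k'\<close>, for the quotients by the powers \<open>x^(l+1)\<close>, whose exponents
        are positive.\<close>
      case (Suc k')
      have lift: "\<exists>\<alpha>\<in>?B k'. \<exists>\<beta>\<in>carrier (S.C k'). \<exists>\<zeta>'\<in>carrier (S.C (Suc k')).
          cech_diff R fs (self_module R) k' (\<theta> \<oplus>\<^bsub>S.C k'\<^esub> \<alpha> \<oplus>\<^bsub>S.C k'\<^esub> x \<odot>\<^bsub>S.C k'\<^esub> \<beta>)
            = (x [^]\<^bsub>R\<^esub> Suc l) \<odot>\<^bsub>S.C (Suc k')\<^esub> \<zeta>'"
        if "\<theta> \<in> carrier (S.C k')" "\<zeta> \<in> carrier (S.C (Suc k'))"
          "cech_diff R fs (self_module R) k' \<theta> = x \<odot>\<^bsub>S.C (Suc k')\<^esub> \<zeta>" for \<theta> \<zeta> l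
      proof (rule cocycle_lift[OF R fs x _ _ _ that])
        show "x [^]\<^bsub>R\<^esub> Suc l \<in> carrier R" using x by simp
        have "x [^]\<^bsub>R\<^esub> Suc l \<in> PIdl\<^bsub>R\<^esub> x" unfolding cgenideal_def nat_pow_Suc using x by blast
        then show "PIdl\<^bsub>R\<^esub> (x [^]\<^bsub>R\<^esub> Suc l) \<subseteq> PIdl\<^bsub>R\<^esub> x"
          by (rule cgenideal_minimal[OF I.is_ideal])
      qed (rule assms(7)[OF gen zero_less_Suc])
      obtain n where "(x [^]\<^bsub>R\<^esub> (n::nat)) \<odot>\<^bsub>S.C k\<^esub> \<eta> \<in> ?B k"
        using torsion[OF \<eta>] by blast
      then have n: "(x [^]\<^bsub>R\<^esub> n) \<odot>\<^bsub>S.C (Suc k')\<^esub> \<eta> \<in> ?B (Suc k')" and \<eta>': "\<eta> \<in> ?Z (Suc k')"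
        using \<eta> Suc by simp_all
      show ?thesis
        unfolding Suc
        by (rule S.cocycle_mod_coboundaries_divisible[OF x _ _ \<eta>' n]) (erule (1) regS, erule (2) lift)
    qed
    have "c \<in> ?B i" if c: "c \<in> ?Z i" and Fc: "?F i c \<in> ?B i" for c
    proof (cases i)
      case 0
      then show ?thesis using degree_0[of c] c Fc by (simp add: cech_coboundaries_def)
    next
      case (Suc k)
      interpret C: module R "S.C (Suc k)" by (rule S.C_module)
      have cZ: "c \<in> ?Z (Suc k)" and cF: "?F (Suc k) c \<in> ?B (Suc k)"
        using c Fc Suc by simp_all
      obtain n where "(x [^]\<^bsub>R\<^esub> (n::nat)) \<odot>\<^bsub>S.C (Suc k)\<^esub> c \<in> ?B (Suc k)"
        using torsion[OF cZ] by blast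
      \<comment> \<open>Descent on the exponent with \<open>c\<close> fixed: the cocycle
        \<open>\<xi> = x^n c\<close> has \<open>x \<xi>\<close> a coboundary, and
        \<open>F \<xi> = x^(n p) F c\<close> is still one, so the previous lemma brings
        \<open>n + 1\<close> down to \<open>n\<close>.\<close>
      then have "c \<in> ?B (Suc k)"
      proof (induction n)
        case 0
        then show ?case using cZ by (simp add: cech_cocycles_def)
      next
        case (Suc n)
        have cC: "c \<in> carrier (S.C (Suc k))" using cZ by (simp add: cech_cocycles_def)
        let ?\<xi> = "(x [^]\<^bsub>R\<^esub> n) \<odot>\<^bsub>S.C (Suc k)\<^esub> c"
        have \<xi>Z: "?\<xi> \<in> ?Z (Suc k)"
          using cZ x S.diff_smult[of "x [^]\<^bsub>R\<^esub> n" c "Suc k"] module.smult_r_null[OF S.C_module[of "Suc (Suc k)"]]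
          by (simp add: cech_cocycles_def)
        have F\<xi>: "?F (Suc k) ?\<xi> \<in> ?B (Suc k)"
          using cech_semilinear.map_smult[OF FR, of "x [^]\<^bsub>R\<^esub> n" c "Suc k"] S.coboundaries_smult[OF _ cF] x cC by simp
        have x\<xi>: "x \<odot>\<^bsub>S.C (Suc k)\<^esub> ?\<xi> \<in> ?B (Suc k)"
          using Suc.prems x cC C.smult_assoc1[of x "x [^]\<^bsub>R\<^esub> n" c] m_comm[of "x [^]\<^bsub>R\<^esub> n" x] by simp
        have "?\<xi> \<in> ?B (Suc k)"
          by (rule frobenius_regular_descent[OF R p pQ fs assms(5) _ _ \<xi>Z F\<xi> x\<xi>])
            (erule (1) Q_inj, erule divisible)
        then show ?case by (rule Suc.IH)
      qed
      then show ?thesis using Suc by simp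
    qed
    then show ?thesis
      using frobenius_action_inj_iff[OF R p fs, of i] by blast
  qed
  then show ?thesis
    using assms(1-3) by (simp add: F_injective_def)
qed

end
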